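(* Let $\nu>0$ and consider the curve $(t,t^{1+\nu})$, $t\in[0,1]$. For every $2\le p\le 6$ and every $\epsilon>0$ there is a constant $C_\epsilon$ such that for all $0<\delta\le 1$ and all integrable $g:[0,1]\to\mathbb{C}$, $$\|E_{[0,1]}g\|_{L^p(\mathbb{R}^2)}\le C_\epsilon\,\delta^{-\epsilon}\left(\sum_{\Delta\in \mathrm{Part}_{\delta^{1/2}}([0,1])}\|E_\Delta g\|_{L^p(\mathbb{R}^2)}^2\right)^{1/2}.$$
   Context: Write $e(z)=e^{2\pi i z}$. For a measurable set $Q\subset[0,1]$, $E_Qg(x_1,x_2)=\int_Q g(t)\,e(x_1t+x_2t^{1+\nu})\,dt$. $\mathrm{Part}_{\delta^{1/2}}([0,1])$ denotes a partition of $[0,1]$ into subintervals of length $\delta^{1/2}$ (if $\delta^{-1/2}$ is not an integer, the last interval may be shorter). The constant $C_\epsilon$ may depend on $\epsilon,p,\nu$, but not on $\delta$ or $g$. Norms are allowed to be infinite. *)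

theory Defs
  imports "HOL-Analysis.Analysis"
begin

definition unit_exp :: "real \<Rightarrow> complex" where
  "unit_exp z = exp (2 * of_real pi * \<i> * of_real z)"

definition extension_op :: "real \<Rightarrow> real set \<Rightarrow> (real \<Rightarrow> complex) \<Rightarrow> real \<times> real \<Rightarrow> complex" where
  "extension_op \<nu> Q g = (\<lambda>(x1, x2).
     (LINT t:Q|lebesgue. g t * unit_exp (x1 * t + x2 * t powr (1 + \<nu>))))"

text \<open>Real powers on \<open>[0, \<infinity>]\<close>; only meant for exponents \<open>a > 0\<close>, so that \<open>\<infinity>\<close> is sent to \<open>\<infinity>\<close>.\<close>

definition ennreal_powr :: "ennreal \<Rightarrow> real \<Rightarrow> ennreal" where
  "ennreal_powr x a = (if x = \<infinity> then \<infinity> else ennreal (enn2real x powr a))"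

text \<open>The \<open>L\<^sup>p\<close> norm for finite \<open>p\<close>; it takes the value \<open>\<infinity>\<close> when \<open>\<bar>f\<bar>\<^sup>p\<close> is not integrable.\<close>

definition Lp_norm :: "real \<Rightarrow> (real \<times> real \<Rightarrow> complex) \<Rightarrow> ennreal" where
  "Lp_norm p f = ennreal_powr (\<integral>\<^sup>+ x. ennreal (norm (f x) powr p) \<partial>lborel) (1 / p)"

text \<open>The partition of \<open>[0,1]\<close> into consecutive intervals of length \<open>s\<close>, for \<open>0 < s \<le> 1\<close>.
  All intervals are half-open, except that the last one is closed and may be shorter.\<close>

definition Part :: "real \<Rightarrow> real set set" where
  "Part s = (let N = nat \<lceil>1 / s\<rceil> in
     (\<lambda>j. if Suc j < N then {real j * s ..< real (Suc j) * s} else {real j * s .. 1}) ` {..<N})"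

end

theory Submission
  imports Defs
begin

text \<open>Let \<open>E\<^sub>j\<close> be the part of \<open>E g\<close> that comes from the \<open>j\<close>-th interval of length
\<open>s = \<delta> powr (1 / 2)\<close>. Group the intervals into the dyadic arcs \<open>2^i \<le> j < 2^(i+1)\<close>. On such an arc the second
derivative of \<open>t powr (1 + \<nu>)\<close> varies by a factor at most \<open>2 powr \<bar>\<nu> - 1\<bar>\<close>, although its size depends on
\<open>i\<close>. All estimates for one arc have constants that depend on this factor only
(\<open>Lp_decoupling\<close>), so the degeneracy or the singularity of the curve at the origin is harmless: there are
\<open>O(log(1/\<delta>))\<close> arcs, and adding them up costs a power of a logarithm.

The norms are taken over the whole plane, and therefore orthogonality is exact, without weights. A function is called
band-limited to a set \<open>B\<close> if it is a limit of trigonometric polynomials with frequencies in \<open>B\<close> and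
bounded coefficient sums; frequency sets add under products, and two square-integrable functions whose
frequencies are separated in some direction are orthogonal (\<open>orthogonal_of_separated_tilt\<close>).

For \<open>p = 6\<close> the argument is efficient congruencing in its decoupling form. Write \<open>F I\<close> for the sum of the
pieces with index in \<open>I\<close>, and measure lengths in numbers of pieces. Let \<open>J\<close> be a block of length \<open>L\<close> and
\<open>I\<close> a block at distance \<open>D\<close> from \<open>J\<close>. In the direction normal to the curve at \<open>J\<close> the frequencies of
\<open>(F J)\<^sup>2\<close> fill an interval of length \<open>O(L\<^sup>2)\<close>, whereas sub-blocks of \<open>I\<close> of length \<open>L\<^sup>2 / D\<close> have frequencies
that are \<open>L\<^sup>2\<close> apart. So the products \<open>F K * (F J)\<^sup>2\<close> over these sub-blocks \<open>K\<close> are almost orthogonal, and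
the integral of \<open>|F I|\<^sup>2 |F J|^4\<close> is bounded by the sum over \<open>K\<close> of the integrals of \<open>|F K|\<^sup>2 |F J|^4\<close>
(\<open>bilinear_orthogonality\<close>). The Cauchy-Schwarz inequality exchanges the roles of \<open>K\<close> and \<open>J\<close> at the price
of one factor \<open>|F J|^6\<close>, for which the induction hypothesis on the number of pieces is available
(\<open>mixed_swap\<close>). Repeating this \<open>N\<close> times with blocks that are shorter than the whole by factors
\<open>2^r, 2^(2r), 2^(4r), ...\<close> gains the factor \<open>2^(\<eta> N r / 2)\<close> over the trivial bound
(\<open>bilinear_iteration\<close>). The reduction to separated blocks (\<open>broad_narrow_step\<close>) loses only \<open>2^(O(r))\<close>, with
an absolute constant in the exponent. Hence a large constant \<open>N\<close>, and then a large constant \<open>r\<close>, close the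
induction with the bound \<open>C * n^\<eta>\<close> for \<open>n\<close> pieces.

For \<open>p = 2\<close> almost orthogonality is enough. For \<open>2 < p < 6\<close> the two endpoint estimates are interpolated.
For this they have to hold for arbitrary functions in place of the pieces: the pieces satisfy
\<open>E\<^sub>j = V\<^sub>j * E\<^sub>j\<close> with a convolution kernel \<open>V\<^sub>j\<close> of bounded mass that is band-limited to a parallelogram around
the \<open>j\<close>-th arc, and the endpoint estimates apply to \<open>V\<^sub>j * h\<^sub>j\<close> for any test functions \<open>h\<^sub>j\<close>. Cutting
\<open>h\<^sub>j\<close> at the heights \<open>2^i c\<^sub>j\<close>, with \<open>c\<^sub>j\<close> proportional to its norm, then gives the estimate for \<open>p\<close>
(\<open>real_interpolation\<close>).\<close>

section \<open>Band-limited functions\<close>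

text \<open>The number \<open>A\<close> bounds the sum of the absolute values of the coefficients. It is part of the predicate
because all limits below are limits of polynomials with a common such bound.\<close>

inductive trig_poly :: "'a::euclidean_space set \<Rightarrow> real \<Rightarrow> ('a \<Rightarrow> complex) \<Rightarrow> bool" for B where
  zero: "0 \<le> A \<Longrightarrow> trig_poly B A (\<lambda>x. 0)"
| add: "trig_poly B A p \<Longrightarrow> \<xi> \<in> B \<Longrightarrow> trig_poly B (A + norm c) (\<lambda>x. p x + c * unit_exp (\<xi> \<bullet> x))"

text \<open>This is a concrete substitute for "the Fourier transform is a measure of mass at most \<open>A\<close> on the closure of
\<open>B\<close>". It is visibly stable under products and conjugation, and an estimate that is linear in \<open>A\<close> only has to
be checked for one exponential.\<close>

definition bandlimited :: "'a::euclidean_space set \<Rightarrow> real \<Rightarrow> ('a \<Rightarrow> complex) \<Rightarrow> bool" where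
  "bandlimited B A f \<longleftrightarrow> (\<exists>p. (\<forall>n::nat. trig_poly B A (p n)) \<and> (\<forall>x. (\<lambda>n. p n x) \<longlonglongrightarrow> f x))"

lemma norm_unit_exp [simp]: "norm (unit_exp t) = 1"
  by (simp add: unit_exp_def norm_exp_eq_Re)

lemma unit_exp_add: "unit_exp (s + t) = unit_exp s * unit_exp t"
  by (simp add: unit_exp_def distrib_left exp_add)

lemma unit_exp_diff: "unit_exp (s - t) = unit_exp s * unit_exp (- t)"
  using unit_exp_add[of s "- t"] by simp

lemma unit_exp_0 [simp]: "unit_exp 0 = 1"
  by (simp add: unit_exp_def)

lemma cnj_unit_exp: "cnj (unit_exp t) = unit_exp (- t)"
  by (simp add: unit_exp_def exp_cnj)

lemma unit_exp_conv_cis: "unit_exp t = cis (2 * pi * t)"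
  by (simp add: unit_exp_def cis_conv_exp mult_ac)

lemma continuous_on_unit_exp [continuous_intros]:
  "continuous_on S f \<Longrightarrow> continuous_on S (\<lambda>x. unit_exp (f x))"
  unfolding unit_exp_def by (intro continuous_intros)

lemma borel_measurable_unit_exp [measurable]: "unit_exp \<in> borel_measurable borel"
  by (intro borel_measurable_continuous_onI continuous_intros)

lemma trig_poly_bound: "trig_poly B A p \<Longrightarrow> norm (p x) \<le> A"
proof (induction rule: trig_poly.induct)
  case (add A p \<xi> c)
  have "norm (p x + c * unit_exp (\<xi> \<bullet> x)) \<le> norm (p x) + norm (c * unit_exp (\<xi> \<bullet> x))"
    by (rule norm_triangle_ineq)
  with add show ?case by (simp add: norm_mult)
qed auto

lemma trig_poly_measurable: "trig_poly B A p \<Longrightarrow> p \<in> borel_measurable borel"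
  by (induction rule: trig_poly.induct) auto

lemma trig_poly_weaken: "trig_poly B A p \<Longrightarrow> A \<le> A' \<Longrightarrow> trig_poly B A' p"
proof (induction arbitrary: A' rule: trig_poly.induct)
  case (add A p \<xi> c)
  have "trig_poly B (A' - norm c) p" using add by auto
  from trig_poly.add[OF this add(2), of c] show ?case by simp
qed (auto intro: trig_poly.intros)

lemma trig_poly_nonneg: "trig_poly B A p \<Longrightarrow> 0 \<le> A"
  by (induction rule: trig_poly.induct) auto

lemma trig_poly_sum:
  assumes "trig_poly B A p" "trig_poly B A' q"
  shows "trig_poly B (A + A') (\<lambda>x. p x + q x)"
  using assms(2)
proof (induction rule: trig_poly.induct)
  case (zero A'')
  then show ?case using trig_poly_weaken[OF assms(1), of "A + A''"] by simp
next
  case (add A'' q' \<xi> c)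
  from trig_poly.add[OF this(3) this(2), of c] show ?case by (simp add: add_ac)
qed

lemma trig_poly_mono: "trig_poly B A p \<Longrightarrow> B \<subseteq> C \<Longrightarrow> trig_poly C A p"
  by (induction rule: trig_poly.induct) (auto intro: trig_poly.intros)

lemma trig_poly_cmult: "trig_poly B A p \<Longrightarrow> trig_poly B (norm c * A) (\<lambda>x. c * p x)"
proof (induction rule: trig_poly.induct)
  case (add A p \<xi> d)
  from trig_poly.add[OF this(3) this(2), of "c * d"] show ?case by (simp add: algebra_simps norm_mult)
qed (auto intro: trig_poly.intros)

lemma trig_poly_mult:
  assumes "trig_poly B A p" "trig_poly C A' q"
  shows "trig_poly {\<xi> + \<eta> |\<xi> \<eta>. \<xi> \<in> B \<and> \<eta> \<in> C} (A * A') (\<lambda>x. p x * q x)"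
  using assms(2)
proof (induction rule: trig_poly.induct)
  case (zero A'')
  then show ?case using trig_poly_nonneg[OF assms(1)] by (auto intro!: trig_poly.intros)
next
  case (add A'' q' \<eta> d)
  have "trig_poly {\<xi> + \<eta> |\<xi> \<eta>. \<xi> \<in> B \<and> \<eta> \<in> C} (A * norm d) (\<lambda>x. p x * (d * unit_exp (\<eta> \<bullet> x)))"
    using assms(1)
  proof (induction rule: trig_poly.induct)
    case zero
    then show ?case by (auto intro: trig_poly.intros)
  next
    case (add A p \<xi> c)
    have "\<xi> + \<eta> \<in> {\<xi> + \<eta> |\<xi> \<eta>. \<xi> \<in> B \<and> \<eta> \<in> C}" using add \<open>\<eta> \<in> C\<close> by auto
    from trig_poly.add[OF add(3) this, of "c * d"]
    show ?case by (simp add: algebra_simps norm_mult unit_exp_add inner_add_left)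
  qed
  from trig_poly_sum[OF add(3) this] show ?case by (simp add: algebra_simps)
qed

lemma trig_poly_cnj: "trig_poly B A p \<Longrightarrow> trig_poly (uminus ` B) A (\<lambda>x. cnj (p x))"
proof (induction rule: trig_poly.induct)
  case (add A p \<xi> c)
  have "- \<xi> \<in> uminus ` B" using add by auto
  from trig_poly.add[OF add(3) this, of "cnj c"] show ?case by (simp add: cnj_unit_exp)
qed (auto intro: trig_poly.intros)

lemma bandlimited_bound: "bandlimited B A f \<Longrightarrow> norm (f x) \<le> A"
  proof -
  assume "bandlimited B A f"
  then obtain p where p: "\<And>n. trig_poly B A (p n)" "\<And>x. (\<lambda>n. p n x) \<longlonglongrightarrow> f x"
    unfolding bandlimited_def by blast
  show ?thesis
    by (rule LIMSEQ_le_const2[OF tendsto_norm[OF p(2)]]) (use trig_poly_bound[OF p(1)] in auto)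
qed

lemma bandlimited_measurable: "bandlimited B A f \<Longrightarrow> f \<in> borel_measurable borel"
proof -
  assume "bandlimited B A f"
  then obtain p where p: "\<And>n. trig_poly B A (p n)" "\<And>x. (\<lambda>n. p n x) \<longlonglongrightarrow> f x"
    unfolding bandlimited_def by blast
  show ?thesis
    by (rule borel_measurable_LIMSEQ_metric[OF trig_poly_measurable[OF p(1)] p(2)])
qed

lemma bandlimited_zero: "bandlimited B 0 (\<lambda>x. 0)"
  unfolding bandlimited_def by (auto intro!: exI[of _ "\<lambda>_ _. 0"] trig_poly.zero)

lemma bandlimited_mono: "bandlimited B A f \<Longrightarrow> B \<subseteq> C \<Longrightarrow> bandlimited C A f"
  unfolding bandlimited_def using trig_poly_mono by blast

lemma bandlimited_add: "bandlimited B A f \<Longrightarrow> bandlimited B A' g \<Longrightarrow> bandlimited B (A + A') (\<lambda>x. f x + g x)"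
  unfolding bandlimited_def
proof (elim exE conjE)
  fix p q :: "nat \<Rightarrow> 'a \<Rightarrow> complex"
  assume "\<forall>n. trig_poly B A (p n)" "\<forall>n. trig_poly B A' (q n)" "\<forall>x. (\<lambda>n. p n x) \<longlonglongrightarrow> f x" "\<forall>x. (\<lambda>n. q n x) \<longlonglongrightarrow> g x"
  then show "\<exists>p. (\<forall>n. trig_poly B (A + A') (p n)) \<and> (\<forall>x. (\<lambda>n. p n x) \<longlonglongrightarrow> f x + g x)"
    by (intro exI[of _ "\<lambda>n x. p n x + q n x"]) (auto intro: trig_poly_sum tendsto_add)
qed

lemma bandlimited_mult:
  "bandlimited B A f \<Longrightarrow> bandlimited C A' g \<Longrightarrow>
    bandlimited {\<xi> + \<eta> |\<xi> \<eta>. \<xi> \<in> B \<and> \<eta> \<in> C} (A * A') (\<lambda>x. f x * g x)"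
  unfolding bandlimited_def
proof (elim exE conjE)
  fix p q :: "nat \<Rightarrow> 'a \<Rightarrow> complex"
  assume "\<forall>n. trig_poly B A (p n)" "\<forall>n. trig_poly C A' (q n)" "\<forall>x. (\<lambda>n. p n x) \<longlonglongrightarrow> f x" "\<forall>x. (\<lambda>n. q n x) \<longlonglongrightarrow> g x"
  then show "\<exists>p. (\<forall>n. trig_poly {\<xi> + \<eta> |\<xi> \<eta>. \<xi> \<in> B \<and> \<eta> \<in> C} (A * A') (p n)) \<and> (\<forall>x. (\<lambda>n. p n x) \<longlonglongrightarrow> f x * g x)"
    by (intro exI[of _ "\<lambda>n x. p n x * q n x"]) (auto intro: trig_poly_mult tendsto_mult)
qed

lemma bandlimited_cnj: "bandlimited B A f \<Longrightarrow> bandlimited (uminus ` B) A (\<lambda>x. cnj (f x))"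
  unfolding bandlimited_def
proof (elim exE conjE)
  fix p :: "nat \<Rightarrow> 'a \<Rightarrow> complex"
  assume "\<forall>n. trig_poly B A (p n)" "\<forall>x. (\<lambda>n. p n x) \<longlonglongrightarrow> f x"
  then show "\<exists>p. (\<forall>n. trig_poly (uminus ` B) A (p n)) \<and> (\<forall>x. (\<lambda>n. p n x) \<longlonglongrightarrow> cnj (f x))"
    by (intro exI[of _ "\<lambda>n x. cnj (p n x)"]) (auto intro: trig_poly_cnj tendsto_cnj)
qed

lemma bandlimited_sum:
  assumes "finite I" "\<And>i. i \<in> I \<Longrightarrow> \<exists>A. bandlimited (B i) A (f i)"
  shows "\<exists>A. bandlimited (\<Union>i\<in>I. B i) A (\<lambda>x. \<Sum>i\<in>I. f i x)"
  using assms
proof (induction I rule: finite_induct)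
  case empty
  then show ?case using bandlimited_zero by auto
next
  case (insert i I)
  from insert.prems obtain A where "bandlimited (B i) A (f i)" by blast
  moreover from insert obtain A' where "bandlimited (\<Union>i\<in>I. B i) A' (\<lambda>x. \<Sum>i\<in>I. f i x)" by blast
  ultimately
  have "bandlimited (\<Union>i\<in>insert i I. B i) A (f i)" "bandlimited (\<Union>i\<in>insert i I. B i) A' (\<lambda>x. \<Sum>i\<in>I. f i x)"
    by (auto elim: bandlimited_mono)
  from bandlimited_add[OF this] show ?case using insert by (auto simp del: UN_insert)
qed

text \<open>Cover \<open>B\<close> by finitely many small balls with centres in \<open>B\<close> and move each frequency \<open>\<Phi> w\<close> to the centre of
the first ball that contains it. The moved integrals are trigonometric polynomials with coefficient sum at most
the mass of \<open>G\<close>, and they converge by dominated convergence.\<close>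

lemma bandlimited_integral:
  fixes \<Phi> :: "'b \<Rightarrow> 'a::euclidean_space"
  assumes [measurable]: "\<Phi> \<in> borel_measurable M" and G: "integrable M (G :: 'b \<Rightarrow> complex)"
    and B: "bounded B" and \<Phi>: "\<And>w. w \<in> space M \<Longrightarrow> G w \<noteq> 0 \<Longrightarrow> \<Phi> w \<in> B"
  shows "\<exists>A. bandlimited B A (\<lambda>x. LINT w|M. G w * unit_exp (\<Phi> w \<bullet> x))"
proof -
  have [measurable]: "G \<in> borel_measurable M" using G by simp
  have "\<exists>\<sigma>. (\<forall>w. norm (\<sigma> w - \<Phi> w) \<le> 1 / Suc n \<or> \<Phi> w \<notin> B) \<and> \<sigma> \<in> borel_measurable M \<and>
     trig_poly B (LINT w|M. norm (G w)) (\<lambda>x. LINT w|M. G w * unit_exp (\<sigma> w \<bullet> x))" for n :: nat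
  proof -
    have "compact (closure B)" using B by (simp add: compact_closure)
    moreover have "closure B \<subseteq> (\<Union>x\<in>B. ball x (1 / Suc n))"
    proof
      fix y assume "y \<in> closure B"
      then obtain x where "x \<in> B" "dist x y < 1 / Suc n"
        unfolding closure_approachable by (metis divide_pos_pos of_nat_0_less_iff zero_less_Suc zero_less_one)
      then show "y \<in> (\<Union>x\<in>B. ball x (1 / Suc n))" by auto
    qed
    ultimately obtain X where X: "X \<subseteq> B" "finite X" "closure B \<subseteq> (\<Union>x\<in>X. ball x (1 / Suc n))"
      using compactE_image[of "closure B" B "\<lambda>x. ball x (1 / real (Suc n))"] open_ball by metis
    have XB: "B \<subseteq> (\<Union>x\<in>X. ball x (1 / Suc n))" using X(3) closure_subset by blast
    from X(2) obtain xs where xs: "set xs = X" using finite_list by blast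
    define c where "c = (\<lambda>i. xs ! i)"
    define D where "D = (\<lambda>i. ball (c i) (1 / Suc n) - (\<Union>j<i. ball (c j) (1 / Suc n)))"
    have Dm [measurable]: "D i \<in> sets borel" for i unfolding D_def by auto
    have Dd: "y \<in> D i \<Longrightarrow> y \<in> D j \<Longrightarrow> i = j" for y i j
      unfolding D_def by (cases i j rule: linorder_cases) auto
    define k where "k = length xs"
    have DB: "\<exists>i<k. y \<in> D i" if "y \<in> B" for y
    proof -
      from that XB obtain x where "x \<in> X" "y \<in> ball x (1 / Suc n)" by blast
      moreover from this xs obtain i where "i < k" "x = c i"
        unfolding k_def c_def by (metis in_set_conv_nth)
      ultimately obtain i where i: "i < k" "y \<in> ball (c i) (1 / Suc n)" by blast
      \<comment> \<open>The first ball that contains \<open>y\<close> is the one whose disjointed part contains it.\<close>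
      define i0 where "i0 = (LEAST i. y \<in> ball (c i) (1 / Suc n))"
      have "i0 \<le> i" "y \<in> ball (c i0) (1 / Suc n)" unfolding i0_def using i by (auto intro: Least_le LeastI)
      moreover have "y \<notin> ball (c j) (1 / Suc n)" if "j < i0" for j
        using that not_less_Least unfolding i0_def by blast
      ultimately show ?thesis using i unfolding D_def by (intro exI[of _ i0]) auto
    qed
    have cB: "c i \<in> B" if "i < k" for i using that X(1) xs unfolding c_def k_def by auto
    \<comment> \<open>The sets \<open>D i\<close> partition \<open>B\<close>, so at most one summand is nonzero.\<close>
    define \<sigma> where "\<sigma> = (\<lambda>w. \<Sum>i<k. indicator (D i) (\<Phi> w) *\<^sub>R c i)"
    have \<sigma>eq: "\<sigma> w = c i" if "i < k" "\<Phi> w \<in> D i" for i w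
    proof -
      have "\<sigma> w = (\<Sum>j<k. if j = i then c i else 0)"
        unfolding \<sigma>_def using that Dd by (intro sum.cong) (auto simp: indicator_def)
      then show ?thesis using that by simp
    qed
    have 1: "norm (\<sigma> w - \<Phi> w) \<le> 1 / Suc n \<or> \<Phi> w \<notin> B" for w
    proof (cases "\<Phi> w \<in> B")
      case True
      then obtain i where i: "i < k" "\<Phi> w \<in> D i" using DB by blast
      with \<sigma>eq have "\<sigma> w = c i" "\<Phi> w \<in> ball (c i) (1 / Suc n)" by (auto simp: D_def)
      then show ?thesis by (auto simp: dist_norm less_imp_le)
    qed auto
    have 2: "\<sigma> \<in> borel_measurable M" unfolding \<sigma>_def by measurable
    have int: "integrable M (\<lambda>w. indicator (D i) (\<Phi> w) *\<^sub>R G w)" for i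
      by (rule Bochner_Integration.integrable_bound[OF G]) (auto simp: indicator_def)
    define C where "C = (\<lambda>i. LINT w|M. indicator (D i) (\<Phi> w) *\<^sub>R G w)"
    have dec1: "(\<Sum>i<k. indicator (D i) (\<Phi> w)) = (1 :: real)" if "\<Phi> w \<in> B" for w
    proof -
      from that obtain i where i: "i < k" "\<Phi> w \<in> D i" using DB by blast
      have "(\<Sum>j<k. indicator (D j) (\<Phi> w)) = (\<Sum>j<k. if j = i then 1 else (0 :: real))"
        using i Dd by (intro sum.cong) (auto simp: indicator_def)
      then show ?thesis using i by simp
    qed
    have eq: "(LINT w|M. G w * unit_exp (\<sigma> w \<bullet> x)) = (\<Sum>i<k. C i * unit_exp (c i \<bullet> x))" for x
    proof -
      have "(LINT w|M. G w * unit_exp (\<sigma> w \<bullet> x)) = (LINT w|M. (\<Sum>i<k. (indicator (D i) (\<Phi> w) *\<^sub>R G w) * unit_exp (c i \<bullet> x)))"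
      proof (rule Bochner_Integration.integral_cong[OF refl])
        fix w assume w: "w \<in> space M"
        show "G w * unit_exp (\<sigma> w \<bullet> x) = (\<Sum>i<k. (indicator (D i) (\<Phi> w) *\<^sub>R G w) * unit_exp (c i \<bullet> x))"
        proof (cases "G w = 0")
          case False
          then have "\<Phi> w \<in> B" using \<Phi> w by auto
          note \<open>\<Phi> w \<in> B\<close>
          then have "G w * unit_exp (\<sigma> w \<bullet> x) = (\<Sum>i<k. indicator (D i) (\<Phi> w) *\<^sub>R (G w * unit_exp (\<sigma> w \<bullet> x)))"
            by (simp only: scaleR_sum_left[symmetric] dec1 scaleR_one)
          also have "\<dots> = (\<Sum>i<k. (indicator (D i) (\<Phi> w) *\<^sub>R G w) * unit_exp (c i \<bullet> x))"
            using \<sigma>eq by (intro sum.cong) (auto simp: indicator_def)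
          finally show ?thesis .
        qed auto
      qed
      also have "\<dots> = (\<Sum>i<k. C i * unit_exp (c i \<bullet> x))"
        unfolding C_def integral_mult_left_zero[symmetric]
        by (rule Bochner_Integration.integral_sum) (rule integrable_mult_left[OF int])
      finally show ?thesis .
    qed
    have tp: "trig_poly B (\<Sum>i<m. norm (C i)) (\<lambda>x. \<Sum>i<m. C i * unit_exp (c i \<bullet> x))" if "m \<le> k" for m
      using that by (induction m) (auto intro!: trig_poly.intros cB)
    have "(\<Sum>i<k. norm (C i)) \<le> (\<Sum>i<k. LINT w|M. indicator (D i) (\<Phi> w) *\<^sub>R norm (G w))"
      unfolding C_def by (intro sum_mono order_trans[OF integral_norm_bound]) simp
    also have "\<dots> = (LINT w|M. (\<Sum>i<k. indicator (D i) (\<Phi> w) *\<^sub>R norm (G w)))"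
      using integrable_norm[OF int] by (subst Bochner_Integration.integral_sum) auto
    also have "\<dots> = (LINT w|M. norm (G w))"
    proof (rule Bochner_Integration.integral_cong[OF refl])
      fix w assume "w \<in> space M"
      then show "(\<Sum>i<k. indicator (D i) (\<Phi> w) *\<^sub>R norm (G w)) = norm (G w)"
        using \<Phi>[of w] dec1[of w] by (cases "G w = 0") (simp_all add: sum_distrib_right[symmetric])
    qed
    finally have "trig_poly B (LINT w|M. norm (G w)) (\<lambda>x. LINT w|M. G w * unit_exp (\<sigma> w \<bullet> x))"
      unfolding eq by (rule trig_poly_weaken[OF tp[OF order_refl]])
    with 1 2 show ?thesis by blast
  qed
  then have "\<forall>n. \<exists>\<sigma>. (\<forall>w. norm (\<sigma> w - \<Phi> w) \<le> 1 / Suc n \<or> \<Phi> w \<notin> B) \<and> \<sigma> \<in> borel_measurable M \<and>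
     trig_poly B (LINT w|M. norm (G w)) (\<lambda>x. LINT w|M. G w * unit_exp (\<sigma> w \<bullet> x))" by blast
  from choice[OF this] obtain \<sigma> where \<sigma>: "\<And>n w. norm (\<sigma> n w - \<Phi> w) \<le> 1 / Suc n \<or> \<Phi> w \<notin> B"
     "\<And>n. \<sigma> n \<in> borel_measurable M"
     "\<And>n. trig_poly B (LINT w|M. norm (G w)) (\<lambda>x. LINT w|M. G w * unit_exp (\<sigma> n w \<bullet> x))"
    by blast
  note [measurable] = \<sigma>(2)
  have "(\<lambda>n. LINT w|M. G w * unit_exp (\<sigma> n w \<bullet> x)) \<longlonglongrightarrow> (LINT w|M. G w * unit_exp (\<Phi> w \<bullet> x))" for x
  proof (rule integral_dominated_convergence[where w = "\<lambda>w. norm (G w)"])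
    show "AE w in M. (\<lambda>n. G w * unit_exp (\<sigma> n w \<bullet> x)) \<longlonglongrightarrow> G w * unit_exp (\<Phi> w \<bullet> x)"
    proof (rule AE_I2)
      fix w assume w: "w \<in> space M"
      show "(\<lambda>n. G w * unit_exp (\<sigma> n w \<bullet> x)) \<longlonglongrightarrow> G w * unit_exp (\<Phi> w \<bullet> x)"
      proof (cases "G w = 0")
        case False
        with \<Phi> w have "\<Phi> w \<in> B" by auto
        with \<sigma>(1) have b: "norm (\<sigma> n w - \<Phi> w) \<le> 1 / Suc n" for n by blast
        have "(\<lambda>n. \<sigma> n w - \<Phi> w) \<longlonglongrightarrow> 0"
          by (rule Lim_null_comparison[OF always_eventually LIMSEQ_inverse_real_of_nat])
             (use b in \<open>simp add: inverse_eq_divide\<close>)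
        then have "(\<lambda>n. \<sigma> n w) \<longlonglongrightarrow> \<Phi> w" by (simp add: LIM_zero_iff)
        then show ?thesis unfolding unit_exp_def by (intro tendsto_intros)
      qed auto
    qed
  qed (use G in \<open>auto simp: norm_mult\<close>)
  with \<sigma>(3) show ?thesis unfolding bandlimited_def
    by (intro exI[of _ "LINT w|M. norm (G w)"] exI[of _ "\<lambda>n x. LINT w|M. G w * unit_exp (\<sigma> n w \<bullet> x)"]) simp
qed

lemma trig_poly_convolution:
  assumes [measurable]: "h \<in> borel_measurable borel" and h: "integrable lborel h" and "trig_poly B A p"
  shows "trig_poly B (A * (LINT y|lborel. norm (h y))) (\<lambda>x. LINT y|lborel. h y * p (x - y))"
  using assms(3)
proof (induction rule: trig_poly.induct)
  case (zero A)
  then show ?case by (auto intro!: trig_poly.intros mult_nonneg_nonneg)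
next
  case (add A p \<xi> c)
  note [measurable] = trig_poly_measurable[OF add(1)]
  define d where "d = c * (LINT y|lborel. h y * unit_exp (- (\<xi> \<bullet> y)))"
  have i1: "integrable lborel (\<lambda>y. h y * p (x - y))" for x
    by (rule Bochner_Integration.integrable_bound[OF integrable_mult_left[OF integrable_norm[OF h], of A]])
       (auto simp: norm_mult intro!: mult_left_mono AE_I2 order_trans[OF _ abs_ge_self] trig_poly_bound[OF add(1)])
  have i2: "integrable lborel (\<lambda>y. h y * unit_exp (- (\<xi> \<bullet> y)))"
    by (rule Bochner_Integration.integrable_bound[OF h]) (auto simp: norm_mult)
  have "norm (LINT y|lborel. h y * unit_exp (- (\<xi> \<bullet> y))) \<le> (LINT y|lborel. norm (h y))"
    by (rule order_trans[OF integral_norm_bound]) (simp add: norm_mult)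
  then have d: "norm d \<le> norm c * (LINT y|lborel. norm (h y))"
    unfolding d_def by (simp add: norm_mult mult_left_mono)
  have "(\<lambda>x. (LINT y|lborel. h y * (p (x - y) + c * unit_exp (\<xi> \<bullet> (x - y))))) =
        (\<lambda>x. (LINT y|lborel. h y * p (x - y)) + d * unit_exp (\<xi> \<bullet> x))"
  proof
    fix x
    have "(LINT y|lborel. h y * (p (x - y) + c * unit_exp (\<xi> \<bullet> (x - y)))) =
       (LINT y|lborel. h y * p (x - y) + (c * unit_exp (\<xi> \<bullet> x)) * (h y * unit_exp (- (\<xi> \<bullet> y))))"
      by (rule Bochner_Integration.integral_cong)
         (simp_all only: inner_diff_right unit_exp_diff distrib_left mult_ac)
    also have "\<dots> = (LINT y|lborel. h y * p (x - y)) + d * unit_exp (\<xi> \<bullet> x)"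
      using i1 i2 by (subst Bochner_Integration.integral_add) (auto simp: d_def)
    finally show "(LINT y|lborel. h y * (p (x - y) + c * unit_exp (\<xi> \<bullet> (x - y)))) =
        (LINT y|lborel. h y * p (x - y)) + d * unit_exp (\<xi> \<bullet> x)" .
  qed
  with trig_poly.add[OF add(3) add(2), of d]
  have "trig_poly B (A * (LINT y|lborel. norm (h y)) + norm d)
     (\<lambda>x. (LINT y|lborel. h y * (p (x - y) + c * unit_exp (\<xi> \<bullet> (x - y)))))" by simp
  from trig_poly_weaken[OF this] d show ?case by (simp add: distrib_right)
qed

text \<open>Convolution with \<open>h\<close> multiplies the coefficient at \<open>\<xi>\<close> by the Fourier transform of \<open>h\<close> at \<open>\<xi>\<close>.\<close>

lemma bandlimited_convolution:
  assumes [measurable]: "h \<in> borel_measurable borel" and h: "integrable lborel h" and "bandlimited B A f"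
  shows "bandlimited B (A * (LINT y|lborel. norm (h y))) (\<lambda>x. LINT y|lborel. h y * f (x - y))"
proof -
  obtain p where p: "\<And>n. trig_poly B A (p n)" "\<And>x. (\<lambda>n. p n x) \<longlonglongrightarrow> f x"
    using assms(3) unfolding bandlimited_def by blast
  note [measurable] = trig_poly_measurable[OF p(1)] bandlimited_measurable[OF assms(3)]
  have "(\<lambda>n. LINT y|lborel. h y * p n (x - y)) \<longlonglongrightarrow> (LINT y|lborel. h y * f (x - y))" for x
    by (rule integral_dominated_convergence[where w = "\<lambda>y. norm (h y) * A"])
       (use h p in \<open>simp_all add: norm_mult tendsto_mult_left mult_left_mono trig_poly_bound[OF p(1)]\<close>)
  with trig_poly_convolution[OF assms(1,2) p(1)] show ?thesis
    unfolding bandlimited_def by (intro exI[of _ "\<lambda>n x. LINT y|lborel. h y * p n (x - y)"]) auto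
qed

section \<open>Orthogonality of functions with separated frequencies\<close>

definition tent :: "real \<Rightarrow> real \<Rightarrow> real" where
  "tent T s = max 0 (1 - \<bar>s\<bar> / T)"

lemma tent_bounds: "T > 0 \<Longrightarrow> 0 \<le> tent T s \<and> tent T s \<le> 1"
  by (auto simp: tent_def)

lemma tent_measurable [measurable]: "tent T \<in> borel_measurable borel"
  unfolding tent_def by measurable

text \<open>The tent is a Fejer weight: it tends to \<open>1\<close> as \<open>T\<close> grows, and the weighted integral of an oscillation of
frequency \<open>\<theta>\<close> decays like \<open>1 / (T \<theta>\<^sup>2)\<close>.\<close>

lemma integral_tent_unit_exp:
  assumes T: "T > 0" and th: "\<theta> \<noteq> 0"
  shows "integrable lborel (\<lambda>s. tent T s *\<^sub>R unit_exp (\<theta> * s))"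
    and "norm (LINT s|lborel. tent T s *\<^sub>R unit_exp (\<theta> * s)) \<le> 4 / (T * (2 * pi * \<theta>)\<^sup>2)"
proof -
  define w where "w = 2 * pi * \<theta>"
  have w: "w \<noteq> 0" using th by (simp add: w_def)
  have ue: "unit_exp (\<theta> * s) = exp (\<i> * w * s)" for s
    by (simp add: unit_exp_def w_def mult_ac)
  define H1 where "H1 = (\<lambda>z::complex. (1 - z / T) * exp (\<i> * w * z) / (\<i> * w) + exp (\<i> * w * z) / (T * (\<i> * w)\<^sup>2))"
  define H2 where "H2 = (\<lambda>z::complex. (1 + z / T) * exp (\<i> * w * z) / (\<i> * w) - exp (\<i> * w * z) / (T * (\<i> * w)\<^sup>2))"
  define G1 where "G1 = (\<lambda>s::real. H1 (of_real s))"
  define G2 where "G2 = (\<lambda>s::real. H2 (of_real s))"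
  have "(H1 has_field_derivative (1 - z / T) * exp (\<i> * w * z)) (at z)" for z :: complex
    unfolding H1_def using w T
    by (auto intro!: derivative_eq_intros simp: field_simps power2_eq_square)
  then have "(G1 has_vector_derivative (1 - complex_of_real s / complex_of_real T) * exp (\<i> * w * of_real s)) (at s within {0..T})" for s
    unfolding G1_def by (rule has_vector_derivative_real_field)
  then have d1: "(G1 has_vector_derivative tent T s *\<^sub>R unit_exp (\<theta> * s)) (at s within {0..T})" if "s \<in> {0..T}" for s
    using that T by (auto simp: tent_def ue scaleR_conv_of_real)
  have "(H2 has_field_derivative (1 + z / T) * exp (\<i> * w * z)) (at z)" for z :: complex
    unfolding H2_def using w T
    by (auto intro!: derivative_eq_intros simp: field_simps power2_eq_square)
  then have "(G2 has_vector_derivative (1 + complex_of_real s / complex_of_real T) * exp (\<i> * w * of_real s)) (at s within {-T..0})" for s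
    unfolding G2_def by (rule has_vector_derivative_real_field)
  moreover have "tent T s = 1 + s / T" if "s \<in> {-T..0}" for s
    using that T by (auto simp: tent_def field_simps)
  ultimately have d2: "(G2 has_vector_derivative tent T s *\<^sub>R unit_exp (\<theta> * s)) (at s within {-T..0})" if "s \<in> {-T..0}" for s
    using that by (simp add: ue scaleR_conv_of_real)
  let ?f = "\<lambda>s. tent T s *\<^sub>R unit_exp (\<theta> * s)"
  have A1: "(?f has_integral (G1 T - G1 0)) {0..T}"
    by (rule fundamental_theorem_of_calculus) (use T d1 in auto)
  have A2: "(?f has_integral (G2 0 - G2 (-T))) {-T..0}"
    by (rule fundamental_theorem_of_calculus) (use T d2 in auto)
  have I: "(?f has_integral ((G2 0 - G2 (-T)) + (G1 T - G1 0))) {-T..T}"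
    by (rule has_integral_combine[OF _ _ A2 A1]) (use T in auto)
  have z: "?f s = 0" if "s \<notin> {-T..T}" for s using that T by (auto simp: tent_def field_simps)
  have I2: "(?f has_integral ((G2 0 - G2 (-T)) + (G1 T - G1 0))) UNIV"
    by (rule has_integral_on_superset[OF I]) (use z in auto)
  have fm: "?f \<in> borel_measurable borel" by measurable
  have int: "integrable lborel (\<lambda>s. indicator {-T..T} s *\<^sub>R (1::real))" using T by simp
  show int: "integrable lborel ?f"
    by (rule Bochner_Integration.integrable_bound[OF int]) (use T in \<open>auto simp: indicator_def tent_def field_simps\<close>)
  have "(LINT s|lborel. ?f s) = (G2 0 - G2 (-T)) + (G1 T - G1 0)"
    using has_integral_integral_lborel[OF int] I2 by (rule has_integral_unique)
  also have "\<dots> = (exp (\<i> * w * (-T)) + exp (\<i> * w * T) - 2) / (T * (\<i> * w)\<^sup>2)"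
    using w T by (simp add: G1_def G2_def H1_def H2_def field_simps)
  also have "norm \<dots> \<le> 4 / (T * w\<^sup>2)"
  proof -
    have e: "norm (exp (\<i> * w * (-T))) = 1" "norm (exp (\<i> * w * T)) = 1" by (simp_all add: norm_exp_eq_Re)
    have "norm (exp (\<i> * w * (-T)) + exp (\<i> * w * T) - 2) \<le> norm (exp (\<i> * w * (-T)) + exp (\<i> * w * T)) + norm (2::complex)"
      by (rule norm_triangle_ineq4)
    also have "norm (exp (\<i> * w * (-T)) + exp (\<i> * w * T)) \<le> 1 + 1"
      using norm_triangle_ineq[of "exp (\<i> * w * (-T))" "exp (\<i> * w * T)"] unfolding e .
    finally have "norm (exp (\<i> * w * (-T)) + exp (\<i> * w * T) - 2) \<le> 4" by simp
    then show ?thesis using T w by (simp add: norm_divide norm_mult norm_power divide_right_mono)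
  qed
  finally show "norm (LINT s|lborel. ?f s) \<le> 4 / (T * (2 * pi * \<theta>)\<^sup>2)" unfolding w_def .
qed

lemma trig_poly_tent:
  fixes B :: "real set"
  assumes T: "T > 0" and \<alpha>: "\<alpha> > 0" and B: "\<And>\<theta>. \<theta> \<in> B \<Longrightarrow> \<bar>\<theta>\<bar> \<ge> \<alpha>" and "trig_poly B A p"
  shows "integrable lborel (\<lambda>s. tent T s *\<^sub>R p s) \<and> norm (LINT s|lborel. tent T s *\<^sub>R p s) \<le> A / (T * \<alpha>\<^sup>2)"
  using assms(4)
proof (induction rule: trig_poly.induct)
  case (zero A)
  then show ?case using T by simp
next
  case (add A p \<theta> c)
  have th: "\<theta> \<noteq> 0" "\<alpha> \<le> \<bar>\<theta>\<bar>" using B[OF add(2)] \<alpha> by auto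
  note * = integral_tent_unit_exp[OF T th(1)]
  have "\<alpha>\<^sup>2 \<le> \<theta>\<^sup>2" using th(2) \<alpha> by (metis abs_le_square_iff abs_of_pos)
  moreover have "1 \<le> pi\<^sup>2" using pi_ge_two by (intro one_le_power) simp
  ultimately have "1 * \<alpha>\<^sup>2 \<le> pi\<^sup>2 * \<theta>\<^sup>2" by (intro mult_mono) auto
  then have "T * (4 * \<alpha>\<^sup>2) \<le> T * (2 * pi * \<theta>)\<^sup>2" using T by (simp add: power_mult_distrib)
  then have "4 / (T * (2 * pi * \<theta>)\<^sup>2) \<le> 4 / (T * (4 * \<alpha>\<^sup>2))" using T \<alpha> th(1)
    by (intro divide_left_mono mult_pos_pos zero_less_power2[THEN iffD2]) auto
  with *(2) have 2: "norm (LINT s|lborel. tent T s *\<^sub>R unit_exp (\<theta> * s)) \<le> 1 / (T * \<alpha>\<^sup>2)" by simp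
  have eq: "(\<lambda>s. tent T s *\<^sub>R (p s + c * unit_exp (\<theta> \<bullet> s))) =
     (\<lambda>s. tent T s *\<^sub>R p s + c * (tent T s *\<^sub>R unit_exp (\<theta> * s)))" by (auto simp: algebra_simps)
  have "norm (c * (LINT s|lborel. tent T s *\<^sub>R unit_exp (\<theta> * s))) \<le> norm c * (1 / (T * \<alpha>\<^sup>2))"
    unfolding norm_mult by (rule mult_left_mono[OF 2]) auto
  then have "norm ((LINT s|lborel. tent T s *\<^sub>R p s) + c * (LINT s|lborel. tent T s *\<^sub>R unit_exp (\<theta> * s)))
       \<le> A / (T * \<alpha>\<^sup>2) + norm c * (1 / (T * \<alpha>\<^sup>2))"
    using add(3) by (intro norm_triangle_mono) auto
  then have "norm (LINT s|lborel. tent T s *\<^sub>R p s + c * (tent T s *\<^sub>R unit_exp (\<theta> * s))) \<le> (A + norm c) / (T * \<alpha>\<^sup>2)"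
    unfolding Bochner_Integration.integral_add[OF conjunct1[OF add(3)] integrable_mult_right[OF *(1), of c]]
      integral_mult_right_zero by (simp add: add_divide_distrib)
  with Bochner_Integration.integrable_add[OF conjunct1[OF add(3)] integrable_mult_right[OF *(1), of c]]
  show ?case unfolding eq by blast
qed

text \<open>Against the tent of width \<open>T\<close> the function has integral \<open>O(1/T)\<close>, because this holds for each exponential;
as \<open>T\<close> tends to infinity these weighted integrals tend to the integral of \<open>h\<close>.\<close>

lemma integral_bandlimited_eq_0:
  fixes B :: "real set"
  assumes \<alpha>: "\<alpha> > 0" and B: "\<And>\<theta>. \<theta> \<in> B \<Longrightarrow> \<bar>\<theta>\<bar> \<ge> \<alpha>" and h: "bandlimited B A h" and int: "integrable lborel h"
  shows "(LINT s|lborel. h s) = 0"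
proof -
  obtain p where p: "\<And>n. trig_poly B A (p n)" "\<And>x. (\<lambda>n. p n x) \<longlonglongrightarrow> h x"
    using h unfolding bandlimited_def by blast
  note [measurable] = trig_poly_measurable[OF p(1)] bandlimited_measurable[OF h]
  have A: "A \<ge> 0" using trig_poly_nonneg[OF p(1)] .
  have ti: "integrable lborel (tent T)" if "T > 0" for T
  proof -
    have int: "integrable lborel (\<lambda>s. indicator {-T..T} s *\<^sub>R (1::real))" using that by simp
    show ?thesis
      by (rule Bochner_Integration.integrable_bound[OF int]) (use that in \<open>auto simp: indicator_def tent_def field_simps\<close>)
  qed
  have b: "norm (LINT s|lborel. tent T s *\<^sub>R h s) \<le> A / (T * \<alpha>\<^sup>2)" if T: "T > 0" for T
  proof -
    have "(\<lambda>n. LINT s|lborel. tent T s *\<^sub>R p n s) \<longlonglongrightarrow> (LINT s|lborel. tent T s *\<^sub>R h s)"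
      by (rule integral_dominated_convergence[where w = "\<lambda>s. tent T s * A"])
         (use p T tent_bounds[OF T] ti[OF T] in \<open>simp_all add: tendsto_scaleR mult_left_mono trig_poly_bound[OF p(1)]\<close>)
    then show ?thesis
      by (rule LIMSEQ_le_const2[OF tendsto_norm]) (use trig_poly_tent[OF T \<alpha> B p(1)] in auto)
  qed
  have "(\<lambda>n. LINT s|lborel. tent (real (Suc n)) s *\<^sub>R h s) \<longlonglongrightarrow> (LINT s|lborel. h s)"
  proof (rule integral_dominated_convergence[where w = "\<lambda>s. norm (h s)"])
    show "AE s in lborel. (\<lambda>n. tent (real (Suc n)) s *\<^sub>R h s) \<longlonglongrightarrow> h s"
    proof (rule AE_I2)
      fix s :: real
      have "(\<lambda>n. 1 - \<bar>s\<bar> / real (Suc n)) \<longlonglongrightarrow> 1 - 0"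
        by (intro tendsto_diff tendsto_const LIMSEQ_Suc[OF lim_const_over_n])
      then have "(\<lambda>n. max 0 (1 - \<bar>s\<bar> / real (Suc n))) \<longlonglongrightarrow> max 0 (1 - 0)"
        by (intro tendsto_max tendsto_const)
      then have "(\<lambda>n. tent (real (Suc n)) s) \<longlonglongrightarrow> 1" by (simp add: tent_def)
      from tendsto_scaleR[OF this tendsto_const, of "h s"]
      show "(\<lambda>n. tent (real (Suc n)) s *\<^sub>R h s) \<longlonglongrightarrow> h s" by simp
    qed
    show "AE s in lborel. norm (tent (real (Suc n)) s *\<^sub>R h s) \<le> norm (h s)" for n
      using tent_bounds[of "real (Suc n)"] by (intro AE_I2) (auto intro!: mult_left_le_one_le)
  qed (use int in auto)
  then have "norm (LINT s|lborel. h s) \<le> 0"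
  proof (rule LIMSEQ_le[OF tendsto_norm])
    have "(\<lambda>n. (A / \<alpha>\<^sup>2) / real (Suc n)) \<longlonglongrightarrow> 0" by (rule LIMSEQ_Suc[OF lim_const_over_n])
    then show "(\<lambda>n. A / (real (Suc n) * \<alpha>\<^sup>2)) \<longlonglongrightarrow> 0" by (simp add: mult.commute)
  qed (use b in auto)
  then show ?thesis by simp
qed

definition shear :: "real \<Rightarrow> real \<times> real \<Rightarrow> real \<times> real" where
  "shear m = (\<lambda>(x1, x2). (x1 - m * x2, x2))"

lemma shear_measurable [measurable]: "shear m \<in> borel_measurable borel"
  unfolding shear_def by (simp add: case_prod_beta' flip: borel_prod)

text \<open>Translation invariance in the first variable, for each fixed value of the second one.\<close>

lemma distr_shear: "distr lborel borel (shear m) = (lborel :: (real \<times> real) measure)"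
proof (rule measure_eqI)
  show "sets (distr lborel borel (shear m)) = sets lborel" by simp
  fix A assume "A \<in> sets (distr lborel borel (shear m))"
  then have [measurable]: "A \<in> sets borel" by simp
  have t: "(\<integral>\<^sup>+x. f (x - c) \<partial>lborel) = (\<integral>\<^sup>+x. f x \<partial>lborel)" if [measurable]: "f \<in> borel_measurable borel" for f :: "real \<Rightarrow> ennreal" and c
    using nn_integral_real_affine[of f 1 "-c"] by simp
  have "emeasure (distr lborel borel (shear m)) A = (\<integral>\<^sup>+z. indicator A (shear m z) \<partial>lborel)"
    by (simp add: nn_integral_distr flip: nn_integral_indicator)
  also have "\<dots> = (\<integral>\<^sup>+z. indicator A (shear m z) \<partial>(lborel \<Otimes>\<^sub>M lborel))" by (simp add: lborel_prod)
  also have "\<dots> = (\<integral>\<^sup>+x2. \<integral>\<^sup>+x1. indicator A (shear m (x1, x2)) \<partial>lborel \<partial>lborel)"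
    by (subst lborel_pair.nn_integral_snd[symmetric]) (simp_all add: lborel_prod)
  also have "\<dots> = (\<integral>\<^sup>+x2. \<integral>\<^sup>+x1. indicator A (x1, x2) \<partial>lborel \<partial>lborel)"
    unfolding shear_def using t[of "\<lambda>x1. indicator A (x1, _)"] by simp
  also have "\<dots> = (\<integral>\<^sup>+z. indicator A z \<partial>(lborel \<Otimes>\<^sub>M lborel))"
    by (subst lborel_pair.nn_integral_snd) (simp_all add: lborel_prod)
  also have "\<dots> = emeasure lborel A" by (simp add: lborel_prod)
  finally show "emeasure (distr lborel borel (shear m)) A = emeasure lborel A" .
qed

lemma integral_shear:
  fixes f :: "real \<times> real \<Rightarrow> 'b::{banach, second_countable_topology}"
  assumes [measurable]: "f \<in> borel_measurable borel"
  shows "(LINT x|lborel. f (shear m x)) = (LINT x|lborel. f x)"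
  using integral_distr[of "shear m" lborel borel f] by (simp add: distr_shear)

lemma integrable_shear:
  fixes f :: "real \<times> real \<Rightarrow> 'b::{banach, second_countable_topology}"
  assumes [measurable]: "f \<in> borel_measurable borel"
  shows "integrable lborel (\<lambda>x. f (shear m x)) = integrable lborel f"
  using integrable_distr_eq[of "shear m" lborel borel f] by (simp add: distr_shear)

text \<open>Up to a constant factor this is the component of \<open>\<xi>\<close> normal to a line of slope \<open>m\<close>; it is the frequency of
\<open>unit_exp (\<xi> \<bullet> x)\<close> along the direction in which the sections of \<open>shear m\<close> run.\<close>

definition tilt :: "real \<Rightarrow> real \<times> real \<Rightarrow> real" where
  "tilt m \<xi> = snd \<xi> - m * fst \<xi>"

lemma tilt_add [simp]: "tilt m (\<xi> + \<eta>) = tilt m \<xi> + tilt m \<eta>"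
  and tilt_minus [simp]: "tilt m (- \<xi>) = - tilt m \<xi>"
  and tilt_diff [simp]: "tilt m (\<xi> - \<eta>) = tilt m \<xi> - tilt m \<eta>"
  by (simp_all add: tilt_def algebra_simps)

lemma trig_poly_section:
  assumes "trig_poly B A p"
  shows "trig_poly (tilt m ` B) A (\<lambda>s. p (shear m (x, s)))"
  using assms
proof (induction rule: trig_poly.induct)
  case (zero A)
  then show ?case by (auto intro!: trig_poly.intros)
next
  case (add A p \<xi> c)
  from trig_poly.add[OF add(3) imageI[OF add(2)], of "c * unit_exp (fst \<xi> * x)"]
  show ?case
    by (cases \<xi>) (simp add: shear_def tilt_def norm_mult algebra_simps flip: unit_exp_add)
qed

lemma bandlimited_section:
  assumes "bandlimited B A f"
  shows "bandlimited (tilt m ` B) A (\<lambda>s. f (shear m (x, s)))"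
proof -
  obtain p where "\<And>n. trig_poly B A (p n)" "\<And>x. (\<lambda>n. p n x) \<longlonglongrightarrow> f x"
    using assms unfolding bandlimited_def by blast
  then show ?thesis
    unfolding bandlimited_def by (intro exI[of _ "\<lambda>n s. p n (shear m (x, s))"]) (auto intro: trig_poly_section)
qed

text \<open>By Fubini in sheared coordinates it is enough to integrate along lines, and almost every line section is
integrable with frequencies bounded away from \<open>0\<close>.\<close>

lemma integral_bandlimited_plane_eq_0:
  assumes \<alpha>: "\<alpha> > 0" and B: "\<And>\<xi>. \<xi> \<in> B \<Longrightarrow> \<bar>tilt m \<xi>\<bar> \<ge> \<alpha>" and f: "bandlimited B A f" and int: "integrable lborel f"
  shows "(LINT x|lborel. f x) = 0"
proof -
  note [measurable] = bandlimited_measurable[OF f]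
  have i: "integrable (lborel \<Otimes>\<^sub>M lborel) (\<lambda>z. f (shear m z))"
    using int by (simp add: lborel_prod integrable_shear)
  have "(LINT x|lborel. f x) = (LINT z|(lborel \<Otimes>\<^sub>M lborel). f (shear m z))"
    by (simp add: lborel_prod integral_shear)
  also have "\<dots> = (LINT x|lborel. LINT s|lborel. f (shear m (x, s)))"
    using lborel_pair.integral_fst'[OF i] by simp
  also have "\<dots> = 0"
  proof (rule integral_eq_zero_AE)
    show "AE x in lborel. (LINT s|lborel. f (shear m (x, s))) = 0"
      using lborel_pair.AE_integrable_fst'[OF i]
    proof eventually_elim
      case (elim x)
      show ?case
        by (rule integral_bandlimited_eq_0[OF \<alpha> _ bandlimited_section[OF f]]) (use B elim in auto)
    qed
  qed
  finally show ?thesis .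
qed

lemma borel_measurable_cnj [measurable]: "cnj \<in> borel_measurable borel"
  by (intro borel_measurable_continuous_onI continuous_intros)

definition square_int :: "('a::euclidean_space \<Rightarrow> complex) \<Rightarrow> bool" where
  "square_int f \<longleftrightarrow> f \<in> borel_measurable borel \<and> integrable lborel (\<lambda>x. norm (f x) ^ 2)"

lemma square_int_mult_integrable:
  assumes "square_int f" "square_int g"
  shows "integrable lborel (\<lambda>x. f x * cnj (g x))"
proof -
  have [measurable]: "f \<in> borel_measurable borel" "g \<in> borel_measurable borel"
    using assms by (auto simp: square_int_def)
  have i: "integrable lborel (\<lambda>x. norm (f x) ^ 2 + norm (g x) ^ 2)" using assms by (auto simp: square_int_def)
  show ?thesis
  proof (rule Bochner_Integration.integrable_bound[OF i])
    show "AE x in lborel. norm (f x * cnj (g x)) \<le> norm (norm (f x) ^ 2 + norm (g x) ^ 2)"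
    proof (rule AE_I2)
      fix x
      have "2 * (norm (f x) * norm (g x)) \<le> norm (f x) ^ 2 + norm (g x) ^ 2"
        using sum_squares_bound[of "norm (f x)" "norm (g x)"] by (simp add: mult_ac)
      moreover have "0 \<le> norm (f x) * norm (g x)" by simp
      ultimately have "norm (f x) * norm (g x) \<le> norm (f x) ^ 2 + norm (g x) ^ 2" by linarith
      then show "norm (f x * cnj (g x)) \<le> norm (norm (f x) ^ 2 + norm (g x) ^ 2)"
        by (simp add: norm_mult)
    qed
  qed measurable
qed

text \<open>The product of \<open>f\<close> and the conjugate of \<open>g\<close> is integrable and its frequencies are differences of the
frequencies of \<open>f\<close> and \<open>g\<close>.\<close>

lemma orthogonal_of_separated_tilt:
  assumes \<alpha>: "\<alpha> > 0" and f: "bandlimited B A f" "square_int f" and g: "bandlimited C A' g" "square_int g"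
    and sep: "\<And>\<xi> \<eta>. \<xi> \<in> B \<Longrightarrow> \<eta> \<in> C \<Longrightarrow> \<bar>tilt m \<xi> - tilt m \<eta>\<bar> \<ge> \<alpha>"
  shows "(LINT x|lborel. f x * cnj (g x)) = 0"
proof (rule integral_bandlimited_plane_eq_0[OF \<alpha>])
  show "bandlimited {\<xi> + \<eta> |\<xi> \<eta>. \<xi> \<in> B \<and> \<eta> \<in> uminus ` C} (A * A') (\<lambda>x. f x * cnj (g x))"
    by (intro bandlimited_mult bandlimited_cnj f g)
  show "\<bar>tilt m \<xi>\<bar> \<ge> \<alpha>" if "\<xi> \<in> {\<xi> + \<eta> |\<xi> \<eta>. \<xi> \<in> B \<and> \<eta> \<in> uminus ` C}" for \<xi>
  proof -
    from that obtain \<xi>' \<eta> where "\<xi> = \<xi>' - \<eta>" "\<xi>' \<in> B" "\<eta> \<in> C" by auto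
    with sep show ?thesis by (simp only: tilt_diff)
  qed
qed (rule square_int_mult_integrable[OF f(2) g(2)])

text \<open>Expand the square. Each \<open>i\<close> has fewer than \<open>2 R\<close> indices \<open>j\<close> for which the mixed term can be nonzero, and such a
term is at most the average of the two diagonal ones.\<close>

lemma almost_orthogonality:
  fixes f :: "nat \<Rightarrow> real \<times> real \<Rightarrow> complex"
  assumes \<alpha>: "\<alpha> > 0" and R: "R \<ge> 1"
    and f: "\<And>i. i < n \<Longrightarrow> \<exists>A. bandlimited (B i) A (f i)" "\<And>i. i < n \<Longrightarrow> square_int (f i)"
    and sep: "\<And>i j \<xi> \<eta>. i < j \<Longrightarrow> j < n \<Longrightarrow> i + R \<le> j \<Longrightarrow> \<xi> \<in> B i \<Longrightarrow> \<eta> \<in> B j \<Longrightarrow> \<bar>tilt m \<xi> - tilt m \<eta>\<bar> \<ge> \<alpha>"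
  shows "(LINT x|lborel. norm (\<Sum>i<n. f i x) ^ 2) \<le> 2 * real R * (\<Sum>i<n. LINT x|lborel. norm (f i x) ^ 2)"
proof -
  let ?I = "\<lambda>i j. LINT x|lborel. f i x * cnj (f j x)"
  let ?N = "\<lambda>i. LINT x|lborel. norm (f i x) ^ 2"
  have sq: "complex_of_real (norm (\<Sum>i<n. f i x) ^ 2) = (\<Sum>i<n. \<Sum>j<n. f i x * cnj (f j x))" for x
    by (simp only: complex_norm_square cnj_sum sum_product)
  have "complex_of_real (LINT x|lborel. norm (\<Sum>i<n. f i x) ^ 2) = (LINT x|lborel. complex_of_real (norm (\<Sum>i<n. f i x) ^ 2))"
    by (rule integral_complex_of_real[symmetric])
  also have "\<dots> = (\<Sum>i<n. \<Sum>j<n. ?I i j)"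
  proof -
    have *: "integrable lborel (\<lambda>x. f i x * cnj (f j x))" if "i < n" "j < n" for i j
      using that by (intro square_int_mult_integrable f(2))
    have "(LINT x|lborel. complex_of_real (norm (\<Sum>i<n. f i x) ^ 2)) = (\<Sum>i<n. LINT x|lborel. (\<Sum>j<n. f i x * cnj (f j x)))"
      unfolding sq by (rule Bochner_Integration.integral_sum) (use * in auto)
    also have "\<dots> = (\<Sum>i<n. \<Sum>j<n. ?I i j)"
      by (intro sum.cong refl Bochner_Integration.integral_sum) (use * in auto)
    finally show ?thesis .
  qed
  finally have 1: "(LINT x|lborel. norm (\<Sum>i<n. f i x) ^ 2) = Re (\<Sum>i<n. \<Sum>j<n. ?I i j)"
    by (metis Re_complex_of_real)
  have z: "?I i j = 0" if ij: "i < n" "j < n" "i + R \<le> j \<or> j + R \<le> i" for i j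
  proof -
    obtain A A' where *: "bandlimited (B i) A (f i)" "bandlimited (B j) A' (f j)"
      using f(1)[OF ij(1)] f(1)[OF ij(2)] by (elim exE)
    show ?thesis
      by (rule orthogonal_of_separated_tilt[OF \<alpha> *(1) f(2)[OF that(1)] *(2) f(2)[OF that(2)], of m])
         (use that R sep[of i j] sep[of j i] in \<open>force simp: abs_minus_commute\<close>)
  qed
  have nb: "Re (?I i j) \<le> (?N i + ?N j) / 2" if "i < n" "j < n" for i j
  proof -
    have ii: "integrable lborel (\<lambda>x. norm (f i x) ^ 2)" "integrable lborel (\<lambda>x. norm (f j x) ^ 2)"
      using f(2) that by (auto simp: square_int_def)
    have "Re (?I i j) = (LINT x|lborel. Re (f i x * cnj (f j x)))"
      by (rule integral_Re[symmetric, OF square_int_mult_integrable[OF f(2)[OF that(1)] f(2)[OF that(2)]]])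
    also have "\<dots> \<le> (LINT x|lborel. (norm (f i x) ^ 2 + norm (f j x) ^ 2) / 2)"
    proof (rule integral_mono)
      show "integrable lborel (\<lambda>x. Re (f i x * cnj (f j x)))"
        using square_int_mult_integrable[OF f(2)[OF that(1)] f(2)[OF that(2)]] by (rule integrable_Re)
      fix x
      have "Re (f i x * cnj (f j x)) \<le> norm (f i x * cnj (f j x))" by (rule complex_Re_le_cmod)
      also have "\<dots> \<le> (norm (f i x) ^ 2 + norm (f j x) ^ 2) / 2"
        using sum_squares_bound[of "norm (f i x)" "norm (f j x)"] by (simp add: norm_mult)
      finally show "Re (f i x * cnj (f j x)) \<le> (norm (f i x) ^ 2 + norm (f j x) ^ 2) / 2" .
    qed (use ii in auto)
    also have "\<dots> = (?N i + ?N j) / 2" using ii by simp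
    finally show ?thesis .
  qed
  define near where "near = (\<lambda>i. {j. j < n \<and> \<not> (i + R \<le> j \<or> j + R \<le> i)})"
  have cn: "real (card (near i)) \<le> 2 * real R" for i
  proof -
    have "near i \<subseteq> {i - (R - 1) ..< i + R}" by (auto simp: near_def)
    then have "card (near i) \<le> card {i - (R - 1) ..< i + R}" by (rule card_mono[rotated]) simp
    also have "\<dots> \<le> 2 * R" using R by simp
    finally show ?thesis by linarith
  qed
  have fin: "finite (near i)" for i by (rule finite_subset[of _ "{..<n}"]) (auto simp: near_def)
  have N0: "?N i \<ge> 0" for i by simp
  have row: "(\<Sum>j<n. Re (?I i j)) \<le> (\<Sum>j<n. if j \<in> near i then (?N i + ?N j) / 2 else 0)" if "i < n" for i
    using z[OF that] nb[OF that] by (intro sum_mono) (auto simp: near_def)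
  have "(LINT x|lborel. norm (\<Sum>i<n. f i x) ^ 2) \<le> (\<Sum>i<n. \<Sum>j<n. if j \<in> near i then (?N i + ?N j) / 2 else 0)"
    unfolding 1 Re_sum by (rule sum_mono) (use row in auto)
  also have "\<dots> = (\<Sum>i<n. \<Sum>j<n. if j \<in> near i then ?N i / 2 else 0) + (\<Sum>i<n. \<Sum>j<n. if j \<in> near i then ?N j / 2 else 0)"
    by (simp only: sum.distrib[symmetric]) (intro sum.cong refl, auto simp: add_divide_distrib)
  also have "(\<Sum>i<n. \<Sum>j<n. if j \<in> near i then ?N j / 2 else 0) = (\<Sum>j<n. \<Sum>i<n. if j \<in> near i then ?N j / 2 else 0)"
    by (rule sum.swap)
  also have "\<dots> = (\<Sum>i<n. \<Sum>j<n. if j \<in> near i then ?N i / 2 else 0)"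
    by (intro sum.cong refl if_cong) (auto simp: near_def)
  also have "(\<Sum>i<n. \<Sum>j<n. if j \<in> near i then ?N i / 2 else 0) = (\<Sum>i<n. real (card (near i)) * (?N i / 2))"
  proof (rule sum.cong[OF refl])
    fix i assume "i \<in> {..<n}"
    have "{j \<in> {..<n}. j \<in> near i} = near i" by (auto simp: near_def)
    then show "(\<Sum>j<n. if j \<in> near i then ?N i / 2 else 0) = real (card (near i)) * (?N i / 2)"
      by (simp add: sum.If_cases Int_def)
  qed
  also have "\<dots> \<le> (\<Sum>i<n. (2 * real R) * (?N i / 2))"
    using cn N0 by (intro sum_mono mult_right_mono) auto
  finally show ?thesis by (simp add: sum_distrib_left[symmetric] sum_divide_distrib[symmetric])
qed

section \<open>Elementary inequalities\<close>

definition L6 :: "('a::euclidean_space \<Rightarrow> complex) \<Rightarrow> bool" where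
  "L6 f \<longleftrightarrow> f \<in> borel_measurable borel \<and> integrable lborel (\<lambda>x. norm (f x) ^ 6)"

lemma norm_sum_powr_le:
  fixes z :: "'i \<Rightarrow> complex"
  assumes "finite I" "p > 0"
  shows "norm (\<Sum>i\<in>I. z i) powr p \<le> real (card I) powr p * (\<Sum>i\<in>I. norm (z i) powr p)"
proof (cases "I = {}")
  case False
  obtain k where k: "k \<in> I" "\<And>i. i \<in> I \<Longrightarrow> norm (z i) \<le> norm (z k)"
  proof -
    have "Max ((\<lambda>i. norm (z i)) ` I) \<in> (\<lambda>i. norm (z i)) ` I" using assms False by (intro Max_in) auto
    then obtain k where "k \<in> I" "norm (z k) = Max ((\<lambda>i. norm (z i)) ` I)" by auto
    then show ?thesis using assms by (intro that[of k]) auto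
  qed
  have "norm (\<Sum>i\<in>I. z i) \<le> (\<Sum>i\<in>I. norm (z k))"
    by (rule order_trans[OF norm_sum]) (intro sum_mono k)
  then have "norm (\<Sum>i\<in>I. z i) powr p \<le> (real (card I) * norm (z k)) powr p"
    using assms by (intro powr_mono2) auto
  also have "\<dots> = real (card I) powr p * norm (z k) powr p" by (simp add: powr_mult)
  also have "\<dots> \<le> real (card I) powr p * (\<Sum>i\<in>I. norm (z i) powr p)"
    using assms k by (intro mult_left_mono member_le_sum) auto
  finally show ?thesis .
qed (use assms in auto)

lemma norm_sum_power_le:
  fixes z :: "'i \<Rightarrow> complex"
  assumes "finite I" "n \<ge> 1"
  shows "norm (\<Sum>i\<in>I. z i) ^ n \<le> real (card I) ^ n * (\<Sum>i\<in>I. norm (z i) ^ n)"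
  using norm_sum_powr_le[of I "real n" z] assms by (simp add: powr_realpow')

lemma L6_sum:
  assumes "finite I" "\<And>i. i \<in> I \<Longrightarrow> L6 (f i)"
  shows "L6 (\<lambda>x. \<Sum>i\<in>I. f i x)"
proof -
  have [measurable]: "\<And>i. i \<in> I \<Longrightarrow> f i \<in> borel_measurable borel" using assms by (auto simp: L6_def)
  have "integrable lborel (\<lambda>x. real (card I) ^ 6 * (\<Sum>i\<in>I. norm (f i x) ^ 6))"
    using assms by (intro integrable_mult_right Bochner_Integration.integrable_sum) (auto simp: L6_def)
  then have "integrable lborel (\<lambda>x. norm (\<Sum>i\<in>I. f i x) ^ 6)"
    by (rule Bochner_Integration.integrable_bound)
       (auto intro!: AE_I2 order_trans[OF norm_sum_power_le] assms sum_nonneg)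
  then show ?thesis by (simp add: L6_def)
qed

lemma mixed_power_le: "0 \<le> a \<Longrightarrow> 0 \<le> b \<Longrightarrow> a ^ i * b ^ j \<le> a ^ (i + j) + b ^ (i + j)" for a b :: real
proof (cases "a \<le> b")
  case True
  assume "0 \<le> a" "0 \<le> b"
  then have "a ^ i * b ^ j \<le> b ^ i * b ^ j" using True by (intro mult_right_mono power_mono) auto
  then show ?thesis using \<open>0 \<le> a\<close> by (simp add: power_add add_increasing)
next
  case False
  assume "0 \<le> a" "0 \<le> b"
  then have "a ^ i * b ^ j \<le> a ^ i * a ^ j" using False by (intro mult_left_mono power_mono) auto
  then show ?thesis using \<open>0 \<le> b\<close> by (simp add: power_add add_increasing2)
qed

lemma L6_mixed:
  assumes "L6 f" "L6 g" "i + j = 6"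
  shows "integrable lborel (\<lambda>x. norm (f x) ^ i * norm (g x) ^ j)"
proof -
  have [measurable]: "f \<in> borel_measurable borel" "g \<in> borel_measurable borel" using assms by (auto simp: L6_def)
  have "integrable lborel (\<lambda>x. norm (f x) ^ 6 + norm (g x) ^ 6)" using assms by (auto simp: L6_def)
  then show ?thesis
    by (rule Bochner_Integration.integrable_bound)
       (use mixed_power_le[of "norm (f _)" "norm (g _)" i j] assms(3) in \<open>auto intro!: AE_I2\<close>)
qed

lemma Cauchy_Schwarz_integral:
  fixes f g :: "'a \<Rightarrow> real"
  assumes [measurable]: "f \<in> borel_measurable M" "g \<in> borel_measurable M"
    and "integrable M (\<lambda>x. f x ^ 2)" "integrable M (\<lambda>x. g x ^ 2)"
  shows "(LINT x|M. f x * g x)\<^sup>2 \<le> (LINT x|M. f x ^ 2) * (LINT x|M. g x ^ 2)"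
proof -
  have i: "integrable M (\<lambda>x. f x * g x)"
  proof (rule Bochner_Integration.integrable_bound[OF Bochner_Integration.integrable_add[OF assms(3,4)]])
    show "AE x in M. norm (f x * g x) \<le> norm (f x ^ 2 + g x ^ 2)"
    proof (rule AE_I2)
      fix x
      have "2 * (\<bar>f x\<bar> * \<bar>g x\<bar>) \<le> f x ^ 2 + g x ^ 2"
        using sum_squares_bound[of "\<bar>f x\<bar>" "\<bar>g x\<bar>"] by (simp add: mult_ac)
      moreover have "0 \<le> \<bar>f x\<bar> * \<bar>g x\<bar>" by simp
      ultimately have "\<bar>f x\<bar> * \<bar>g x\<bar> \<le> f x ^ 2 + g x ^ 2" by linarith
      then show "norm (f x * g x) \<le> norm (f x ^ 2 + g x ^ 2)" by (simp add: abs_mult)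
    qed
  qed measurable
  let ?a = "LINT x|M. f x ^ 2" and ?b = "LINT x|M. f x * g x" and ?c = "LINT x|M. g x ^ 2"
  have q: "0 \<le> ?a * s\<^sup>2 - 2 * ?b * s * t + ?c * t\<^sup>2" for s t
  proof -
    have "0 \<le> (LINT x|M. (f x * s - g x * t) ^ 2)" by simp
    also have "\<dots> = (LINT x|M. f x ^ 2 * s\<^sup>2 - (f x * g x) * (2 * s * t) + g x ^ 2 * t\<^sup>2)"
      by (rule Bochner_Integration.integral_cong) (auto simp: power2_eq_square algebra_simps)
    also have "\<dots> = ?a * s\<^sup>2 - ?b * (2 * s * t) + ?c * t\<^sup>2"
      using i assms(3,4) by simp
    finally show ?thesis by (simp add: mult_ac)
  qed
  have c0: "?c \<ge> 0" "?a \<ge> 0" by simp_all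
  show ?thesis
  proof (cases "?c = 0")
    case True
    have "?b = 0"
    proof (rule ccontr)
      assume "?b \<noteq> 0"
      have "2 * ?b * t \<le> ?a" for t using q[of 1 t] True by (simp add: mult_ac)
      from this[of "(?a + 1) / (2 * ?b)"] \<open>?b \<noteq> 0\<close> show False by simp
    qed
    then show ?thesis using True by simp
  next
    case False
    then have c: "?c > 0" using c0(1) by linarith
    have "0 \<le> ?c * (?a * ?c - ?b\<^sup>2)" using q[of ?c ?b] by (simp add: power2_eq_square algebra_simps)
    then show ?thesis using c by (simp add: zero_le_mult_iff)
  qed
qed

text \<open>Hoelder's inequality with exponents 3 and 3/2, in the form in which the two bounds have a common factor \<open>X\<close>.
Young's inequality for \<open>f / A\<close> and \<open>g / B\<close> gives it for positive \<open>A\<close> and \<open>B\<close>; the general case is a limit.\<close>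

lemma Holder_trilinear:
  fixes f g :: "'a \<Rightarrow> real"
  assumes [measurable]: "f \<in> borel_measurable M" "g \<in> borel_measurable M"
    and pos: "\<And>x. f x \<ge> 0" "\<And>x. g x \<ge> 0"
    and i: "integrable M (\<lambda>x. f x ^ 3)" "integrable M (\<lambda>x. g x ^ 3)"
    and X: "X \<ge> 0" "A \<ge> 0" "B \<ge> 0" and b: "(LINT x|M. f x ^ 3) \<le> X * A ^ 3" "(LINT x|M. g x ^ 3) \<le> X * B ^ 3"
  shows "(LINT x|M. f x * g x ^ 2) \<le> X * (A * B ^ 2)"
proof -
  have strict: "(LINT x|M. f x * g x ^ 2) \<le> X * (A * B ^ 2)" if AB: "A > 0" "B > 0"
    and b: "(LINT x|M. f x ^ 3) \<le> X * A ^ 3" "(LINT x|M. g x ^ 3) \<le> X * B ^ 3" for A B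
  proof -
    have young: "a * b ^ 2 \<le> a ^ 3 / 3 + 2 * b ^ 3 / 3" if "a \<ge> 0" "b \<ge> 0" for a b :: real
    proof -
      have "0 \<le> (a + 2 * b) * (a - b)\<^sup>2" using that by simp
      also have "\<dots> = a ^ 3 + 2 * b ^ 3 - 3 * (a * b ^ 2)" by (simp add: power2_eq_square power3_eq_cube algebra_simps)
      finally show ?thesis by simp
    qed
    have "(LINT x|M. f x * g x ^ 2) \<le> (LINT x|M. (A * B ^ 2) * (f x ^ 3 / (3 * A ^ 3) + 2 * g x ^ 3 / (3 * B ^ 3)))"
    proof (rule integral_mono')
      show "integrable M (\<lambda>x. (A * B ^ 2) * (f x ^ 3 / (3 * A ^ 3) + 2 * g x ^ 3 / (3 * B ^ 3)))"
        using i by auto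
      fix x
      have "(f x / A) * (g x / B) ^ 2 \<le> (f x / A) ^ 3 / 3 + 2 * (g x / B) ^ 3 / 3"
        using AB pos by (intro young divide_nonneg_pos) auto
      then have "(A * B ^ 2) * ((f x / A) * (g x / B) ^ 2) \<le> (A * B ^ 2) * ((f x / A) ^ 3 / 3 + 2 * (g x / B) ^ 3 / 3)"
        using AB by (intro mult_left_mono) auto
      then show "f x * g x ^ 2 \<le> (A * B ^ 2) * (f x ^ 3 / (3 * A ^ 3) + 2 * g x ^ 3 / (3 * B ^ 3))"
        using AB by (simp add: power_divide mult.commute)
      show "0 \<le> (A * B ^ 2) * (f x ^ 3 / (3 * A ^ 3) + 2 * g x ^ 3 / (3 * B ^ 3))"
        using pos AB by simp
    qed
    also have "\<dots> = (A * B ^ 2) * ((LINT x|M. f x ^ 3) / (3 * A ^ 3) + 2 * (LINT x|M. g x ^ 3) / (3 * B ^ 3))"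
      using i by simp
    also have "\<dots> \<le> (A * B ^ 2) * (X * A ^ 3 / (3 * A ^ 3) + 2 * (X * B ^ 3) / (3 * B ^ 3))"
      using AB b by (intro mult_left_mono add_mono divide_right_mono) auto
    also have "\<dots> = X * (A * B ^ 2)" using AB by (simp add: field_simps)
    finally show ?thesis .
  qed
  have "(LINT x|M. f x * g x ^ 2) \<le> X * ((A + 1 / Suc n) * (B + 1 / Suc n) ^ 2)" for n
    using X by (intro strict order_trans[OF b(1)] order_trans[OF b(2)] mult_left_mono power_mono add_nonneg_pos) auto
  moreover have "(\<lambda>n. X * ((A + 1 / Suc n) * (B + 1 / Suc n) ^ 2)) \<longlonglongrightarrow> X * ((A + 0) * (B + 0) ^ 2)"
    by (intro tendsto_intros LIMSEQ_Suc[OF lim_const_over_n])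
  ultimately show ?thesis by (intro LIMSEQ_le_const[where X = "\<lambda>n. X * ((A + 1 / Suc n) * (B + 1 / Suc n) ^ 2)"]) auto
qed

text \<open>Let \<open>z k\<close> be the largest term. Either every term away from \<open>k\<close> is at most \<open>|z k| / n\<close>, and then the sum is
at most \<open>4 |z k|\<close>; or some term \<open>z j\<close> away from \<open>k\<close> is larger, and then \<open>(n |z k|)^6 \<le> n^10 |z k|\<^sup>2 |z j|^4\<close>.
The constant in front of the first sum must not depend on \<open>n\<close>.\<close>

lemma broad_narrow:
  fixes z :: "nat \<Rightarrow> complex"
  assumes "n \<ge> 1"
  shows "norm (\<Sum>i<n. z i) ^ 6 \<le> 4096 * (\<Sum>i<n. norm (z i) ^ 6) +
    real n ^ 10 * (\<Sum>i<n. \<Sum>j<n. if i + 2 \<le> j \<or> j + 2 \<le> i then norm (z i) ^ 2 * norm (z j) ^ 4 else 0)"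
    (is "_ \<le> 4096 * ?N + _ * ?F")
proof -
  obtain k where k: "k < n" "\<And>i. i < n \<Longrightarrow> norm (z i) \<le> norm (z k)"
  proof -
    have "Max ((\<lambda>i. norm (z i)) ` {..<n}) \<in> (\<lambda>i. norm (z i)) ` {..<n}" using assms by (intro Max_in) (auto simp: lessThan_empty_iff)
    then obtain k where "k < n" "norm (z k) = Max ((\<lambda>i. norm (z i)) ` {..<n})" by auto
    then show ?thesis by (intro that[of k]) auto
  qed
  have N: "norm (z k) ^ 6 \<le> ?N" using k by (intro member_le_sum) auto
  have F0: "?F \<ge> 0" by (intro sum_nonneg) auto
  have N0: "?N \<ge> 0" by (intro sum_nonneg) auto
  show ?thesis
  proof (cases "\<exists>j<n. (k + 2 \<le> j \<or> j + 2 \<le> k) \<and> norm (z k) < real n * norm (z j)")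
    case True
    then obtain j where j: "j < n" "k + 2 \<le> j \<or> j + 2 \<le> k" "norm (z k) < real n * norm (z j)" by blast
    have "norm (\<Sum>i<n. z i) \<le> (\<Sum>i<n. norm (z k))"
      by (rule order_trans[OF norm_sum]) (intro sum_mono, use k in auto)
    then have "norm (\<Sum>i<n. z i) ^ 6 \<le> (real n * norm (z k)) ^ 6" by (intro power_mono) auto
    also have "\<dots> = real n ^ 6 * (norm (z k) ^ 2 * norm (z k) ^ 4)"
      by (simp add: power_mult_distrib flip: power_add)
    also have "\<dots> \<le> real n ^ 6 * (norm (z k) ^ 2 * (real n * norm (z j)) ^ 4)"
      using j by (intro mult_left_mono power_mono) auto
    also have "\<dots> = real n ^ 10 * (norm (z k) ^ 2 * norm (z j) ^ 4)"
      by (simp add: power_mult_distrib flip: power_add)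
    also have "norm (z k) ^ 2 * norm (z j) ^ 4 \<le> ?F"
    proof -
      have "norm (z k) ^ 2 * norm (z j) ^ 4 = (if k + 2 \<le> j \<or> j + 2 \<le> k then norm (z k) ^ 2 * norm (z j) ^ 4 else 0)"
        using j by simp
      also have "\<dots> \<le> (\<Sum>j<n. if k + 2 \<le> j \<or> j + 2 \<le> k then norm (z k) ^ 2 * norm (z j) ^ 4 else 0)"
        using j(1) by (intro member_le_sum[of j "{..<n}" "\<lambda>j. if k + 2 \<le> j \<or> j + 2 \<le> k then norm (z k) ^ 2 * norm (z j) ^ 4 else 0"]) auto
      also have "\<dots> \<le> ?F"
        using k(1) by (intro member_le_sum[of k "{..<n}" "\<lambda>i. \<Sum>j<n. if i + 2 \<le> j \<or> j + 2 \<le> i then norm (z i) ^ 2 * norm (z j) ^ 4 else 0"]) (auto intro!: sum_nonneg)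
      finally show ?thesis .
    qed
    finally show ?thesis using N0 by (simp add: mult_left_mono add_increasing)
  next
    case False
    have "norm (z j) \<le> (if j \<in> {k - 1..k + 1} then norm (z k) else 0) + norm (z k) / real n" if "j < n" for j
    proof (cases "j \<in> {k - 1..k + 1}")
      case True
      then show ?thesis using k(2)[OF that] by (simp add: add_increasing2)
    next
      case F: False
      then have "k + 2 \<le> j \<or> j + 2 \<le> k" by auto
      with False that have "real n * norm (z j) \<le> norm (z k)" by force
      then have "norm (z j) \<le> norm (z k) / real n" using assms by (simp add: field_simps)
      then show ?thesis unfolding if_not_P[OF F] by simp
    qed
    then have "(\<Sum>j<n. norm (z j)) \<le> (\<Sum>j<n. (if j \<in> {k - 1..k + 1} then norm (z k) else 0) + norm (z k) / real n)"
      by (intro sum_mono) auto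
    also have "\<dots> = real (card ({..<n} \<inter> {k - 1..k + 1})) * norm (z k) + norm (z k)"
      using assms by (simp add: sum.distrib sum.If_cases del: atLeastAtMost_iff)
    also have "\<dots> \<le> 3 * norm (z k) + norm (z k)"
    proof -
      have "card ({..<n} \<inter> {k - 1..k + 1}) \<le> card {k - 1..k + 1}" by (intro card_mono) auto
      also have "\<dots> \<le> 3" by simp
      finally show ?thesis by (intro add_right_mono mult_right_mono) auto
    qed
    finally have "norm (\<Sum>i<n. z i) \<le> 4 * norm (z k)" using norm_sum[of z "{..<n}"] by simp
    then have "norm (\<Sum>i<n. z i) ^ 6 \<le> (4 * norm (z k)) ^ 6" by (intro power_mono) auto
    also have "\<dots> = 4096 * norm (z k) ^ 6" by (simp add: power_mult_distrib)
    also have "\<dots> \<le> 4096 * ?N" using N by simp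
    finally show ?thesis using F0 by (simp add: add_increasing2)
  qed
qed

lemma sum_cubes_le: "(\<Sum>i\<in>I. a i ^ 3) \<le> (\<Sum>i\<in>I. a i) ^ 3" if "finite I" "\<And>i. i \<in> I \<Longrightarrow> (0::real) \<le> a i"
  using that
proof (induction I rule: finite_induct)
  case (insert i I)
  have s: "0 \<le> (\<Sum>i\<in>I. a i)" "0 \<le> a i" using insert by (auto intro: sum_nonneg)
  have "a i ^ 3 + (\<Sum>i\<in>I. a i) ^ 3 \<le> (a i + (\<Sum>i\<in>I. a i)) ^ 3"
    using s by (simp add: power3_eq_cube algebra_simps)
  then show ?case using insert by simp
qed simp

lemma sum_consecutive_blocks:
  "(\<Sum>j\<in>{q..<q + n * k}. f j) = (\<Sum>i<n. \<Sum>j\<in>{q + i * k..<q + i * k + k}. f j)" for q k n :: nat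
proof (induction n)
  case (Suc n)
  have "{q..<q + Suc n * k} = {q..<q + n * k} \<union> {q + n * k..<q + n * k + k}" by auto
  then have "(\<Sum>j\<in>{q..<q + Suc n * k}. f j) = (\<Sum>j\<in>{q..<q + n * k}. f j) + (\<Sum>j\<in>{q + n * k..<q + n * k + k}. f j)"
    by (simp add: sum.union_disjoint)
  with Suc show ?case by simp
qed simp

definition block :: "nat \<Rightarrow> nat \<Rightarrow> nat set" where
  "block q l = {q..<q + 2 ^ l}"

lemma finite_block [simp]: "finite (block q l)" by (simp add: block_def)

lemma sum_block:
  assumes "\<mu> \<le> l"
  shows "(\<Sum>j\<in>block q l. f j) = (\<Sum>i<2 ^ (l - \<mu>). \<Sum>j\<in>block (q + i * 2 ^ \<mu>) \<mu>. f j)"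
  using sum_consecutive_blocks[of f q "2 ^ (l - \<mu>)" "2 ^ \<mu>"] assms
  by (simp add: block_def flip: power_add)

lemma block_subset:
  assumes "\<mu> \<le> l" "i < 2 ^ (l - \<mu>)"
  shows "block (q + i * 2 ^ \<mu>) \<mu> \<subseteq> block q l"
proof -
  have "(i + 1) * 2 ^ \<mu> \<le> 2 ^ (l - \<mu>) * (2 ^ \<mu> :: nat)" using assms by (intro mult_right_mono) auto
  also have "\<dots> = 2 ^ l" using assms by (simp flip: power_add)
  finally show ?thesis by (auto simp: block_def)
qed

text \<open>The set \<open>I\<close> lies on one side of \<open>J\<close>: the normal component at \<open>J\<close> is monotone along the curve only on each side
of \<open>J\<close> separately.\<close>

definition far :: "nat \<Rightarrow> nat set \<Rightarrow> nat set \<Rightarrow> bool" where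
  "far D I J \<longleftrightarrow> (\<forall>i\<in>I. \<forall>j\<in>J. i + D \<le> j) \<or> (\<forall>i\<in>I. \<forall>j\<in>J. j + D \<le> i)"

lemma far_sym: "far D I J \<Longrightarrow> far D J I" by (auto simp: far_def)
lemma far_subset: "far D I J \<Longrightarrow> I' \<subseteq> I \<Longrightarrow> far D I' J" unfolding far_def by blast

lemma square_int_trilinear:
  assumes "L6 g" "L6 h"
  shows "square_int (\<lambda>x. g x * (h x * h x))"
proof -
  have [measurable]: "g \<in> borel_measurable borel" "h \<in> borel_measurable borel"
    using assms by (auto simp: L6_def)
  have "(\<lambda>x. norm (g x * (h x * h x)) ^ 2) = (\<lambda>x. norm (g x) ^ 2 * norm (h x) ^ 4)"
    by (simp add: norm_mult power_mult_distrib flip: power_add)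
  then show ?thesis using L6_mixed[OF assms, of 2 4] by (simp add: square_int_def)
qed

section \<open>Bilinear orthogonality for pieces along a curve\<close>

text \<open>The geometry that all orthogonality arguments use. The set \<open>B j\<close> contains the frequencies of the \<open>j\<close>-th piece
and \<open>m q\<close> is the slope of the curve at the \<open>q\<close>-th one. In the direction normal to the curve at \<open>q\<close>, \<open>L\<close>
consecutive pieces starting at \<open>q\<close> occupy an interval of length \<open>O(L\<^sup>2)\<close>, and two pieces on the same side of
\<open>q\<close> are separated in proportion to their mutual distance and to the distance from \<open>q\<close>. The unit \<open>u\<close> absorbs
the curvature and the length of the pieces, so that only \<open>\<kappa>\<close> enters the constants.\<close>

locale tangent_separated =
  fixes U :: "nat set" and B :: "nat \<Rightarrow> (real \<times> real) set" and m :: "nat \<Rightarrow> real" and u :: real and \<kappa> :: nat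
  assumes unit_pos: "u > 0" and kappa_pos: "\<kappa> \<ge> 1"
    and tangent: "\<And>q j j' \<xi> \<xi>' L. \<lbrakk>q \<in> U; j \<in> U; j' \<in> U; q \<le> j; j < q + L; q \<le> j'; j' < q + L; \<xi> \<in> B j; \<xi>' \<in> B j'\<rbrakk>
      \<Longrightarrow> \<bar>tilt (m q) \<xi> - tilt (m q) \<xi>'\<bar> \<le> real \<kappa> * u * real L ^ 2"
    and right: "\<And>q j j' \<xi> \<xi>'. \<lbrakk>q \<in> U; j \<in> U; j' \<in> U; q \<le> j; j + \<kappa> \<le> j'; \<xi> \<in> B j; \<xi>' \<in> B j'\<rbrakk>
      \<Longrightarrow> u * (real (j - q) + 1) * real (j' - j) \<le> \<bar>tilt (m q) \<xi> - tilt (m q) \<xi>'\<bar>"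
    and left: "\<And>q j j' \<xi> \<xi>'. \<lbrakk>q \<in> U; j \<in> U; j' \<in> U; j' \<le> q; j + \<kappa> \<le> j'; \<xi> \<in> B j; \<xi>' \<in> B j'\<rbrakk>
      \<Longrightarrow> u * (real (q - j') + 1) * real (j' - j) \<le> \<bar>tilt (m q) \<xi> - tilt (m q) \<xi>'\<bar>"

text \<open>The number \<open>S j\<close> stands for the square of the \<open>L^6\<close> norm of \<open>f j\<close>; a bound in place of equality avoids cube
roots.\<close>

locale L6_family = tangent_separated +
  fixes f :: "nat \<Rightarrow> real \<times> real \<Rightarrow> complex" and S :: "nat \<Rightarrow> real"
  assumes bandlimited: "j \<in> U \<Longrightarrow> \<exists>A. bandlimited (B j) A (f j)"
    and L6: "j \<in> U \<Longrightarrow> L6 (f j)"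
    and S_nonneg: "0 \<le> S j"
    and S_bound: "j \<in> U \<Longrightarrow> (LINT x|lborel. norm (f j x) ^ 6) \<le> S j ^ 3"
begin

definition F :: "nat set \<Rightarrow> real \<times> real \<Rightarrow> complex" where
  "F I x = (\<Sum>j\<in>I. f j x)"

definition T :: "nat set \<Rightarrow> real" where
  "T I = (\<Sum>j\<in>I. S j)"

definition norm6 :: "nat set \<Rightarrow> real" where
  "norm6 I = (LINT x|lborel. norm (F I x) ^ 6)"

definition mixed :: "nat set \<Rightarrow> nat set \<Rightarrow> real" where
  "mixed I J = (LINT x|lborel. norm (F I x) ^ 2 * norm (F J x) ^ 4)"

lemma T_nonneg: "0 \<le> T I" unfolding T_def by (intro sum_nonneg S_nonneg)

lemma T_block: "\<mu> \<le> l \<Longrightarrow> T (block q l) = (\<Sum>i<2 ^ (l - \<mu>). T (block (q + i * 2 ^ \<mu>) \<mu>))"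
  unfolding T_def by (rule sum_block)

lemma F_block: "\<mu> \<le> l \<Longrightarrow> F (block q l) x = (\<Sum>i<2 ^ (l - \<mu>). F (block (q + i * 2 ^ \<mu>) \<mu>) x)"
  unfolding F_def by (rule sum_block)

lemma L6_F: "finite I \<Longrightarrow> I \<subseteq> U \<Longrightarrow> L6 (F I)"
  unfolding F_def using L6_sum[of I f] L6 by blast

lemma bandlimited_F: "finite I \<Longrightarrow> I \<subseteq> U \<Longrightarrow> \<exists>A. bandlimited (\<Union>j\<in>I. B j) A (F I)"
  unfolding F_def using bandlimited_sum[of I B f] bandlimited by blast

lemma F_measurable: "finite I \<Longrightarrow> I \<subseteq> U \<Longrightarrow> F I \<in> borel_measurable borel"
  using L6_F by (auto simp: L6_def)

text \<open>Here \<open>I = block q lI\<close>, \<open>J = block q' l\<close>, and \<open>K\<close> runs through the sub-blocks of \<open>I\<close> of length \<open>2^\<mu>\<close>. With respect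
to the normal at the left end of \<open>J\<close>, the frequencies of \<open>(F J)\<^sup>2\<close> spread over \<open>2 \<kappa> u 4^l\<close>, and those of
sub-blocks whose indices differ by \<open>R\<close> are at least \<open>u 2^d (R - 1) 2^\<mu>\<close> apart. The hypothesis on the exponents
says that \<open>R\<close> of order \<open>\<kappa> 2^r\<close> makes the second number larger.\<close>

lemma bilinear_orthogonality:
  assumes I: "block q lI \<subseteq> U" and J: "block q' l \<subseteq> U" and far: "far (2 ^ d) (block q lI) (block q' l)"
    and \<mu>: "\<mu> \<le> lI" "2 * l \<le> \<mu> + d + r"
  shows "mixed (block q lI) (block q' l) \<le> real (2 * ((2 * \<kappa> + 1) * 2 ^ r + 1)) *
     (\<Sum>i<2 ^ (lI - \<mu>). mixed (block (q + i * 2 ^ \<mu>) \<mu>) (block q' l))"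
proof -
  define K where "K = (\<lambda>i. block (q + i * 2 ^ \<mu>) \<mu>)"
  define n :: nat where "n = 2 ^ (lI - \<mu>)"
  define J where "J = block q' l"
  \<comment> \<open>Chosen so that sub-blocks at index distance \<open>R\<close> are separated by \<open>u (2 \<kappa> + 1) 4^l\<close>, which exceeds twice the spread of \<open>F J\<close> by \<open>u 4^l\<close>.\<close>
  define R where "R = (2 * \<kappa> + 1) * 2 ^ r + 1"
  define g where "g = (\<lambda>i x. F (K i) x * (F J x * F J x))"
  define BJ where "BJ = {\<xi> + \<eta> |\<xi> \<eta>. \<xi> \<in> (\<Union>j\<in>J. B j) \<and> \<eta> \<in> (\<Union>j\<in>J. B j)}"
  define C where "C = (\<lambda>i. {\<xi> + \<eta> |\<xi> \<eta>. \<xi> \<in> (\<Union>j\<in>K i. B j) \<and> \<eta> \<in> BJ})"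
  have KI: "K i \<subseteq> block q lI" if "i < n" for i using block_subset[OF \<mu>(1)] that by (simp add: K_def n_def)
  have KU: "K i \<subseteq> U" if "i < n" for i using KI[OF that] I by blast
  have JU: "J \<subseteq> U" and fJ: "finite J" and fK: "finite (K i)" for i using assms by (auto simp: J_def K_def)
  have q'J: "q' \<in> J" by (simp add: J_def block_def)
  have q'U: "q' \<in> U" using q'J JU by blast
  have R1: "R \<ge> 1" by (simp add: R_def)
  have "(LINT x|lborel. norm (\<Sum>i<n. g i x) ^ 2) \<le> 2 * real R * (\<Sum>i<n. LINT x|lborel. norm (g i x) ^ 2)"
  proof (rule almost_orthogonality[OF unit_pos R1, where B = C and m = "m q'"])
    fix i assume i: "i < n"
    obtain A where A: "bandlimited (\<Union>j\<in>J. B j) A (F J)" using bandlimited_F[OF fJ JU] by blast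
    obtain A' where A': "bandlimited (\<Union>j\<in>K i. B j) A' (F (K i))" using bandlimited_F[OF fK KU[OF i]] by blast
    have "bandlimited (C i) (A' * (A * A)) (g i)"
      unfolding C_def BJ_def g_def by (intro bandlimited_mult A A')
    then show "\<exists>A. bandlimited (C i) A (g i)" by blast
    show "square_int (g i)" unfolding g_def by (intro square_int_trilinear L6_F fJ fK KU i JU)
  next
    fix i i' \<zeta> \<zeta>' assume i: "i < i'" "i' < n" "i + R \<le> i'" and z: "\<zeta> \<in> C i" "\<zeta>' \<in> C i'"
    obtain \<xi> a b where 1: "\<zeta> = \<xi> + (a + b)" "\<xi> \<in> (\<Union>j\<in>K i. B j)" "a \<in> (\<Union>j\<in>J. B j)" "b \<in> (\<Union>j\<in>J. B j)"
      using z(1) unfolding C_def BJ_def by blast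
    obtain \<xi>' a' b' where 2: "\<zeta>' = \<xi>' + (a' + b')" "\<xi>' \<in> (\<Union>j\<in>K i'. B j)" "a' \<in> (\<Union>j\<in>J. B j)" "b' \<in> (\<Union>j\<in>J. B j)"
      using z(2) unfolding C_def BJ_def by blast
    have tan: "\<bar>tilt (m q') a - tilt (m q') a'\<bar> \<le> real \<kappa> * u * real (2 ^ l) ^ 2" if "a \<in> (\<Union>j\<in>J. B j)" "a' \<in> (\<Union>j\<in>J. B j)" for a a'
    proof -
      from that obtain j j' where "j \<in> J" "j' \<in> J" "a \<in> B j" "a' \<in> B j'" by blast
      then show ?thesis using JU by (intro tangent[of q' j j']) (auto simp: J_def block_def q'U)
    qed
    obtain j j' where j: "j \<in> K i" "j' \<in> K i'" "\<xi> \<in> B j" "\<xi>' \<in> B j'" using 1 2 by blast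
    have jU: "j \<in> U" "j' \<in> U" using j KU[of i] KU[of i'] i by auto
    have jI: "j \<in> block q lI" "j' \<in> block q lI" using j KI[of i] KI[of i'] i by auto
    have "(i + R) * 2 ^ \<mu> \<le> i' * 2 ^ \<mu>" using i by simp
    then have gap: "j + (R - 1) * 2 ^ \<mu> \<le> j'" using j R1 by (auto simp: K_def block_def algebra_simps diff_mult_distrib)
    have "\<kappa> \<le> (R - 1) * 2 ^ \<mu>"
    proof -
      have "\<kappa> * (1 * 1) \<le> (2 * \<kappa> + 1) * (2 ^ r * 2 ^ \<mu>)" by (intro mult_mono) auto
      then show ?thesis by (simp add: R_def mult_ac)
    qed
    with gap have gap\<kappa>: "j + \<kappa> \<le> j'" by linarith
    have main: "u * (2 * real \<kappa> + 1) * real (2 ^ l) ^ 2 \<le> \<bar>tilt (m q') \<xi> - tilt (m q') \<xi>'\<bar>"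
    proof -
      have low: "u * (2 * real \<kappa> + 1) * real (2 ^ l) ^ 2 \<le> u * (real t + 1) * real (j' - j)" if "2 ^ d \<le> t" for t
      proof -
        have "(2 * \<kappa> + 1) * 2 ^ (2 * l) \<le> (2 * \<kappa> + 1) * 2 ^ (\<mu> + d + r)"
          using \<mu>(2) by (intro mult_left_mono power_increasing) auto
        also have "\<dots> = 2 ^ d * ((R - 1) * 2 ^ \<mu>)" by (simp add: R_def power_add mult_ac)
        also have "\<dots> \<le> (t + 1) * (j' - j)" using that gap by (intro mult_mono) auto
        finally have "real ((2 * \<kappa> + 1) * 2 ^ (2 * l)) \<le> real ((t + 1) * (j' - j))" by (rule of_nat_mono)
        then have "(2 * real \<kappa> + 1) * 2 ^ (2 * l) \<le> (real t + 1) * real (j' - j)"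
          by (simp only: of_nat_mult of_nat_add of_nat_power of_nat_numeral of_nat_1)
        then have "u * ((2 * real \<kappa> + 1) * 2 ^ (2 * l)) \<le> u * ((real t + 1) * real (j' - j))"
          using unit_pos by (intro mult_left_mono) auto
        then show ?thesis by (simp add: power_mult[symmetric] mult_ac)
      qed
      from far[unfolded far_def] show ?thesis
      proof
        assume "\<forall>i\<in>block q lI. \<forall>j\<in>block q' l. i + 2 ^ d \<le> j"
        then have "j' + 2 ^ d \<le> q'" using jI q'J by (auto simp: J_def)
        then have "2 ^ d \<le> q' - j'" "j' \<le> q'" by auto
        with left[OF q'U jU \<open>j' \<le> q'\<close> gap\<kappa> j(3,4)] low[of "q' - j'"] show ?thesis by linarith
      next
        assume "\<forall>i\<in>block q lI. \<forall>j\<in>block q' l. j + 2 ^ d \<le> i"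
        then have "q' + 2 ^ d \<le> j" using jI q'J by (auto simp: J_def)
        then have "2 ^ d \<le> j - q'" "q' \<le> j" by auto
        with right[OF q'U jU \<open>q' \<le> j\<close> gap\<kappa> j(3,4)] low[of "j - q'"] show ?thesis by linarith
      qed
    qed
    have "1 \<le> real (2 ^ l) ^ 2" by simp
    then have "u * 1 \<le> u * real (2 ^ l) ^ 2" using unit_pos by (intro mult_left_mono) auto
    moreover have "u * (2 * real \<kappa> + 1) * real (2 ^ l) ^ 2 = 2 * (real \<kappa> * u * real (2 ^ l) ^ 2) + u * real (2 ^ l) ^ 2"
      by (simp add: algebra_simps)
    moreover have "tilt (m q') \<zeta> = tilt (m q') \<xi> + (tilt (m q') a + tilt (m q') b)"
      "tilt (m q') \<zeta>' = tilt (m q') \<xi>' + (tilt (m q') a' + tilt (m q') b')"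
      unfolding 1(1) 2(1) by (simp_all only: tilt_add)
    ultimately show "u \<le> \<bar>tilt (m q') \<zeta> - tilt (m q') \<zeta>'\<bar>"
      using main tan[OF 1(3) 2(3)] tan[OF 1(4) 2(4)] by linarith
  qed
  moreover have "(\<Sum>i<n. g i x) = F (block q lI) x * (F J x * F J x)" for x
    unfolding F_block[OF \<mu>(1)] g_def K_def n_def sum_distrib_right ..
  moreover have "norm (z * (w * w)) ^ 2 = norm z ^ 2 * norm w ^ 4" for z w :: complex
    by (simp add: norm_mult power_mult_distrib flip: power_add)
  ultimately show ?thesis
    by (simp add: mixed_def g_def K_def n_def J_def R_def)
qed

text \<open>Cauchy-Schwarz for the factorisation \<open>|F I|\<^sup>2 |F J|^4 = (|F I|\<^sup>2 |F J|) * |F J|^3\<close>.\<close>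

lemma mixed_swap:
  assumes "finite I" "I \<subseteq> U" "finite J" "J \<subseteq> U"
  shows "mixed I J ^ 2 \<le> mixed J I * norm6 J"
proof -
  have [measurable]: "F I \<in> borel_measurable borel" "F J \<in> borel_measurable borel" by (intro F_measurable assms)+
  have 1: "(norm (F I x) ^ 2 * norm (F J x)) ^ 2 = norm (F J x) ^ 2 * norm (F I x) ^ 4" for x
    by (simp add: power_mult_distrib flip: power_mult)
  have 2: "(norm (F J x) ^ 3) ^ 2 = norm (F J x) ^ 6" for x by (simp flip: power_mult)
  have 3: "norm (F I x) ^ 2 * norm (F J x) * norm (F J x) ^ 3 = norm (F I x) ^ 2 * norm (F J x) ^ 4" for x
    by (simp add: eval_nat_numeral)
  have "(LINT x|lborel. (norm (F I x) ^ 2 * norm (F J x)) * norm (F J x) ^ 3)\<^sup>2 \<le>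
     (LINT x|lborel. (norm (F I x) ^ 2 * norm (F J x)) ^ 2) * (LINT x|lborel. (norm (F J x) ^ 3) ^ 2)"
    by (rule Cauchy_Schwarz_integral)
       (use L6_mixed[OF L6_F[OF assms(3,4)] L6_F[OF assms(1,2)], of 2 4] L6_F[OF assms(3,4)] in \<open>simp_all add: 1 2 L6_def\<close>)
  then show ?thesis unfolding 1 2 3 by (simp add: mixed_def norm6_def)
qed

lemma mixed_trivial:
  assumes "finite I" "I \<subseteq> U" "finite J" "J \<subseteq> U" "X \<ge> 0" "norm6 I \<le> X * T I ^ 3" "norm6 J \<le> X * T J ^ 3"
  shows "mixed I J \<le> X * (T I * T J ^ 2)"
proof -
  have [measurable]: "F I \<in> borel_measurable borel" "F J \<in> borel_measurable borel" by (intro F_measurable assms)+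
  have "(LINT x|lborel. norm (F I x) ^ 2 * (norm (F J x) ^ 2) ^ 2) \<le> X * (T I * T J ^ 2)"
    by (rule Holder_trilinear)
       (use assms L6_F[OF assms(3,4)] L6_F[OF assms(1,2)] in \<open>simp_all add: L6_def norm6_def T_nonneg flip: power_mult\<close>)
  then show ?thesis by (simp add: mixed_def flip: power_mult)
qed

end

section \<open>Decoupling at exponent six\<close>

context L6_family begin

text \<open>Downward induction on \<open>k\<close>. At \<open>k = K\<close> the claim is Hoelder's inequality and the induction hypothesis \<open>IH\<close> for shorter blocks.
One step decomposes \<open>I\<close> into sub-blocks of length \<open>2^(m' - 2^(k+1) r)\<close>, which is the shortest length that
\<open>bilinear_orthogonality\<close> permits, and exchanges the roles of \<open>J\<close> and of these sub-blocks. The square root in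
\<open>mixed_swap\<close> halves the exponent that has been gained so far, but that exponent was measured at the scale \<open>2^(k+1) r\<close>: half of
\<open>\<eta> (K - k - 1) 2^(k+1) r / 2\<close>, together with the gain \<open>\<eta> 2^k r / 2\<close> from \<open>IH\<close> for \<open>J\<close>, is
\<open>\<eta> (K - k) 2^k r / 2\<close>. The losses \<open>W\<close> form a geometric product, bounded by \<open>W\<^sup>2\<close>.\<close>

lemma bilinear_iteration:
  fixes C0 \<eta> W :: real and m' r K Q k :: nat
  defines "W \<equiv> real (2 * ((2 * \<kappa> + 1) * 2 ^ r + 1))"
  assumes m: "2 ^ K * r \<le> m'" and r: "r \<ge> 1" and C0: "C0 \<ge> 1"
    and IH: "\<And>q l. block q l \<subseteq> U \<Longrightarrow> l < m' \<Longrightarrow> norm6 (block q l) \<le> C0 * 2 powr (\<eta> * l) * T (block q l) ^ 3"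
    and eta: "\<eta> > 0"
  shows "k \<le> K \<Longrightarrow> block q lI \<subseteq> U \<Longrightarrow> block q' (m' - 2 ^ k * r) \<subseteq> U \<Longrightarrow> m' - 2 ^ k * r \<le> lI \<Longrightarrow> lI \<le> m' - r \<Longrightarrow>
    far (2 ^ (m' - r)) (block q lI) (block q' (m' - 2 ^ k * r)) \<Longrightarrow>
    mixed (block q lI) (block q' (m' - 2 ^ k * r)) \<le>
      C0 * 2 powr (\<eta> * m') * W ^ 2 * 2 powr (- \<eta> * real (K - k) * 2 ^ k * r / 2) * (T (block q lI) * T (block q' (m' - 2 ^ k * r)) ^ 2)"
proof (induction k arbitrary: q q' lI rule: inc_induct)
  case base
  define l where "l = m' - 2 ^ K * r"
  have "1 * r \<le> 2 ^ K * r" by (intro mult_right_mono) auto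
  then have lt: "l < m'" "lI < m'" using m base(4) r unfolding l_def by linarith+
  have W1: "W \<ge> 1" by (simp add: W_def)
  have up: "norm6 (block q l') \<le> (C0 * 2 powr (\<eta> * m')) * T (block q l') ^ 3" if "block q l' \<subseteq> U" "l' < m'" for q l'
  proof -
    have "C0 * 2 powr (\<eta> * l') * T (block q l') ^ 3 \<le> C0 * 2 powr (\<eta> * m') * T (block q l') ^ 3"
      using that C0 eta by (intro mult_right_mono mult_left_mono powr_mono zero_le_power T_nonneg) auto
    with IH[OF that] show ?thesis by linarith
  qed
  have "mixed (block q lI) (block q' l) \<le> (C0 * 2 powr (\<eta> * m')) * (T (block q lI) * T (block q' l) ^ 2)"
    by (rule mixed_trivial) (use base lt C0 up in \<open>auto simp: l_def\<close>)
  also have "\<dots> \<le> (C0 * 2 powr (\<eta> * m')) * W ^ 2 * (T (block q lI) * T (block q' l) ^ 2)"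
    using C0 W1 T_nonneg by (intro mult_right_mono mult_nonneg_nonneg) (auto simp: one_le_power)
  finally show ?case by (simp add: l_def)
next
  case (step k)
  define l where "l = m' - 2 ^ k * r"
  define \<mu> where "\<mu> = m' - 2 ^ Suc k * r"
  have "(2::nat) ^ Suc k * r \<le> 2 ^ K * r" using step by (intro mult_right_mono power_increasing) auto
  then have kr: "2 ^ Suc k * r \<le> m'" using m by linarith
  have \<mu>l: "\<mu> \<le> l" "\<mu> \<le> lI" using step by (auto simp: \<mu>_def l_def)
  have "1 * r \<le> 2 ^ k * r" by (intro mult_right_mono) auto
  then have lr: "l \<le> m' - r" unfolding l_def by linarith
  have dim: "2 * l \<le> \<mu> + (m' - r) + r" using kr r by (auto simp: \<mu>_def l_def)
  have J: "block q' l \<subseteq> U" using step by (simp add: l_def)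
  have far: "far (2 ^ (m' - r)) (block q lI) (block q' l)" using step by (simp add: l_def)
  define X where "X = C0 * 2 powr (\<eta> * m') * W ^ 2 * 2 powr (- \<eta> * real (K - Suc k) * 2 ^ Suc k * r / 2)"
  define Y where "Y = C0 * 2 powr (\<eta> * l)"
  define Z where "Z = C0 * 2 powr (\<eta> * m') * W * 2 powr (- \<eta> * real (K - k) * 2 ^ k * r / 2)"
  have W0: "W > 0" unfolding W_def of_nat_0_less_iff by simp
  \<comment> \<open>The exponents match exactly: half of what the previous steps and the induction hypothesis for \<open>J\<close> provide is the new exponent.\<close>
  have XY: "X * Y = Z ^ 2"
  proof -
    have Kk: "real (K - k) = real (K - Suc k) + 1" using step by (simp add: of_nat_diff)
    have lr': "real l = real m' - 2 ^ k * real r" using kr by (simp add: l_def of_nat_diff)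
    have e: "\<eta> * m' + (- \<eta> * real (K - Suc k) * 2 ^ Suc k * r / 2) + \<eta> * l = 2 * (\<eta> * m' + (- \<eta> * real (K - k) * 2 ^ k * r / 2))"
      unfolding Kk lr' by (simp add: field_simps)
    have "X * Y = (C0 * W) ^ 2 * (2 powr (\<eta> * m') * 2 powr (- \<eta> * real (K - Suc k) * 2 ^ Suc k * r / 2) * 2 powr (\<eta> * l))"
      by (simp add: X_def Y_def power2_eq_square mult_ac)
    also have "\<dots> = (C0 * W) ^ 2 * 2 powr (\<eta> * m' + (- \<eta> * real (K - Suc k) * 2 ^ Suc k * r / 2) + \<eta> * l)"
      by (simp only: powr_add)
    also have "\<dots> = (C0 * W) ^ 2 * (2 powr (\<eta> * m' + (- \<eta> * real (K - k) * 2 ^ k * r / 2))) ^ 2"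
      unfolding e by (simp only: powr_power[symmetric] powr_powr[symmetric] mult.commute[of 2]) (simp add: powr_realpow[symmetric] powr_powr)
    also have "\<dots> = Z ^ 2" by (simp only: powr_add Z_def power_mult_distrib mult_ac)
    finally show ?thesis .
  qed
  have Z0: "Z \<ge> 0" using C0 W0 by (simp add: Z_def)
  have one: "mixed (block (q + i * 2 ^ \<mu>) \<mu>) (block q' l) \<le> Z * (T (block (q + i * 2 ^ \<mu>) \<mu>) * T (block q' l) ^ 2)"
    if i: "i < 2 ^ (lI - \<mu>)" for i
  proof -
    let ?K = "block (q + i * 2 ^ \<mu>) \<mu>" and ?J = "block q' l"
    have KI: "?K \<subseteq> block q lI" by (rule block_subset[OF \<mu>l(2) i])
    have KU: "?K \<subseteq> U" using KI step by blast
    have "far (2 ^ (m' - r)) ?J ?K" using far_subset[OF far KI] by (rule far_sym)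
    then have a: "mixed ?J ?K \<le> X * (T ?J * T ?K ^ 2)"
      unfolding X_def \<mu>_def by (intro step.IH) (use J KU \<mu>l lr in \<open>auto simp: \<mu>_def\<close>)
    have "l < m'" using lr r kr by (cases "m' = 0") auto
    then have b: "norm6 ?J \<le> Y * T ?J ^ 3" unfolding Y_def by (rule IH[OF J])
    have "mixed ?K ?J ^ 2 \<le> mixed ?J ?K * norm6 ?J" by (rule mixed_swap) (use KU J in auto)
    also have "\<dots> \<le> (X * (T ?J * T ?K ^ 2)) * (Y * T ?J ^ 3)"
      by (rule mult_mono[OF a b]) (use C0 W0 T_nonneg in \<open>auto simp: X_def norm6_def\<close>)
    also have "\<dots> = (X * Y) * (T ?K ^ 2 * T ?J ^ 4)" by (simp add: eval_nat_numeral)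
    also have "\<dots> = (Z * (T ?K * T ?J ^ 2)) ^ 2" unfolding XY by (simp add: power_mult_distrib flip: power_mult)
    finally show ?thesis by (rule power2_le_imp_le) (use Z0 T_nonneg in auto)
  qed
  have "mixed (block q lI) (block q' l) \<le> W * (\<Sum>i<2 ^ (lI - \<mu>). mixed (block (q + i * 2 ^ \<mu>) \<mu>) (block q' l))"
    unfolding W_def by (rule bilinear_orthogonality[OF _ J far \<mu>l(2) dim]) (use step in auto)
  also have "\<dots> \<le> W * (\<Sum>i<2 ^ (lI - \<mu>). Z * (T (block (q + i * 2 ^ \<mu>) \<mu>) * T (block q' l) ^ 2))"
    using W0 one by (intro mult_left_mono sum_mono) auto
  also have "\<dots> = W * Z * (T (block q lI) * T (block q' l) ^ 2)"
    unfolding T_block[OF \<mu>l(2), of q] by (simp add: sum_distrib_left sum_distrib_right mult_ac)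
  also have "W * Z = C0 * 2 powr (\<eta> * m') * W ^ 2 * 2 powr (- \<eta> * real (K - k) * 2 ^ k * r / 2)"
    by (simp add: Z_def power2_eq_square mult_ac)
  finally show ?case by (simp add: l_def)
qed

text \<open>The start of the induction on the length: few pieces.\<close>

lemma norm6_trivial:
  assumes "finite I" "I \<subseteq> U"
  shows "norm6 I \<le> real (card I) ^ 6 * T I ^ 3"
proof -
  have "norm6 I \<le> (LINT x|lborel. real (card I) ^ 6 * (\<Sum>i\<in>I. norm (f i x) ^ 6))"
    unfolding norm6_def F_def
  proof (rule integral_mono')
    show "integrable lborel (\<lambda>x. real (card I) ^ 6 * (\<Sum>i\<in>I. norm (f i x) ^ 6))"
      using assms L6 by (intro integrable_mult_right Bochner_Integration.integrable_sum) (auto simp: L6_def subset_iff)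
    show "norm (\<Sum>j\<in>I. f j x) ^ 6 \<le> real (card I) ^ 6 * (\<Sum>i\<in>I. norm (f i x) ^ 6)" for x
      by (rule norm_sum_power_le) (use assms in auto)
  qed (auto intro!: mult_nonneg_nonneg sum_nonneg)
  also have "\<dots> = real (card I) ^ 6 * (\<Sum>i\<in>I. LINT x|lborel. norm (f i x) ^ 6)"
    using assms L6 by (subst integral_mult_right_zero, subst Bochner_Integration.integral_sum) (auto simp: L6_def subset_iff)
  also have "\<dots> \<le> real (card I) ^ 6 * (\<Sum>i\<in>I. S i ^ 3)"
    using assms S_bound by (intro mult_left_mono sum_mono) auto
  also have "\<dots> \<le> real (card I) ^ 6 * T I ^ 3"
    unfolding T_def using assms S_nonneg by (intro mult_left_mono sum_cubes_le) auto
  finally show ?thesis .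
qed

text \<open>The \<open>2^r\<close> sub-blocks are treated as the terms of \<open>broad_narrow\<close>. Two sub-blocks that are not adjacent are separated
by the length of a sub-block.\<close>

lemma broad_narrow_step:
  assumes U: "block q m' \<subseteq> U" and r: "r \<le> m'" and A: "A \<ge> 0" and A': "A' \<ge> 0"
    and narrow: "\<And>q. block q (m' - r) \<subseteq> U \<Longrightarrow> norm6 (block q (m' - r)) \<le> A * T (block q (m' - r)) ^ 3"
    and broad: "\<And>q q'. block q (m' - r) \<subseteq> U \<Longrightarrow> block q' (m' - r) \<subseteq> U \<Longrightarrow> far (2 ^ (m' - r)) (block q (m' - r)) (block q' (m' - r)) \<Longrightarrow>
      mixed (block q (m' - r)) (block q' (m' - r)) \<le> A' * (T (block q (m' - r)) * T (block q' (m' - r)) ^ 2)"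
  shows "norm6 (block q m') \<le> (4096 * A + 2 ^ (10 * r) * A') * T (block q m') ^ 3"
proof -
  define \<mu> where "\<mu> = m' - r"
  define n :: nat where "n = 2 ^ r"
  define K where "K = (\<lambda>i. block (q + i * 2 ^ \<mu>) \<mu>)"
  have rr: "m' - \<mu> = r" and \<mu>: "\<mu> \<le> m'" using r by (auto simp: \<mu>_def)
  have KI: "K i \<subseteq> block q m'" if "i < n" for i using block_subset[OF \<mu>, of i q] that by (simp add: K_def n_def rr)
  have KU: "K i \<subseteq> U" if "i < n" for i using KI[OF that] U by blast
  have fK: "finite (K i)" for i by (simp add: K_def)
  let ?far = "\<lambda>i j. i + 2 \<le> j \<or> j + 2 \<le> (i::nat)"
  have farK: "far (2 ^ \<mu>) (K i) (K j)" if "?far i j" for i j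
  proof -
    have *: "x + 2 ^ \<mu> \<le> y" if "i + 2 \<le> j" "x \<in> K i" "y \<in> K j" for i j x y
    proof -
      have "(i + 2) * 2 ^ \<mu> \<le> j * 2 ^ \<mu>" using that by (intro mult_right_mono) auto
      then show ?thesis using that by (auto simp: K_def block_def algebra_simps)
    qed
    from that show ?thesis unfolding far_def using * by blast
  qed
  have Feq: "F (block q m') x = (\<Sum>i<n. F (K i) x)" for x
    using F_block[OF \<mu>] by (simp add: rr K_def n_def)
  have Teq: "T (block q m') = (\<Sum>i<n. T (K i))" using T_block[OF \<mu>] by (simp add: rr K_def n_def)
  have i6: "integrable lborel (\<lambda>x. norm (F (K i) x) ^ 6)" if "i < n" for i
    using L6_F[OF fK KU[OF that]] by (simp add: L6_def)
  have im: "integrable lborel (\<lambda>x. norm (F (K i) x) ^ 2 * norm (F (K j) x) ^ 4)" if "i < n" "j < n" for i j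
    using L6_mixed[OF L6_F[OF fK KU[OF that(1)]] L6_F[OF fK KU[OF that(2)]], of 2 4] by simp
  have imf: "integrable lborel (\<lambda>x. if ?far i j then norm (F (K i) x) ^ 2 * norm (F (K j) x) ^ 4 else 0)" if "i < n" "j < n" for i j
    using im[OF that] by (cases "?far i j") auto
  have "norm6 (block q m') \<le> (LINT x|lborel. 4096 * (\<Sum>i<n. norm (F (K i) x) ^ 6) +
     real n ^ 10 * (\<Sum>i<n. \<Sum>j<n. if ?far i j then norm (F (K i) x) ^ 2 * norm (F (K j) x) ^ 4 else 0))"
    unfolding norm6_def Feq
    by (rule integral_mono'[OF _ broad_narrow])
       (use i6 imf in \<open>auto simp: n_def intro!: Bochner_Integration.integrable_add integrable_mult_right Bochner_Integration.integrable_sum add_nonneg_nonneg mult_nonneg_nonneg sum_nonneg\<close>)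
  also have "\<dots> = 4096 * (\<Sum>i<n. norm6 (K i)) + real n ^ 10 * (\<Sum>i<n. \<Sum>j<n. if ?far i j then mixed (K i) (K j) else 0)"
  proof -
    have a: "(LINT x|lborel. (\<Sum>i<n. norm (F (K i) x) ^ 6)) = (\<Sum>i<n. norm6 (K i))"
      unfolding norm6_def by (rule Bochner_Integration.integral_sum) (use i6 in auto)
    have "(LINT x|lborel. (\<Sum>i<n. \<Sum>j<n. if ?far i j then norm (F (K i) x) ^ 2 * norm (F (K j) x) ^ 4 else 0)) =
       (\<Sum>i<n. LINT x|lborel. (\<Sum>j<n. if ?far i j then norm (F (K i) x) ^ 2 * norm (F (K j) x) ^ 4 else 0))"
      by (rule Bochner_Integration.integral_sum) (use imf in \<open>auto intro!: Bochner_Integration.integrable_sum\<close>)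
    also have "\<dots> = (\<Sum>i<n. \<Sum>j<n. LINT x|lborel. (if ?far i j then norm (F (K i) x) ^ 2 * norm (F (K j) x) ^ 4 else 0))"
      by (intro sum.cong refl Bochner_Integration.integral_sum) (use imf in auto)
    also have "\<dots> = (\<Sum>i<n. \<Sum>j<n. if ?far i j then mixed (K i) (K j) else 0)"
      by (intro sum.cong refl) (auto simp: mixed_def)
    finally have b: "(LINT x|lborel. (\<Sum>i<n. \<Sum>j<n. if ?far i j then norm (F (K i) x) ^ 2 * norm (F (K j) x) ^ 4 else 0)) =
      (\<Sum>i<n. \<Sum>j<n. if ?far i j then mixed (K i) (K j) else 0)" .
    show ?thesis unfolding a[symmetric] b[symmetric]
      by (subst Bochner_Integration.integral_add)
         (use i6 imf in \<open>auto intro!: integrable_mult_right Bochner_Integration.integrable_sum\<close>)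
  qed
  also have "\<dots> \<le> 4096 * (\<Sum>i<n. A * T (K i) ^ 3) + real n ^ 10 * (\<Sum>i<n. \<Sum>j<n. A' * (T (K i) * T (K j) ^ 2))"
  proof (intro add_mono mult_left_mono sum_mono)
    fix i assume "i \<in> {..<n}"
    then show "norm6 (K i) \<le> A * T (K i) ^ 3" using narrow KU by (auto simp: K_def \<mu>_def)
    fix j assume "j \<in> {..<n}"
    then show "(if ?far i j then mixed (K i) (K j) else 0) \<le> A' * (T (K i) * T (K j) ^ 2)"
      using broad[of "q + i * 2 ^ \<mu>" "q + j * 2 ^ \<mu>"] KU[of i] KU[of j] farK[of i j] \<open>i \<in> {..<n}\<close> A' T_nonneg
      by (auto simp: K_def \<mu>_def)
  qed auto
  also have "(\<Sum>i<n. A * T (K i) ^ 3) \<le> A * T (block q m') ^ 3"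
    unfolding Teq sum_distrib_left[symmetric] using A T_nonneg by (intro mult_left_mono sum_cubes_le) auto
  also have "(\<Sum>i<n. \<Sum>j<n. A' * (T (K i) * T (K j) ^ 2)) = A' * (T (block q m') * (\<Sum>j<n. T (K j) ^ 2))"
    unfolding Teq sum_product by (simp add: sum_distrib_left)
  also have "(\<Sum>j<n. T (K j) ^ 2) \<le> T (block q m') ^ 2"
  proof -
    have "(\<Sum>j<n. T (K j) ^ 2) \<le> (\<Sum>j<n. T (K j) * T (block q m'))"
      unfolding power2_eq_square Teq using T_nonneg by (intro sum_mono mult_left_mono member_le_sum) auto
    then show ?thesis by (simp add: Teq power2_eq_square sum_distrib_right)
  qed
  finally have "norm6 (block q m') \<le> 4096 * (A * T (block q m') ^ 3) + real n ^ 10 * (A' * (T (block q m') * T (block q m') ^ 2))"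
    using A' T_nonneg by (simp add: mult_left_mono)
  also have "\<dots> = (4096 * A + 2 ^ (10 * r) * A') * T (block q m') ^ 3"
    by (simp add: n_def power_mult mult.commute[of 10] power2_eq_square power3_eq_cube algebra_simps)
  finally show ?thesis .
qed

text \<open>Strong induction on \<open>l\<close>. Below the threshold \<open>2^K r\<close>, which does not depend on the family, the trivial bound is
absorbed by the constant. Above it, the narrow part has gained \<open>2^(-\<eta> r)\<close> and the broad part \<open>2^(-\<eta> K r / 2)\<close>, and
\<open>small\<close> says that together they are at most \<open>1\<close>.\<close>

lemma L6_decoupling_constants:
  fixes \<eta> :: real and K r :: nat
  assumes eta: "\<eta> > 0" and r: "r \<ge> 1"
    and small: "4096 * 2 powr (- \<eta> * r) + 2 ^ (10 * r) * (real (2 * ((2 * \<kappa> + 1) * 2 ^ r + 1)) ^ 2 * 2 powr (- \<eta> * K * r / 2)) \<le> 1"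
    and q: "block q l \<subseteq> U"
  shows "norm6 (block q l) \<le> 2 ^ (6 * (2 ^ K * r)) * 2 powr (\<eta> * l) * T (block q l) ^ 3"
  using q
proof (induction l arbitrary: q rule: less_induct)
  case (less l)
  define C0 :: real where "C0 = 2 ^ (6 * (2 ^ K * r))"
  define W where "W = real (2 * ((2 * \<kappa> + 1) * 2 ^ r + 1))"
  have C0: "C0 \<ge> 1" by (simp add: C0_def)
  show ?case
  proof (cases "l < 2 ^ K * r")
    case True
    have "norm6 (block q l) \<le> real (card (block q l)) ^ 6 * T (block q l) ^ 3" by (rule norm6_trivial) (use less in auto)
    also have "real (card (block q l)) ^ 6 = 2 ^ (6 * l)" by (simp add: block_def power_mult[symmetric] mult.commute)
    also have "(2 ^ (6 * l) :: real) \<le> 2 ^ (6 * (2 ^ K * r))" using True by (intro power_increasing) auto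
    also have "\<dots> \<le> 2 ^ (6 * (2 ^ K * r)) * 2 powr (\<eta> * l)" using eta by (simp add: ge_one_powr_ge_zero)
    finally show ?thesis using T_nonneg by (simp add: mult_right_mono)
  next
    case False
    then have m: "2 ^ K * r \<le> l" by simp
    have "1 * r \<le> 2 ^ K * r" by (intro mult_right_mono) auto
    then have rl: "r \<le> l" using m by linarith
    have W0: "W \<ge> 0" by (simp add: W_def)
    have IH: "norm6 (block q' l') \<le> C0 * 2 powr (\<eta> * l') * T (block q' l') ^ 3" if "block q' l' \<subseteq> U" "l' < l" for q' l'
      unfolding C0_def by (rule less.IH[OF that(2,1)])
    have "norm6 (block q l) \<le> (4096 * (C0 * 2 powr (\<eta> * (l - r))) + 2 ^ (10 * r) * (C0 * 2 powr (\<eta> * l) * W ^ 2 * 2 powr (- \<eta> * K * r / 2))) * T (block q l) ^ 3"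
    proof (rule broad_narrow_step[OF less.prems rl])
      show "norm6 (block q (l - r)) \<le> C0 * 2 powr (\<eta> * (l - r)) * T (block q (l - r)) ^ 3" if "block q (l - r) \<subseteq> U" for q
        by (rule IH[OF that]) (use r rl in auto)
      show "mixed (block q (l - r)) (block q' (l - r)) \<le> C0 * 2 powr (\<eta> * l) * W ^ 2 * 2 powr (- \<eta> * K * r / 2) * (T (block q (l - r)) * T (block q' (l - r)) ^ 2)"
        if "block q (l - r) \<subseteq> U" "block q' (l - r) \<subseteq> U" "far (2 ^ (l - r)) (block q (l - r)) (block q' (l - r))" for q q'
        using bilinear_iteration[OF m r C0 IH eta, of 0 q "l - r" q'] that by (simp add: W_def)
    qed (use C0 in auto)
    also have "4096 * (C0 * 2 powr (\<eta> * (l - r))) + 2 ^ (10 * r) * (C0 * 2 powr (\<eta> * l) * W ^ 2 * 2 powr (- \<eta> * K * r / 2)) =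
       (C0 * 2 powr (\<eta> * l)) * (4096 * 2 powr (- \<eta> * r) + 2 ^ (10 * r) * (W ^ 2 * 2 powr (- \<eta> * K * r / 2)))"
    proof -
      have "2 powr (\<eta> * (l - r)) = 2 powr (\<eta> * l) * 2 powr (- \<eta> * r)"
        using rl by (simp add: powr_add[symmetric] of_nat_diff algebra_simps)
      then show ?thesis by (simp add: algebra_simps)
    qed
    also have "\<dots> \<le> (C0 * 2 powr (\<eta> * l)) * 1"
      using C0 small by (intro mult_left_mono) (auto simp: W_def)
    finally show ?thesis using T_nonneg by (simp add: C0_def mult_right_mono)
  qed
qed

end

text \<open>First \<open>K\<close> is chosen so large that the gain \<open>2^(-13 r)\<close> beats the factor \<open>2^(12 r)\<close> lost in the reduction to separated
blocks and in \<open>W\<^sup>2\<close>; then \<open>r\<close> is chosen so large that the remaining constants are small.\<close>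

theorem L6_decoupling:
  fixes \<eta> :: real and \<kappa> :: nat
  assumes "\<eta> > 0"
  shows "\<exists>C\<ge>1. \<forall>U B m u f S q l. L6_family U B m u \<kappa> f S \<longrightarrow> block q l \<subseteq> U \<longrightarrow>
    (LINT x|lborel. norm (\<Sum>j\<in>block q l. f j x) ^ 6) \<le> C * 2 powr (\<eta> * l) * (\<Sum>j\<in>block q l. S j) ^ 3"
proof -
  obtain K :: nat where K: "26 / \<eta> \<le> real K" using real_arch_simple by blast
  then have K2: "13 \<le> \<eta> * K / 2" using assms by (simp add: field_simps)
  define M where "M = 2 * (4 * real \<kappa> + 4) ^ 2"
  obtain r0 :: nat where r0: "max (13 / \<eta>) M \<le> real r0" using real_arch_simple by blast
  define r where "r = max 1 r0"
  have r: "r \<ge> 1" "13 / \<eta> \<le> real r" "M \<le> real r" using r0 by (auto simp: r_def)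
  have r13: "13 \<le> \<eta> * r" using r(2) assms by (simp add: field_simps)
  have "4096 * 2 powr (- \<eta> * r) \<le> 4096 * 2 powr (- 13)"
    using r13 by (intro mult_left_mono powr_mono) auto
  then have a: "4096 * 2 powr (- \<eta> * r) \<le> 1 / 2" by (simp add: powr_minus powr_numeral)
  have pw: "(2::real) ^ n = 2 powr n" for n by (simp add: powr_realpow)
  have W: "real (2 * ((2 * \<kappa> + 1) * 2 ^ r + 1)) \<le> (4 * real \<kappa> + 4) * 2 ^ r"
  proof -
    have "(1::real) \<le> 2 ^ r" by simp
    then show ?thesis by (simp add: algebra_simps)
  qed
  have "13 * real r \<le> \<eta> * K / 2 * real r" using K2 by (intro mult_right_mono) auto
  then have e: "2 powr (- \<eta> * K * r / 2) \<le> 2 powr (- 13 * real r)" by (intro powr_mono) auto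
  have "2 ^ (10 * r) * (real (2 * ((2 * \<kappa> + 1) * 2 ^ r + 1)) ^ 2 * 2 powr (- \<eta> * K * r / 2)) \<le>
    2 ^ (10 * r) * (((4 * real \<kappa> + 4) * 2 ^ r) ^ 2 * 2 powr (- 13 * real r))"
    by (intro mult_left_mono[OF mult_mono[OF power_mono[OF W] e]]) auto
  also have "\<dots> = (4 * real \<kappa> + 4) ^ 2 * (2 powr (10 * real r) * (2 powr r * 2 powr r) * 2 powr (- 13 * real r))"
    unfolding power_mult_distrib pw by (simp add: power2_eq_square pw mult_ac)
  also have "2 powr (10 * real r) * (2 powr r * 2 powr r) * 2 powr (- 13 * real r) = 2 powr (- real r)"
    by (simp flip: powr_add)
  also have "2 powr (- real r) = 1 / 2 ^ r" by (simp add: powr_minus powr_realpow divide_inverse)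
  also have "(4 * real \<kappa> + 4) ^ 2 * (1 / 2 ^ r) \<le> 1 / 2"
  proof -
    have "real r < 2 ^ r" by (rule of_nat_less_two_power)
    with r(3) have "2 * (4 * real \<kappa> + 4) ^ 2 \<le> 2 ^ r" unfolding M_def by linarith
    then show ?thesis by (simp add: field_simps)
  qed
  finally have small: "4096 * 2 powr (- \<eta> * r) + 2 ^ (10 * r) * (real (2 * ((2 * \<kappa> + 1) * 2 ^ r + 1)) ^ 2 * 2 powr (- \<eta> * K * r / 2)) \<le> 1"
    using a by linarith
  show ?thesis
  proof (intro exI[of _ "2 ^ (6 * (2 ^ K * r))"] conjI allI impI)
    fix U B m u f S q l
    assume "L6_family U B m u \<kappa> f S" and q: "block q l \<subseteq> U"
    then interpret L6_family U B m u \<kappa> f S by simp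
    show "(LINT x|lborel. norm (\<Sum>j\<in>block q l. f j x) ^ 6) \<le> 2 ^ (6 * (2 ^ K * r)) * 2 powr (\<eta> * l) * (\<Sum>j\<in>block q l. S j) ^ 3"
      using L6_decoupling_constants[OF assms r(1) small q] by (simp add: norm6_def F_def T_def)
  qed simp
qed

section \<open>A reproducing kernel on the line\<close>

lemma trig_poly_linear:
  fixes L :: "'a::euclidean_space \<Rightarrow> 'b::euclidean_space"
  assumes L: "\<And>\<xi> x. \<xi> \<bullet> L x = L' \<xi> \<bullet> x" and "trig_poly B A p"
  shows "trig_poly (L' ` B) A (\<lambda>x. p (L x))"
  using assms(2)
proof (induction rule: trig_poly.induct)
  case (add A p \<xi> c)
  from trig_poly.add[OF add(3) imageI[OF add(2)], of c] show ?case by (simp add: L)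
qed (auto intro: trig_poly.intros)

lemma bandlimited_linear:
  fixes L :: "'a::euclidean_space \<Rightarrow> 'b::euclidean_space"
  assumes L: "\<And>\<xi> x. \<xi> \<bullet> L x = L' \<xi> \<bullet> x" and "bandlimited B A f"
  shows "bandlimited (L' ` B) A (\<lambda>x. f (L x))"
proof -
  obtain p where "\<And>n. trig_poly B A (p n)" "\<And>x. (\<lambda>n. p n x) \<longlonglongrightarrow> f x"
    using assms unfolding bandlimited_def by blast
  then show ?thesis
    unfolding bandlimited_def by (intro exI[of _ "\<lambda>n x. p n (L x)"]) (auto intro: trig_poly_linear[OF L])
qed

lemma bandlimited_cmult:
  assumes "bandlimited B A f"
  shows "bandlimited B (norm c * A) (\<lambda>x. c * f x)"
proof -
  obtain p where "\<And>n. trig_poly B A (p n)" "\<And>x. (\<lambda>n. p n x) \<longlonglongrightarrow> f x"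
    using assms unfolding bandlimited_def by blast
  then show ?thesis
    unfolding bandlimited_def by (intro exI[of _ "\<lambda>n x. c * p n x"]) (auto intro: trig_poly_cmult tendsto_mult)
qed

lemma bandlimited_unit_exp: "bandlimited {\<gamma>} 1 (\<lambda>x. unit_exp (\<gamma> \<bullet> x))"
proof -
  have "trig_poly {\<gamma>} (0 + norm (1::complex)) (\<lambda>x. 0 + 1 * unit_exp (\<gamma> \<bullet> x))"
    by (intro trig_poly.intros) auto
  then show ?thesis unfolding bandlimited_def by (intro exI[of _ "\<lambda>_ x. unit_exp (\<gamma> \<bullet> x)"]) auto
qed

lemma box_kernel:
  assumes "b > 0"
  shows "(LINT v|lborel. indicator {-b..b} v *\<^sub>R unit_exp (v * y)) =
    complex_of_real (if y = 0 then 2 * b else sin (2 * pi * b * y) / (pi * y))"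
proof (cases "y = 0")
  case True
  then show ?thesis using assms by (simp add: scaleR_conv_of_real)
next
  case False
  define H where "H = (\<lambda>z::complex. exp (2 * of_real pi * \<i> * (of_real y * z)) / (2 * of_real pi * \<i> * of_real y))"
  have "(H has_field_derivative exp (2 * of_real pi * \<i> * (of_real y * z))) (at z)" for z
    unfolding H_def using False by (auto intro!: derivative_eq_intros)
  then have "((\<lambda>v. H (of_real v)) has_vector_derivative exp (2 * of_real pi * \<i> * (of_real y * of_real v))) (at v within {-b..b})" for v
    by (rule has_vector_derivative_real_field)
  moreover have "unit_exp (v * y) = exp (2 * of_real pi * \<i> * (of_real y * of_real v))" for v
    by (simp add: unit_exp_def mult.commute[of v y])
  ultimately have d: "((\<lambda>v. H (of_real v)) has_vector_derivative unit_exp (v * y)) (at v within {-b..b})" for v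
    by simp
  have "(LINT v|lborel. indicator {-b..b} v *\<^sub>R unit_exp (v * y)) = H (of_real b) - H (of_real (-b))"
    by (rule integral_FTC_Icc) (use d assms in \<open>auto intro!: continuous_intros\<close>)
  also have "\<dots> = sin (complex_of_real (2 * pi * b * y)) / (pi * y)"
    using False unfolding sin_exp_eq H_def by (simp add: field_simps)
  also have "\<dots> = complex_of_real (sin (2 * pi * b * y) / (pi * y))"
    unfolding sin_of_real by simp
  finally show ?thesis using False by simp
qed

lemma bandlimited_box_kernel:
  assumes "b > 0"
  shows "\<exists>A. bandlimited {-b..b} A (\<lambda>y. complex_of_real (if y = 0 then 2 * b else sin (2 * pi * b * y) / (pi * y)))"
proof -
  have "integrable lborel (\<lambda>v. indicator {-b..b} v *\<^sub>R (1::real))" using assms by simp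
  then have i: "integrable lborel (\<lambda>v. of_real (indicator {-b..b} v *\<^sub>R (1::real)) :: complex)" by (rule integrable_of_real)
  have "\<exists>A. bandlimited {-b..b} A (\<lambda>y. LINT v|lborel. of_real (indicator {-b..b} v *\<^sub>R (1::real)) * unit_exp (v \<bullet> y))"
    by (rule bandlimited_integral[OF _ i]) (auto simp: indicator_def split: if_splits)
  also have "(\<lambda>y. LINT v|lborel. of_real (indicator {-b..b} v *\<^sub>R (1::real)) * unit_exp (v \<bullet> y)) =
    (\<lambda>y. LINT v|lborel. indicator {-b..b} v *\<^sub>R unit_exp (v * y))"
    by (simp add: scaleR_conv_of_real)
  finally show ?thesis unfolding box_kernel[OF assms] .
qed

text \<open>Up to a factor, a de la Vallee-Poussin kernel: its Fourier transform is a trapezoid that is constant on \<open>[-1, 1]\<close> and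
vanishes outside \<open>[-2, 2]\<close>. The value at \<open>0\<close> is the continuous extension.\<close>

definition vp_base :: "real \<Rightarrow> real" where
  "vp_base y = (if y = 0 then 3 else (cos (2 * pi * y) - cos (4 * pi * y)) / (2 * pi\<^sup>2 * y\<^sup>2))"

lemma vp_base_measurable [measurable]: "vp_base \<in> borel_measurable borel"
  unfolding vp_base_def by measurable

text \<open>The kernel is the product of the transforms of the indicators of \<open>[-1/2, 1/2]\<close> and \<open>[-3/2, 3/2]\<close>.\<close>

lemma bandlimited_vp_base: "\<exists>A. bandlimited {-2..2} A (\<lambda>y. complex_of_real (vp_base y))"
proof -
  obtain A1 where A1: "bandlimited {-(1/2)..1/2} A1 (\<lambda>y. complex_of_real (if y = 0 then 2 * (1/2) else sin (2 * pi * (1/2) * y) / (pi * y)))"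
    using bandlimited_box_kernel[of "1/2"] by auto
  obtain A2 where A2: "bandlimited {-(3/2)..3/2} A2 (\<lambda>y. complex_of_real (if y = 0 then 2 * (3/2) else sin (2 * pi * (3/2) * y) / (pi * y)))"
    using bandlimited_box_kernel[of "3/2"] by auto
  have "complex_of_real (if y = 0 then 2 * (1/2) else sin (2 * pi * (1/2) * y) / (pi * y)) *
     complex_of_real (if y = 0 then 2 * (3/2) else sin (2 * pi * (3/2) * y) / (pi * y)) = complex_of_real (vp_base y)" for y
  proof (cases "y = 0")
    case False
    have "cos (2 * pi * y) - cos (4 * pi * y) = 2 * sin (3 * pi * y) * sin (pi * y)"
      by (simp add: cos_diff_cos algebra_simps)
    then show ?thesis using False by (simp add: vp_base_def power2_eq_square field_simps flip: of_real_mult)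
  qed (simp add: vp_base_def)
  then have "bandlimited {\<xi> + \<eta> |\<xi> \<eta>. \<xi> \<in> {-(1/2)..1/2} \<and> \<eta> \<in> {-(3/2)..3/2}} (A1 * A2) (\<lambda>y. complex_of_real (vp_base y))"
    using bandlimited_mult[OF A1 A2] by simp
  then have "bandlimited {-2..2} (A1 * A2) (\<lambda>y. complex_of_real (vp_base y))"
    by (rule bandlimited_mono) auto
  then show ?thesis by blast
qed

text \<open>The integral of \<open>osc a\<close> is proportional to \<open>\<bar>a\<bar>\<close> by scaling. This determines the Fourier transform of
\<open>vp_base\<close> up to a constant factor.\<close>

definition osc :: "real \<Rightarrow> real \<Rightarrow> real" where
  "osc a y = (1 - cos (a * y)) / y\<^sup>2"

lemma osc_measurable [measurable]: "osc a \<in> borel_measurable borel"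
  unfolding osc_def by measurable

lemma osc_nonneg: "0 \<le> osc a y" by (simp add: osc_def)

lemma integrable_inverse_one_plus_square: "integrable lborel (\<lambda>y::real. inverse (1 + y\<^sup>2))"
proof (rule integrableI_bounded)
  let ?f = "\<lambda>y::real. ennreal (inverse (1 + y\<^sup>2))"
  have h: "(\<integral>\<^sup>+y. ?f y * indicator {0..} y \<partial>lborel) = ennreal (pi / 2 - arctan 0)"
    by (rule nn_integral_FTC_atLeast)
       (auto intro!: DERIV_arctan tendsto_arctan_at_top simp: add_nonneg_nonneg)
  have "(\<integral>\<^sup>+y. ?f y * indicator {..0} y \<partial>lborel) = (\<integral>\<^sup>+y. ?f y * indicator {0..} y \<partial>lborel)"
    by (subst nn_integral_real_affine[where c = "-1" and t = 0]) (auto simp: indicator_def intro!: nn_integral_cong)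
  moreover have "(\<integral>\<^sup>+y. ?f y \<partial>lborel) \<le> (\<integral>\<^sup>+y. ?f y * indicator {0..} y + ?f y * indicator {..0} y \<partial>lborel)"
    by (intro nn_integral_mono) (auto simp: indicator_def)
  ultimately have "(\<integral>\<^sup>+y. ?f y \<partial>lborel) \<le> ennreal (pi / 2 - arctan 0) + ennreal (pi / 2 - arctan 0)"
    using h by (simp add: nn_integral_add)
  then have fin: "(\<integral>\<^sup>+y. ?f y \<partial>lborel) < \<infinity>"
    by (rule order.strict_trans1) (simp add: ennreal_add_eq_top less_top)
  have "norm (inverse (1 + y\<^sup>2)) = inverse (1 + y\<^sup>2)" for y :: real
    by (simp add: add_nonneg_nonneg)
  with fin show "(\<integral>\<^sup>+y. ennreal (norm (inverse (1 + (y::real)\<^sup>2))) \<partial>lborel) < \<infinity>" by (simp only:)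
qed measurable

lemma integrable_osc: "integrable lborel (osc a)"
proof (rule Bochner_Integration.integrable_bound[OF integrable_mult_right[OF integrable_inverse_one_plus_square, of "a\<^sup>2 / 2 + 2"]])
  show "AE y in lborel. norm (osc a y) \<le> norm ((a\<^sup>2 / 2 + 2) * inverse (1 + y\<^sup>2))"
  proof (rule AE_I2)
    fix y :: real
    have p: "1 + y\<^sup>2 > 0" by (simp add: add_pos_nonneg)
    have "2 * (a * y / 2) = a * y" by simp
    then have "1 - cos (a * y) = 2 * (sin (a * y / 2))\<^sup>2" using cos_double_sin[of "a * y / 2"] by (simp only:)
    also have "\<dots> \<le> 2 * (a * y / 2)\<^sup>2"
      using abs_sin_x_le_abs_x[of "a * y / 2"] unfolding abs_le_square_iff by (rule mult_left_mono) simp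
    also have "2 * (a * y / 2)\<^sup>2 = a\<^sup>2 / 2 * y\<^sup>2" by (simp add: power_mult_distrib power_divide)
    finally have 1: "1 - cos (a * y) \<le> a\<^sup>2 / 2 * y\<^sup>2" .
    have 2: "(1 - cos (a * y)) * y\<^sup>2 \<le> 2 * y\<^sup>2"
      using cos_ge_minus_one[of "a * y"] by (intro mult_right_mono) auto
    have "osc a y \<le> (a\<^sup>2 / 2 + 2) / (1 + y\<^sup>2)"
    proof (cases "y = 0")
      case False
      then have z: "y\<^sup>2 \<noteq> 0" by simp
      have "(1 - cos (a * y)) * (1 + y\<^sup>2) \<le> (a\<^sup>2 / 2 + 2) * y\<^sup>2"
        using 1 2 unfolding distrib_left distrib_right mult_1_right by linarith
      then have "(1 - cos (a * y)) * (1 + y\<^sup>2) / (y\<^sup>2 * (1 + y\<^sup>2)) \<le> (a\<^sup>2 / 2 + 2) * y\<^sup>2 / (y\<^sup>2 * (1 + y\<^sup>2))"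
        by (rule divide_right_mono) simp
      moreover have "(1 - cos (a * y)) * (1 + y\<^sup>2) / (y\<^sup>2 * (1 + y\<^sup>2)) = osc a y"
        using p unfolding osc_def by simp
      moreover have "(a\<^sup>2 / 2 + 2) * y\<^sup>2 / (y\<^sup>2 * (1 + y\<^sup>2)) = (a\<^sup>2 / 2 + 2) / (1 + y\<^sup>2)"
        using z by simp
      ultimately show ?thesis by simp
    qed (use p in \<open>simp add: osc_def\<close>)
    then show "norm (osc a y) \<le> norm ((a\<^sup>2 / 2 + 2) * inverse (1 + y\<^sup>2))"
      unfolding divide_inverse[of "a\<^sup>2 / 2 + 2"] real_norm_def abs_of_nonneg[OF osc_nonneg]
      by (rule order_trans[OF _ abs_ge_self])
  qed
qed measurable

definition osc_const :: real where "osc_const = (LINT y|lborel. osc 1 y)"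

lemma integral_osc: "(LINT y|lborel. osc a y) = \<bar>a\<bar> * osc_const"
proof (cases "a = 0")
  case True
  then show ?thesis by (simp add: osc_def)
next
  case False
  have "osc_const = \<bar>a\<bar> * (LINT y|lborel. osc 1 (a * y))"
    unfolding osc_const_def using lborel_integral_real_affine[OF False, of "osc 1" 0] by simp
  also have "(\<lambda>y. osc 1 (a * y)) = (\<lambda>y. inverse (a\<^sup>2) * osc a y)"
    by (auto simp: osc_def power_mult_distrib field_simps)
  finally have "osc_const = \<bar>a\<bar> * (inverse (a\<^sup>2) * (LINT y|lborel. osc a y))" by simp
  moreover have "a\<^sup>2 = \<bar>a\<bar> * \<bar>a\<bar>" by (simp add: power2_eq_square)
  ultimately have "\<bar>a\<bar> * osc_const = (\<bar>a\<bar> * \<bar>a\<bar>) * inverse (\<bar>a\<bar> * \<bar>a\<bar>) * (LINT y|lborel. osc a y)"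
    by (simp only: mult.assoc)
  moreover have "(\<bar>a\<bar> * \<bar>a\<bar>) * inverse (\<bar>a\<bar> * \<bar>a\<bar>) = 1" using False by (intro right_inverse) simp
  ultimately show ?thesis by simp
qed

lemma osc_const_pos: "osc_const > 0"
proof -
  have c: "cos (1::real) < 1" using cos_monotone_0_pi[of 0 1] pi_gt3 by simp
  have "(LINT y|lborel. indicator {1<..<(2::real)} y * ((1 - cos 1) / 4 :: real)) \<le> (LINT y|lborel. osc 1 y)"
  proof (rule integral_mono'[OF integrable_osc])
    fix y :: real
    show "indicator {1<..<(2::real)} y * ((1 - cos 1) / 4 :: real) \<le> osc 1 y"
    proof (cases "y \<in> {1<..<2}")
      case True
      then have "cos y \<le> cos 1" using pi_gt3 by (intro cos_monotone_0_pi_le) auto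
      moreover have "y\<^sup>2 \<le> 2\<^sup>2" using True by (intro power_mono) auto
      ultimately have "(1 - cos 1) / 4 \<le> (1 - cos y) / y\<^sup>2" using c True by (intro frac_le) auto
      then show ?thesis using True by (simp add: osc_def)
    qed (simp add: osc_nonneg)
  qed (rule osc_nonneg)
  then have "(1 - cos 1) / 4 \<le> osc_const" by (simp add: osc_const_def)
  then show ?thesis using c by simp
qed

lemma vp_base_mult_cos:
  "AE y in lborel. vp_base y * cos (2 * pi * v * y) =
    (osc (2 * pi * (2 + v)) y + osc (2 * pi * (2 - v)) y - osc (2 * pi * (1 + v)) y - osc (2 * pi * (1 - v)) y) / (4 * pi\<^sup>2)"
proof -
  have "AE y in lborel. y \<noteq> (0::real)" by (rule AE_lborel_singleton)
  then show ?thesis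
  proof eventually_elim
    case (elim y)
    have e: "cos (2 * pi * v * y) * cos (b * y) = (cos ((b + 2 * pi * v) * y) + cos ((b - 2 * pi * v) * y)) / 2" for b
      using cos_times_cos[of "b * y" "2 * pi * v * y"]
      unfolding distrib_right left_diff_distrib mult.commute[of "cos (2 * pi * v * y)" "cos (b * y)"] by (simp only: add.commute)
    have P: "(cos (2 * pi * y) - cos (4 * pi * y)) * cos (2 * pi * v * y) =
       (cos (2 * pi * (1 + v) * y) + cos (2 * pi * (1 - v) * y) - cos (2 * pi * (2 + v) * y) - cos (2 * pi * (2 - v) * y)) / 2"
      using e[of "2 * pi"] e[of "4 * pi"] by (simp add: algebra_simps)
    have "vp_base y * cos (2 * pi * v * y) = ((cos (2 * pi * y) - cos (4 * pi * y)) * cos (2 * pi * v * y)) / (2 * pi\<^sup>2 * y\<^sup>2)"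
      using elim by (simp add: vp_base_def)
    also have "\<dots> = (cos (2 * pi * (1 + v) * y) + cos (2 * pi * (1 - v) * y) - cos (2 * pi * (2 + v) * y) - cos (2 * pi * (2 - v) * y)) / 2 / (2 * pi\<^sup>2 * y\<^sup>2)"
      unfolding P ..
    also have "\<dots> = (osc (2 * pi * (2 + v)) y + osc (2 * pi * (2 - v)) y - osc (2 * pi * (1 + v)) y - osc (2 * pi * (1 - v)) y) / (4 * pi\<^sup>2)"
    proof -
      have a: "(1 - c3) / z + (1 - c4) / z - (1 - c1) / z - (1 - c2) / z = (c1 + c2 - c3 - c4) / z" for c1 c2 c3 c4 z :: real
        by (simp add: diff_divide_distrib add_divide_distrib)
      have b: "r / 2 / (2 * q * z) = r / z / (4 * q)" for r q z :: real by simp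
      show ?thesis unfolding osc_def a b ..
    qed
    finally show ?case .
  qed
qed

lemma integrable_vp_base: "integrable lborel vp_base"
proof -
  have "integrable lborel (\<lambda>y. (osc (2 * pi * (2 + 0)) y + osc (2 * pi * (2 - 0)) y - osc (2 * pi * (1 + 0)) y - osc (2 * pi * (1 - 0)) y) / (4 * pi\<^sup>2))"
    by (intro integrable_divide_zero Bochner_Integration.integrable_diff Bochner_Integration.integrable_add integrable_osc)
  moreover have "AE y in lborel. (osc (2 * pi * (2 + 0)) y + osc (2 * pi * (2 - 0)) y - osc (2 * pi * (1 + 0)) y - osc (2 * pi * (1 - 0)) y) / (4 * pi\<^sup>2) = vp_base y"
    using vp_base_mult_cos[of 0]
  proof eventually_elim
    case (elim y)
    have "vp_base y = vp_base y * cos (2 * pi * 0 * y)" by (simp only: mult_zero_right mult_zero_left cos_zero mult_1_right)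
    with elim show ?case by (rule trans[THEN sym, rotated])
  qed
  moreover have "vp_base \<in> borel_measurable lborel" by measurable
  ultimately show ?thesis by (blast intro: integrable_cong_AE_imp)
qed

text \<open>The four integrals are multiples of \<open>2 + v\<close>, \<open>2 - v\<close>, \<open>1 + v\<close> and \<open>1 - v\<close>, and \<open>v\<close> cancels. Outside
\<open>[-1, 1]\<close> the absolute values would no longer cancel.\<close>

lemma integral_vp_base_cos:
  assumes "\<bar>v\<bar> \<le> 1"
  shows "(LINT y|lborel. vp_base y * cos (2 * pi * v * y)) = osc_const / pi"
proof -
  have "(LINT y|lborel. vp_base y * cos (2 * pi * v * y)) = (LINT y|lborel. (osc (2 * pi * (2 + v)) y + osc (2 * pi * (2 - v)) y - osc (2 * pi * (1 + v)) y - osc (2 * pi * (1 - v)) y) / (4 * pi\<^sup>2))"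
    by (intro Bochner_Integration.integral_cong_AE vp_base_mult_cos) measurable
  also have "\<dots> = (2 * pi * (2 + v) * osc_const + 2 * pi * (2 - v) * osc_const - 2 * pi * (1 + v) * osc_const - 2 * pi * (1 - v) * osc_const) / (4 * pi\<^sup>2)"
    using assms by (simp add: integrable_osc integral_osc abs_mult)
  also have "\<dots> = osc_const / pi" by (simp add: field_simps power2_eq_square)
  finally show ?thesis .
qed

lemma integral_vp_base_sin: "(LINT y|lborel. vp_base y * sin (2 * pi * v * y)) = 0"
proof -
  have "(LINT y|lborel. vp_base y * sin (2 * pi * v * y)) = (LINT y|lborel. vp_base (0 + (-1) * y) * sin (2 * pi * v * (0 + (-1) * y)))"
    by (subst lborel_integral_real_affine[of "-1" _ 0]) auto
  also have "\<dots> = (LINT y|lborel. - (vp_base y * sin (2 * pi * v * y)))"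
    by (rule Bochner_Integration.integral_cong) (simp_all add: vp_base_def)
  also have "\<dots> = - (LINT y|lborel. vp_base y * sin (2 * pi * v * y))" by simp
  finally show ?thesis by simp
qed

definition vp :: "real \<Rightarrow> complex" where
  "vp y = complex_of_real (vp_base y / (osc_const / pi))"

lemma vp_measurable [measurable]: "vp \<in> borel_measurable borel"
  unfolding vp_def by measurable

lemma integrable_vp: "integrable lborel vp"
  unfolding vp_def by (intro integrable_of_real integrable_divide_zero integrable_vp_base)

lemma bandlimited_vp: "\<exists>A. bandlimited {-2..2} A vp"
proof -
  obtain A where "bandlimited {-2..2} A (\<lambda>y. complex_of_real (vp_base y))" using bandlimited_vp_base by blast
  from bandlimited_cmult[OF this, of "of_real (1 / (osc_const / pi))"]
  show ?thesis unfolding vp_def by (auto simp: divide_inverse mult_ac)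
qed

lemma vp_fourier:
  assumes "\<bar>v\<bar> \<le> 1"
  shows "(LINT y|lborel. vp y * unit_exp (- (v * y))) = 1"
proof -
  let ?c = "osc_const / pi"
  have c: "?c > 0" using osc_const_pos by simp
  have i: "integrable lborel (\<lambda>y. vp_base y * cos (2 * pi * v * y))" "integrable lborel (\<lambda>y. vp_base y * sin (2 * pi * v * y))"
    by (rule Bochner_Integration.integrable_bound[OF integrable_vp_base]; auto simp: abs_mult intro!: mult_left_le)+
  have "(LINT y|lborel. vp y * unit_exp (- (v * y))) =
    (LINT y|lborel. (complex_of_real (vp_base y * cos (2 * pi * v * y)) - \<i> * complex_of_real (vp_base y * sin (2 * pi * v * y))) * of_real (1 / ?c))"
  proof (rule Bochner_Integration.integral_cong[OF refl])
    fix y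
    have "unit_exp (- (v * y)) = complex_of_real (cos (2 * pi * v * y)) - \<i> * complex_of_real (sin (2 * pi * v * y))"
      unfolding unit_exp_conv_cis by (simp add: complex_eq_iff mult_ac)
    then show "vp y * unit_exp (- (v * y)) = (complex_of_real (vp_base y * cos (2 * pi * v * y)) - \<i> * complex_of_real (vp_base y * sin (2 * pi * v * y))) * of_real (1 / ?c)"
      unfolding vp_def by (simp only: of_real_mult of_real_divide) (simp add: algebra_simps)
  qed
  also have "\<dots> = (complex_of_real (LINT y|lborel. vp_base y * cos (2 * pi * v * y)) - \<i> * complex_of_real (LINT y|lborel. vp_base y * sin (2 * pi * v * y))) * of_real (1 / ?c)"
    using i unfolding integral_mult_left_zero by (subst Bochner_Integration.integral_diff) (simp_all only: integrable_of_real integrable_mult_right integral_mult_right_zero integral_complex_of_real)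
  also have "\<dots> = 1" using c osc_const_pos by (simp add: integral_vp_base_cos[OF assms] integral_vp_base_sin)
  finally show ?thesis .
qed

section \<open>Reproducing kernels for parallelograms\<close>

definition vpw :: "real \<Rightarrow> real \<Rightarrow> complex" where
  "vpw w y = of_real w * vp (w * y)"

lemma vpw_measurable [measurable]: "vpw w \<in> borel_measurable borel"
  unfolding vpw_def by measurable

lemma integrable_vpw: "w > 0 \<Longrightarrow> integrable lborel (vpw w)"
  unfolding vpw_def using lborel_integrable_real_affine[OF integrable_vp, of w 0] by auto

definition vp_norm :: real where "vp_norm = (LINT y|lborel. norm (vp y))"

lemma vp_norm_ge_1: "vp_norm \<ge> 1"
proof -
  have "norm (LINT y|lborel. vp y * unit_exp (- (0 * y))) \<le> (LINT y|lborel. norm (vp y * unit_exp (- (0 * y))))"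
    by (rule integral_norm_bound)
  then show ?thesis by (simp only: vp_fourier[of 0] abs_zero zero_le_one) (simp add: vp_norm_def)
qed

lemma integral_norm_vpw: "w > 0 \<Longrightarrow> (LINT y|lborel. norm (vpw w y)) = vp_norm"
  using lborel_integral_real_affine[of w "\<lambda>y. norm (vp y)" 0]
  by (simp add: vpw_def vp_norm_def norm_mult)

lemma vpw_fourier:
  assumes "w > 0" "\<bar>v\<bar> \<le> w"
  shows "(LINT y|lborel. vpw w y * unit_exp (- (v * y))) = 1"
proof -
  have "1 = (LINT y|lborel. vp y * unit_exp (- ((v / w) * y)))"
    using assms by (intro vp_fourier[symmetric]) simp
  also have "\<dots> = w *\<^sub>R (LINT y|lborel. vp (0 + w * y) * unit_exp (- ((v / w) * (0 + w * y))))"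
    using assms by (subst lborel_integral_real_affine[of w _ 0]) auto
  also have "\<dots> = (LINT y|lborel. vpw w y * unit_exp (- (v * y)))"
    using assms by (simp add: vpw_def scaleR_conv_of_real mult_ac flip: integral_mult_right_zero)
  finally show ?thesis by simp
qed

lemma lborel_pair_product:
  fixes f g :: "real \<Rightarrow> complex"
  assumes "integrable lborel f" "integrable lborel g"
  shows "integrable lborel (\<lambda>z. f (fst z) * g (snd z))"
    and "(LINT z|lborel. f (fst z) * g (snd z)) = (LINT x|lborel. f x) * (LINT y|lborel. g y)"
proof -
  have [measurable]: "f \<in> borel_measurable borel" "g \<in> borel_measurable borel" using assms by (auto dest: borel_measurable_integrable)
  have i: "integrable (lborel \<Otimes>\<^sub>M lborel) (\<lambda>z. f (fst z) * g (snd z))"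
  proof (rule lborel_pair.Fubini_integrable)
    show "integrable lborel (\<lambda>x. LINT y|lborel. norm (f (fst (x, y)) * g (snd (x, y))))"
      using assms by (simp add: norm_mult)
    show "AE x in lborel. integrable lborel (\<lambda>y. f (fst (x, y)) * g (snd (x, y)))"
      using assms by simp
  qed measurable
  then show "integrable lborel (\<lambda>z. f (fst z) * g (snd z))" by (simp add: lborel_prod)
  show "(LINT z|lborel. f (fst z) * g (snd z)) = (LINT x|lborel. f x) * (LINT y|lborel. g y)"
    using lborel_pair.integral_fst'[OF i] by (simp add: lborel_prod)
qed

text \<open>A parallelogram with two vertical sides and two sides of slope \<open>m\<close>, centred at \<open>\<gamma>\<close>.\<close>

definition parallelogram :: "real \<times> real \<Rightarrow> real \<Rightarrow> real \<Rightarrow> real \<Rightarrow> (real \<times> real) set" where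
  "parallelogram \<gamma> m s w = {\<xi>. \<bar>fst \<xi> - fst \<gamma>\<bar> \<le> s \<and> \<bar>tilt m \<xi> - tilt m \<gamma>\<bar> \<le> w}"

text \<open>The product of two one-dimensional kernels in sheared coordinates, modulated to the frequency \<open>\<gamma>\<close>. Its Fourier
transform is \<open>1\<close> on the parallelogram with half-widths \<open>s\<close> and \<open>w\<close> and vanishes outside the doubled one.\<close>

definition pkernel :: "real \<times> real \<Rightarrow> real \<Rightarrow> real \<Rightarrow> real \<Rightarrow> real \<times> real \<Rightarrow> complex" where
  "pkernel \<gamma> m s w x = unit_exp (\<gamma> \<bullet> x) * (vpw s (fst x + m * snd x) * vpw w (snd x))"

lemma borel_measurable_fst_real [measurable]: "(fst :: real \<times> real \<Rightarrow> real) \<in> borel_measurable borel"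
  and borel_measurable_snd_real [measurable]: "(snd :: real \<times> real \<Rightarrow> real) \<in> borel_measurable borel"
  by (intro borel_measurable_continuous_onI continuous_intros)+

lemma pkernel_measurable [measurable]: "pkernel \<gamma> m s w \<in> borel_measurable borel"
  unfolding pkernel_def by measurable

lemma pkernel_shear_fourier:
  "pkernel \<gamma> m s w (shear m x) * unit_exp (- (\<xi> \<bullet> shear m x)) =
    (vpw s (fst x) * unit_exp (- ((fst \<xi> - fst \<gamma>) * fst x))) * (vpw w (snd x) * unit_exp (- ((tilt m \<xi> - tilt m \<gamma>) * snd x)))"
proof -
  have e: "unit_exp (\<gamma> \<bullet> shear m x) * unit_exp (- (\<xi> \<bullet> shear m x)) =
    unit_exp (- ((fst \<xi> - fst \<gamma>) * fst x)) * unit_exp (- ((tilt m \<xi> - tilt m \<gamma>) * snd x))"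
    by (cases x; cases \<xi>; cases \<gamma>) (simp add: shear_def tilt_def algebra_simps flip: unit_exp_add)
  have "pkernel \<gamma> m s w (shear m x) = unit_exp (\<gamma> \<bullet> shear m x) * (vpw s (fst x) * vpw w (snd x))"
    by (cases x) (simp add: pkernel_def shear_def)
  then have "pkernel \<gamma> m s w (shear m x) * unit_exp (- (\<xi> \<bullet> shear m x)) =
      (unit_exp (\<gamma> \<bullet> shear m x) * unit_exp (- (\<xi> \<bullet> shear m x))) * (vpw s (fst x) * vpw w (snd x))"
    by (simp only: mult_ac)
  then show ?thesis unfolding e by (simp only: mult_ac)
qed

lemma integrable_vpw_mult: "w > 0 \<Longrightarrow> integrable lborel (\<lambda>y. vpw w y * unit_exp (- (v * y)))"
  by (rule Bochner_Integration.integrable_bound[OF integrable_vpw]) (auto simp: norm_mult)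

lemma pkernel_fourier:
  assumes "s > 0" "w > 0" "\<xi> \<in> parallelogram \<gamma> m s w"
  shows "(LINT y|lborel. pkernel \<gamma> m s w y * unit_exp (- (\<xi> \<bullet> y))) = 1"
proof -
  have "(LINT y|lborel. pkernel \<gamma> m s w y * unit_exp (- (\<xi> \<bullet> y))) = (LINT y|lborel. pkernel \<gamma> m s w (shear m y) * unit_exp (- (\<xi> \<bullet> shear m y)))"
    by (rule integral_shear[symmetric]) measurable
  also have "\<dots> = 1"
    unfolding pkernel_shear_fourier
    by (subst lborel_pair_product(2)[OF integrable_vpw_mult integrable_vpw_mult]) (use assms in \<open>simp_all add: vpw_fourier parallelogram_def\<close>)
  finally show ?thesis .
qed

lemma integrable_pkernel:
  assumes "s > 0" "w > 0"
  shows "integrable lborel (pkernel \<gamma> m s w)" "(LINT y|lborel. norm (pkernel \<gamma> m s w y)) = vp_norm\<^sup>2"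
proof -
  have "integrable lborel (\<lambda>y. pkernel \<gamma> m s w (shear m y) * unit_exp (- (0 \<bullet> shear m y)))"
    unfolding pkernel_shear_fourier by (intro lborel_pair_product integrable_vpw_mult assms)
  then show "integrable lborel (pkernel \<gamma> m s w)" by (simp add: integrable_shear)
  have "(LINT y|lborel. norm (pkernel \<gamma> m s w y)) = (LINT y|lborel. norm (pkernel \<gamma> m s w (shear m y)))"
    by (rule integral_shear[symmetric]) measurable
  also have "\<dots> = (LINT y|lborel. norm (vpw s (fst y)) * norm (vpw w (snd y)))"
    by (rule Bochner_Integration.integral_cong) (auto simp: pkernel_def norm_mult shear_def split_beta)
  also have "\<dots> = Re (LINT y|lborel. of_real (norm (vpw s (fst y))) * of_real (norm (vpw w (snd y))))"
    by (simp only: of_real_mult[symmetric] integral_complex_of_real Re_complex_of_real)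
  also have "\<dots> = vp_norm\<^sup>2"
    using assms
    by (subst lborel_pair_product(2)) (auto simp: integrable_vpw integral_norm_vpw power2_eq_square integral_complex_of_real intro!: integrable_of_real)
  finally show "(LINT y|lborel. norm (pkernel \<gamma> m s w y)) = vp_norm\<^sup>2" .
qed

lemma bandlimited_pkernel:
  assumes "s > 0" "w > 0"
  shows "\<exists>A. bandlimited (parallelogram \<gamma> m (2 * s) (2 * w)) A (pkernel \<gamma> m s w)"
proof -
  obtain A where A: "bandlimited {-2..2} A vp" using bandlimited_vp by blast
  have 1: "bandlimited ((\<lambda>v. (v * s, v * s * m)) ` {-2..2}) A (\<lambda>x. vp (s * (fst x + m * snd x)))"
    by (rule bandlimited_linear[OF _ A]) (auto simp: inner_prod_def algebra_simps)
  have 2: "bandlimited ((\<lambda>v. (0, v * w)) ` {-2..2}) A (\<lambda>x::real \<times> real. vp (w * snd x))"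
    by (rule bandlimited_linear[OF _ A]) (auto simp: inner_prod_def algebra_simps)
  note 3 = bandlimited_mult[OF bandlimited_unit_exp[of \<gamma>] bandlimited_mult[OF bandlimited_cmult[OF 1, of "of_real s"] bandlimited_cmult[OF 2, of "of_real w"]]]
  have abs: "\<bar>v * s\<bar> \<le> 2 * s" if "v \<in> {-2..2}" "s > 0" for v s :: real
    using that by (auto simp: abs_mult intro!: mult_right_mono)
  show ?thesis
    unfolding pkernel_def vpw_def
    by (rule exI, rule bandlimited_mono[OF 3])
       (use assms abs in \<open>auto simp: parallelogram_def tilt_def algebra_simps\<close>)
qed

lemma lborel_reflect:
  fixes f :: "'a::euclidean_space \<Rightarrow> 'b::{banach, second_countable_topology}"
  assumes [measurable]: "f \<in> borel_measurable borel"
  shows "(LINT y|lborel. f (x - y)) = (LINT y|lborel. f y)"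
    and "integrable lborel (\<lambda>y. f (x - y)) \<longleftrightarrow> integrable lborel f"
proof -
  have e: "distr lborel borel (\<lambda>y::'a. x - y) = lborel"
    using lborel_affine[of "-1" x] by (simp add: density_1)
  show "(LINT y|lborel. f (x - y)) = (LINT y|lborel. f y)"
    using integral_distr[of "\<lambda>y. x - y" lborel borel f] by (simp add: e)
  show "integrable lborel (\<lambda>y. f (x - y)) \<longleftrightarrow> integrable lborel f"
    using integrable_distr_eq[of "\<lambda>y. x - y" lborel borel f] by (simp add: e)
qed

lemma nn_integral_translate:
  fixes f :: "'a::euclidean_space \<Rightarrow> ennreal"
  assumes [measurable]: "f \<in> borel_measurable borel"
  shows "(\<integral>\<^sup>+x. f (x - y) \<partial>lborel) = (\<integral>\<^sup>+x. f x \<partial>lborel)"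
proof -
  have e: "distr lborel borel (\<lambda>x. - y + x) = lborel" by (rule lborel_distr_plus)
  show ?thesis using nn_integral_distr[of "\<lambda>x. - y + x" lborel borel f] unfolding e by simp
qed

definition conv :: "('a::euclidean_space \<Rightarrow> complex) \<Rightarrow> ('a \<Rightarrow> complex) \<Rightarrow> 'a \<Rightarrow> complex" where
  "conv V h x = (LINT y|lborel. h y * V (x - y))"

lemma conv_integrable:
  fixes V h :: "'a::euclidean_space \<Rightarrow> complex"
  assumes V: "integrable lborel V" and [measurable]: "h \<in> borel_measurable borel" and h: "\<And>y. norm (h y) \<le> M"
  shows "integrable lborel (\<lambda>y. h y * V (x - y))"
proof -
  have [measurable]: "V \<in> borel_measurable borel" using V by (auto dest: borel_measurable_integrable)
  have "integrable lborel (\<lambda>y. V (x - y))" using V lborel_reflect(2)[of V x] by simp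
  then have "integrable lborel (\<lambda>y. of_real M * V (x - y))" by (rule integrable_mult_right)
  then show ?thesis
    by (rule Bochner_Integration.integrable_bound)
       (use h in \<open>auto simp: norm_mult intro!: AE_I2 mult_right_mono order_trans[OF h abs_ge_self]\<close>)
qed

text \<open>For an exponential of frequency \<open>\<xi>\<close> in \<open>B\<close> this is the hypothesis on the Fourier transform of \<open>V\<close>. It passes to
limits of trigonometric polynomials because these are uniformly bounded.\<close>

lemma conv_reproducing:
  assumes f: "bandlimited B A f" and V: "integrable lborel V"
    and B: "\<And>\<xi>. \<xi> \<in> B \<Longrightarrow> (LINT y|lborel. V y * unit_exp (- (\<xi> \<bullet> y))) = 1"
  shows "conv V f = f"
proof
  fix x
  have [measurable]: "V \<in> borel_measurable borel" using V by (auto dest: borel_measurable_integrable)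
  have tp: "(LINT y|lborel. p y * V (x - y)) = p x" if "trig_poly B A p" for p A
    using that
  proof (induction rule: trig_poly.induct)
    case (add A p \<xi> c)
    note [measurable] = trig_poly_measurable[OF add(1)]
    have i1: "integrable lborel (\<lambda>y. p y * V (x - y))"
      by (rule conv_integrable[OF V _ trig_poly_bound[OF add(1)]]) measurable
    have i2: "integrable lborel (\<lambda>y. unit_exp (\<xi> \<bullet> y) * V (x - y))"
      by (rule conv_integrable[OF V, of _ 1]) auto
    have "(LINT y|lborel. unit_exp (\<xi> \<bullet> y) * V (x - y)) = (LINT y|lborel. unit_exp (\<xi> \<bullet> (x - y)) * V (x - (x - y)))"
      by (subst lborel_reflect(1)[of _ x, symmetric]) auto
    also have "\<dots> = (LINT y|lborel. unit_exp (\<xi> \<bullet> x) * (V y * unit_exp (- (\<xi> \<bullet> y))))"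
      by (simp add: inner_diff_right unit_exp_diff mult_ac)
    also have "\<dots> = unit_exp (\<xi> \<bullet> x)" using B[OF add(2)] by simp
    finally have "(LINT y|lborel. unit_exp (\<xi> \<bullet> y) * V (x - y)) = unit_exp (\<xi> \<bullet> x)" .
    then have "(LINT y|lborel. p y * V (x - y) + c * (unit_exp (\<xi> \<bullet> y) * V (x - y))) = p x + c * unit_exp (\<xi> \<bullet> x)"
      using i1 i2 add(3) by simp
    then show ?case by (simp add: algebra_simps)
  qed simp
  obtain p where p: "\<And>n. trig_poly B A (p n)" "\<And>x. (\<lambda>n. p n x) \<longlonglongrightarrow> f x"
    using f unfolding bandlimited_def by blast
  note [measurable] = trig_poly_measurable[OF p(1)] bandlimited_measurable[OF f]
  have "integrable lborel (\<lambda>y. V (x - y))" using V lborel_reflect(2)[of V x] by simp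
  then have "integrable lborel (\<lambda>y. A * norm (V (x - y)))" by (intro integrable_mult_right integrable_norm)
  then have "(\<lambda>n. LINT y|lborel. p n y * V (x - y)) \<longlonglongrightarrow> (LINT y|lborel. f y * V (x - y))"
    by (intro integral_dominated_convergence[where w = "\<lambda>y. A * norm (V (x - y))"])
       (use p in \<open>simp_all add: norm_mult tendsto_mult_right mult_right_mono trig_poly_bound[OF p(1)]\<close>)
  then have "(\<lambda>n. p n x) \<longlonglongrightarrow> conv V f x" unfolding tp[OF p(1)] conv_def .
  with p(2) show "conv V f x = f x" by (rule LIMSEQ_unique[rotated])
qed

lemma power_tangent: "(a::real) ^ n + real n * a ^ (n - 1) * (t - a) \<le> t ^ n" if "0 \<le> a" "0 \<le> t"
proof (induction n)
  case (Suc n)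
  show ?case
  proof (cases n)
    case (Suc k)
    have "t * (a ^ n + real n * a ^ (n - 1) * (t - a)) \<le> t * t ^ n" using Suc.IH that by (intro mult_left_mono) auto
    moreover have "0 \<le> real n * a ^ k * (t - a)\<^sup>2" using that by simp
    ultimately show ?thesis using Suc by (simp add: algebra_simps power2_eq_square)
  qed simp
qed simp

text \<open>Jensen's inequality for the convex function \<open>t^n\<close>, obtained by integrating the inequality between the function and its tangent at the mean
(\<open>power_tangent\<close>).\<close>

lemma weighted_power_mean:
  fixes V h :: "'a \<Rightarrow> real"
  assumes V: "integrable M V" "\<And>y. V y \<ge> 0" and h: "\<And>y. h y \<ge> 0"
    and i: "integrable M (\<lambda>y. V y * h y)" "integrable M (\<lambda>y. V y * h y ^ n)" and n: "n \<ge> 1"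
  shows "(LINT y|M. V y * h y) ^ n \<le> (LINT y|M. V y) ^ (n - 1) * (LINT y|M. V y * h y ^ n)"
proof -
  define v where "v = (LINT y|M. V y)"
  define a where "a = (LINT y|M. V y * h y)"
  have v0: "v \<ge> 0" "a \<ge> 0" using V h by (auto simp: v_def a_def)
  show ?thesis
  proof (cases "v = 0")
    case True
    then have "AE y in M. V y = 0" using V unfolding v_def by (subst (asm) integral_nonneg_eq_0_iff_AE) auto
    then have "AE y in M. V y * h y = 0" by eventually_elim simp
    then have "a = 0" unfolding a_def by (rule integral_eq_zero_AE)
    then show ?thesis using n V h by (simp add: a_def[symmetric] zero_power)
  next
    case False
    then have vp: "v > 0" using v0 by simp
    define b where "b = a / v"
    have b0: "b \<ge> 0" using vp v0 by (simp add: b_def)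
    have "(LINT y|M. V y * (b ^ n + real n * b ^ (n - 1) * (h y - b))) \<le> (LINT y|M. V y * h y ^ n)"
      by (rule integral_mono') (use i V h power_tangent[OF b0 h] in \<open>auto intro!: mult_left_mono\<close>)
    also have "(\<lambda>y. V y * (b ^ n + real n * b ^ (n - 1) * (h y - b))) = (\<lambda>y. V y * (b ^ n - real n * b ^ (n - 1) * b) + real n * b ^ (n - 1) * (V y * h y))"
      by (auto simp: algebra_simps)
    also have "(LINT y|M. V y * (b ^ n - real n * b ^ (n - 1) * b) + real n * b ^ (n - 1) * (V y * h y)) = v * (b ^ n - real n * b ^ (n - 1) * b) + real n * b ^ (n - 1) * a"
      using V i by (simp add: v_def a_def)
    also have "\<dots> = v * b ^ n" using vp by (simp add: b_def field_simps)
    finally have "v ^ (n - 1) * (v * b ^ n) \<le> v ^ (n - 1) * (LINT y|M. V y * h y ^ n)"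
      using v0 by (intro mult_left_mono) auto
    also have "v ^ (n - 1) * (v * b ^ n) = (v * b) ^ n" using n by (cases n) (auto simp: power_mult_distrib)
    also have "v * b = a" using vp by (simp add: b_def)
    finally show ?thesis by (simp add: v_def a_def)
  qed
qed

definition test_fun :: "('a::euclidean_space \<Rightarrow> complex) \<Rightarrow> bool" where
  "test_fun h \<longleftrightarrow> h \<in> borel_measurable borel \<and> (\<exists>M. \<forall>x. norm (h x) \<le> M) \<and> (\<exists>R. \<forall>x. norm x > R \<longrightarrow> h x = 0)"

lemma test_fun_integrable:
  assumes "test_fun h" and \<phi>: "\<phi> \<in> borel_measurable borel" "\<phi> 0 = 0" "\<And>M. \<exists>M'. \<forall>t. norm t \<le> M \<longrightarrow> norm (\<phi> t) \<le> M'"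
  shows "integrable lborel (\<lambda>x. \<phi> (h x) :: 'b :: {banach, second_countable_topology})"
proof -
  from assms(1) obtain M R where h: "\<And>x. norm (h x) \<le> M" "\<And>x. norm x > R \<Longrightarrow> h x = 0" and [measurable]: "h \<in> borel_measurable borel"
    unfolding test_fun_def by blast
  note [measurable] = \<phi>(1)
  obtain M' where M': "\<And>t. norm t \<le> M \<Longrightarrow> norm (\<phi> t) \<le> M'" using \<phi>(3) by blast
  have "integrable lborel (\<lambda>x::'a. indicator (cball 0 R) x *\<^sub>R M')"
    by (intro integrable_scaleR_left integrable_real_indicator) (use emeasure_bounded_finite[OF bounded_cball, of "0::'a" R] in simp_all)
  then show ?thesis
  proof (rule Bochner_Integration.integrable_bound)
    show "AE x in lborel. norm (\<phi> (h x)) \<le> norm (indicator (cball 0 R) x *\<^sub>R M')"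
    proof (rule AE_I2)
      fix x
      show "norm (\<phi> (h x)) \<le> norm (indicator (cball 0 R) x *\<^sub>R M')"
      proof (cases "norm x > R")
        case True
        then show ?thesis using h(2) \<phi>(2) by simp
      next
        case False
        then show ?thesis using M'[OF h(1)[of x]] by (simp add: indicator_def)
      qed
    qed
  qed measurable
qed

lemma test_fun_power:
  assumes "test_fun h" "n \<ge> 1"
  shows "integrable lborel (\<lambda>x. norm (h x) ^ n)"
  by (rule test_fun_integrable[OF assms(1), of "\<lambda>t. norm t ^ n"])
     (use assms(2) in \<open>auto simp: zero_power intro!: exI power_mono\<close>)

lemma test_fun_L1: "test_fun h \<Longrightarrow> integrable lborel h"
  using test_fun_integrable[of h "\<lambda>t. t"] by auto

text \<open>Young's inequality for convolution with an integrable kernel.\<close>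

lemma conv_power_bound:
  fixes V h :: "'a::euclidean_space \<Rightarrow> complex"
  assumes V: "integrable lborel V" "(LINT y|lborel. norm (V y)) = v" and h: "test_fun h" and n: "n \<ge> 1"
    and [measurable]: "conv V h \<in> borel_measurable borel"
  shows "integrable lborel (\<lambda>x. norm (conv V h x) ^ n)"
    and "(LINT x|lborel. norm (conv V h x) ^ n) \<le> v ^ n * (LINT x|lborel. norm (h x) ^ n)"
proof -
  have [measurable]: "V \<in> borel_measurable borel" using V by (auto dest: borel_measurable_integrable)
  obtain M where M: "\<And>x. norm (h x) \<le> M" and [measurable]: "h \<in> borel_measurable borel"
    using h unfolding test_fun_def by blast
  have v0: "v \<ge> 0" using V by (auto simp flip: V(2))
  have hn: "integrable lborel (\<lambda>x. norm (h x) ^ n)" by (rule test_fun_power[OF h n])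
  have iVn: "integrable lborel (\<lambda>y. norm (V (x - y)) * norm (h y) ^ k)" for x k
  proof -
    have "integrable lborel (\<lambda>y. (h y) ^ k * V (x - y))"
      by (rule conv_integrable[OF V(1), of _ "M ^ k"]) (auto simp: norm_power intro!: power_mono M)
    from integrable_norm[OF this] show ?thesis by (simp add: norm_mult norm_power mult.commute)
  qed
  have pw: "norm (conv V h x) ^ n \<le> v ^ (n - 1) * (LINT y|lborel. norm (V (x - y)) * norm (h y) ^ n)" for x
  proof -
    have "norm (conv V h x) \<le> (LINT y|lborel. norm (V (x - y)) * norm (h y))"
      unfolding conv_def by (rule order_trans[OF integral_norm_bound]) (simp add: norm_mult mult.commute)
    then have "norm (conv V h x) ^ n \<le> (LINT y|lborel. norm (V (x - y)) * norm (h y)) ^ n" by (intro power_mono) auto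
    also have "\<dots> \<le> (LINT y|lborel. norm (V (x - y))) ^ (n - 1) * (LINT y|lborel. norm (V (x - y)) * norm (h y) ^ n)"
      by (rule weighted_power_mean) (use iVn[of x 0] iVn[of x 1] iVn[of x n] n in simp_all)
    also have "(LINT y|lborel. norm (V (x - y))) = v"
      using lborel_reflect(1)[of "\<lambda>y. norm (V y)" x] V(2) by simp
    finally show ?thesis .
  qed
  have "(\<integral>\<^sup>+x. ennreal (norm (conv V h x) ^ n) \<partial>lborel) \<le>
    (\<integral>\<^sup>+x. ennreal (v ^ (n - 1)) * (\<integral>\<^sup>+y. ennreal (norm (V (x - y))) * ennreal (norm (h y) ^ n) \<partial>lborel) \<partial>lborel)"
  proof (rule nn_integral_mono)
    fix x :: 'a
    have "(\<integral>\<^sup>+y. ennreal (norm (V (x - y))) * ennreal (norm (h y) ^ n) \<partial>lborel) = ennreal (LINT y|lborel. norm (V (x - y)) * norm (h y) ^ n)"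
      by (subst nn_integral_eq_integral[OF iVn, symmetric]) (auto simp: ennreal_mult)
    then show "ennreal (norm (conv V h x) ^ n) \<le> ennreal (v ^ (n - 1)) * (\<integral>\<^sup>+y. ennreal (norm (V (x - y))) * ennreal (norm (h y) ^ n) \<partial>lborel)"
      using pw[of x] v0 by (simp flip: ennreal_mult')
  qed
  also have "\<dots> = ennreal (v ^ (n - 1)) * (\<integral>\<^sup>+x. \<integral>\<^sup>+y. ennreal (norm (V (x - y))) * ennreal (norm (h y) ^ n) \<partial>lborel \<partial>lborel)"
    by (rule nn_integral_cmult) measurable
  also have "(\<integral>\<^sup>+x. \<integral>\<^sup>+y. ennreal (norm (V (x - y))) * ennreal (norm (h y) ^ n) \<partial>lborel \<partial>lborel) =
     (\<integral>\<^sup>+y. \<integral>\<^sup>+x. ennreal (norm (V (x - y))) * ennreal (norm (h y) ^ n) \<partial>lborel \<partial>lborel)"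
    by (rule lborel_pair.Fubini') measurable
  also have "\<dots> = (\<integral>\<^sup>+y. ennreal v * ennreal (norm (h y) ^ n) \<partial>lborel)"
  proof (rule nn_integral_cong)
    fix y :: 'a
    have "(\<integral>\<^sup>+x. ennreal (norm (V (x - y))) \<partial>lborel) = (\<integral>\<^sup>+x. ennreal (norm (V x)) \<partial>lborel)"
      by (rule nn_integral_translate[where f = "\<lambda>x. ennreal (norm (V x))"]) measurable
    also have "\<dots> = ennreal v" unfolding V(2)[symmetric] by (rule nn_integral_eq_integral) (use V in auto)
    finally show "(\<integral>\<^sup>+x. ennreal (norm (V (x - y))) * ennreal (norm (h y) ^ n) \<partial>lborel) = ennreal v * ennreal (norm (h y) ^ n)"
      by (simp add: nn_integral_multc)
  qed
  also have "\<dots> = ennreal v * ennreal (LINT x|lborel. norm (h x) ^ n)"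
    by (subst nn_integral_cmult) (auto simp: nn_integral_eq_integral[OF hn])
  also have "ennreal (v ^ (n - 1)) * \<dots> = ennreal (v ^ n * (LINT x|lborel. norm (h x) ^ n))"
  proof -
    have "v ^ n = v ^ (n - 1) * v" using n by (cases n) auto
    then show ?thesis using v0 by (simp add: ennreal_mult' mult.assoc)
  qed
  finally have b: "(\<integral>\<^sup>+x. ennreal (norm (conv V h x) ^ n) \<partial>lborel) \<le> ennreal (v ^ n * (LINT x|lborel. norm (h x) ^ n))" .
  have r0: "0 \<le> v ^ n * (LINT x|lborel. norm (h x) ^ n)" using v0 by simp
  show i: "integrable lborel (\<lambda>x. norm (conv V h x) ^ n)"
    by (rule integrableI_bounded) (use b in \<open>auto simp: norm_power intro: order.strict_trans1\<close>)
  show "(LINT x|lborel. norm (conv V h x) ^ n) \<le> v ^ n * (LINT x|lborel. norm (h x) ^ n)"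
    using b r0 by (subst (asm) nn_integral_eq_integral[OF i]) auto
qed

section \<open>Real interpolation between the exponents two and six\<close>

lemma sum_block_shift: "(\<Sum>j\<in>block q l. g j) = (\<Sum>i<2 ^ l. g (q + i))"
  by (rule sum.reindex_bij_witness[of _ "\<lambda>i. q + i" "\<lambda>j. j - q"]) (auto simp: block_def)

lemma (in tangent_separated) L2_orthogonality:
  assumes U: "block q l \<subseteq> U" and g: "\<And>j. j \<in> block q l \<Longrightarrow> \<exists>A. bandlimited (B j) A (g j)" "\<And>j. j \<in> block q l \<Longrightarrow> square_int (g j)"
  shows "(LINT x|lborel. norm (\<Sum>j\<in>block q l. g j x) ^ 2) \<le> 2 * real \<kappa> * (\<Sum>j\<in>block q l. LINT x|lborel. norm (g j x) ^ 2)"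
  unfolding sum_block_shift
proof (rule almost_orthogonality[OF unit_pos kappa_pos, where B = "\<lambda>i. B (q + i)" and m = "m q"])
  fix i :: nat assume "i < 2 ^ l"
  then have "q + i \<in> block q l" by (simp add: block_def)
  then show "\<exists>A. bandlimited (B (q + i)) A (g (q + i))" "square_int (g (q + i))" using g by auto
next
  fix i j \<xi> \<eta> assume ij: "i < j" "j < 2 ^ l" "i + \<kappa> \<le> j" "\<xi> \<in> B (q + i)" "\<eta> \<in> B (q + j)"
  then have "q + i \<in> block q l" "q + j \<in> block q l" "q \<in> block q l" by (auto simp: block_def)
  then have "u * (real (q + i - q) + 1) * real (q + j - (q + i)) \<le> \<bar>tilt (m q) \<xi> - tilt (m q) \<eta>\<bar>"
    using ij U by (intro right) auto
  moreover have "u * (1 * 1) \<le> u * ((real i + 1) * real (j - i))"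
    using ij unit_pos by (intro mult_left_mono mult_mono) auto
  ultimately show "u \<le> \<bar>tilt (m q) \<xi> - tilt (m q) \<eta>\<bar>" by (simp add: mult.assoc)
qed

lemma geometric_dyadic_sum:
  fixes I :: "int set" and a y :: real
  assumes I: "finite I" and a: "a > 0" and y: "y > 0"
  shows "(\<Sum>i\<in>I. if 2 powr i \<le> y then 2 powr (i * a) else 0) \<le> y powr a / (1 - 2 powr (- a))"
proof -
  define J where "J = {i \<in> I. 2 powr i \<le> y}"
  have fJ: "finite J" using I by (simp add: J_def)
  define r where "r = 2 powr (- a)"
  have r: "0 < r" "r < 1" using a powr_less_mono[of "-a" 0 2] by (simp_all add: r_def)
  have eq: "(\<Sum>i\<in>I. if 2 powr i \<le> y then 2 powr (i * a) else 0) = (\<Sum>i\<in>J. 2 powr (i * a))"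
    unfolding J_def using I by (simp add: sum.inter_filter)
  show ?thesis
  proof (cases "J = {}")
    case True
    then show ?thesis unfolding eq using r by (simp add: r_def)
  next
    case False
    define k where "k = Max J"
    have k: "k \<in> J" "\<And>i. i \<in> J \<Longrightarrow> i \<le> k" using fJ False by (auto simp: k_def)
    have "(\<Sum>i\<in>J. 2 powr (i * a)) = (\<Sum>i\<in>J. 2 powr (k * a) * r ^ nat (k - i))"
    proof (rule sum.cong[OF refl])
      fix i assume "i \<in> J"
      then have "real (nat (k - i)) = real_of_int k - real_of_int i" using k(2) by simp
      then have "r ^ nat (k - i) = 2 powr (- a * (real_of_int k - real_of_int i))"
        unfolding r_def by (simp add: powr_powr flip: powr_realpow)
      then show "2 powr (i * a) = 2 powr (k * a) * r ^ nat (k - i)"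
        by (simp add: algebra_simps flip: powr_add)
    qed
    also have "\<dots> = 2 powr (k * a) * (\<Sum>n\<in>(\<lambda>i. nat (k - i)) ` J. r ^ n)"
    proof -
      have "inj_on (\<lambda>i. nat (k - i)) J" using k(2) by (intro inj_onI) (smt (verit) nat_eq_iff)
      then show ?thesis by (simp add: sum.reindex sum_distrib_left)
    qed
    also have "\<dots> \<le> 2 powr (k * a) * (\<Sum>n. r ^ n)"
      using r fJ by (intro mult_left_mono sum_le_suminf summable_geometric) auto
    also have "\<dots> = (2 powr k) powr a / (1 - r)" using r by (simp add: suminf_geometric powr_powr divide_inverse)
    also have "\<dots> \<le> y powr a / (1 - r)"
      using k(1) a r by (intro divide_right_mono powr_mono2) (auto simp: J_def)
    finally show ?thesis unfolding eq r_def .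
  qed
qed

text \<open>Convexity of the cube for the weights \<open>q j\<close> and the values \<open>S j / q j\<close>, again by a tangent.\<close>

lemma weighted_cube_sum:
  fixes q S :: "'i \<Rightarrow> real"
  assumes J: "finite J" and q: "\<And>j. j \<in> J \<Longrightarrow> q j > 0" "(\<Sum>j\<in>J. q j) = 1" and S: "\<And>j. j \<in> J \<Longrightarrow> S j \<ge> 0"
  shows "(\<Sum>j\<in>J. S j) ^ 3 \<le> (\<Sum>j\<in>J. S j ^ 3 / q j ^ 2)"
proof -
  define a where "a = (\<Sum>j\<in>J. S j)"
  have a0: "a \<ge> 0" unfolding a_def using S by (intro sum_nonneg) auto
  have "(\<Sum>j\<in>J. q j * a ^ 3 + 3 * a ^ 2 * (S j - a * q j)) \<le> (\<Sum>j\<in>J. S j ^ 3 / q j ^ 2)"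
  proof (rule sum_mono)
    fix j assume j: "j \<in> J"
    have "a ^ 3 + real 3 * a ^ (3 - 1) * (S j / q j - a) \<le> (S j / q j) ^ 3"
      using a0 q(1)[OF j] S[OF j] by (intro power_tangent) auto
    then have "q j * (a ^ 3 + real 3 * a ^ (3 - 1) * (S j / q j - a)) \<le> q j * (S j / q j) ^ 3"
      using q(1)[OF j] by (intro mult_left_mono) auto
    moreover have "q j * (S j / q j) ^ 3 = S j ^ 3 / q j ^ 2"
      using q(1)[OF j] by (simp add: power_divide power2_eq_square power3_eq_cube)
    moreover have "q j * (a ^ 3 + real 3 * a ^ (3 - 1) * (S j / q j - a)) = q j * a ^ 3 + 3 * a ^ 2 * (S j - a * q j)"
      using q(1)[OF j] by (simp add: field_simps)
    ultimately show "q j * a ^ 3 + 3 * a ^ 2 * (S j - a * q j) \<le> S j ^ 3 / q j ^ 2" by simp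
  qed
  also have "(\<Sum>j\<in>J. q j * a ^ 3 + 3 * a ^ 2 * (S j - a * q j)) = (\<Sum>j\<in>J. q j) * a ^ 3 + 3 * a ^ 2 * ((\<Sum>j\<in>J. S j) - a * (\<Sum>j\<in>J. q j))"
    by (simp add: sum.distrib sum_distrib_left sum_distrib_right sum_subtractf right_diff_distrib)
  also have "\<dots> = a ^ 3" by (simp add: q(2) a_def)
  finally show ?thesis by (simp add: a_def)
qed

text \<open>Fatou's lemma for bounds that themselves converge.\<close>

lemma nn_integral_limit_le:
  assumes [measurable]: "\<And>n. u n \<in> borel_measurable M" and lim: "\<And>x. (\<lambda>n. u n x) \<longlonglongrightarrow> (f x :: ennreal)"
    and le: "\<And>n. (\<integral>\<^sup>+x. u n x \<partial>M) \<le> c n" and c: "c \<longlonglongrightarrow> C"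
  shows "(\<integral>\<^sup>+x. f x \<partial>M) \<le> C"
proof -
  have "(\<integral>\<^sup>+x. f x \<partial>M) = (\<integral>\<^sup>+x. liminf (\<lambda>n. u n x) \<partial>M)"
    by (intro nn_integral_cong) (simp add: lim_imp_Liminf[OF _ lim])
  also have "\<dots> \<le> liminf (\<lambda>n. \<integral>\<^sup>+x. u n x \<partial>M)" by (rule nn_integral_liminf) measurable
  also have "\<dots> \<le> liminf c" by (intro Liminf_mono always_eventually allI le)
  also have "\<dots> = C" by (rule lim_imp_Liminf[OF _ c]) simp
  finally show ?thesis .
qed

lemma test_fun_restrict:
  assumes "test_fun h" "A \<in> sets borel"
  shows "test_fun (\<lambda>x. if x \<in> A then h x else 0)"
proof -
  obtain M R where "h \<in> borel_measurable borel" "\<And>x. norm (h x) \<le> M" "\<And>x. norm x > R \<Longrightarrow> h x = 0"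
    using assms unfolding test_fun_def by blast
  moreover have "0 \<le> M" using calculation(2)[of 0] norm_ge_zero order_trans by blast
  ultimately show ?thesis unfolding test_fun_def using assms(2)
    by (intro conjI exI[of _ M] exI[of _ R]) auto
qed

lemma test_fun_powr:
  assumes "test_fun h" "p > 0"
  shows "integrable lborel (\<lambda>x. norm (h x) powr p)"
  by (rule test_fun_integrable[OF assms(1), of "\<lambda>t. norm t powr p"])
     (use assms(2) in \<open>auto intro!: exI powr_mono2\<close>)

text \<open>For each dyadic height \<open>2^i\<close> split \<open>h j\<close> into the part \<open>hi i j\<close> above \<open>2^i * c j\<close> and the rest \<open>lo i j\<close>. Where
\<open>F\<close> is of size \<open>2^i\<close>, one of the sums \<open>HI i\<close> and \<open>LO i\<close> is also of that size, so \<open>|F| powr p\<close> is controlled by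
\<open>2^(i(p-2)) |HI i|\<^sup>2 + 2^(-i(6-p)) |LO i|^6\<close> summed over \<open>i\<close>. After the endpoint estimates the sums over
\<open>i\<close> are geometric at each point and return \<open>|h j| powr p\<close> times a power of \<open>c j\<close>. The choice of \<open>c j\<close> proportional to
\<open>w j\<close> is the one for which both resulting sums over \<open>j\<close> equal the \<open>\<ell>\<^sup>2\<close> expression of the conclusion.\<close>

lemma real_interpolation:
  fixes P :: "nat \<Rightarrow> (real \<times> real \<Rightarrow> complex) \<Rightarrow> real \<times> real \<Rightarrow> complex" and p K :: real
  assumes J: "finite J" "J \<noteq> {}" and p: "2 < p" "p < 6" and K: "K \<ge> 0"
    and add: "\<And>j h h'. test_fun h \<Longrightarrow> test_fun h' \<Longrightarrow> P j (\<lambda>x. h x + h' x) = (\<lambda>x. P j h x + P j h' x)"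
    and meas: "\<And>j h. test_fun h \<Longrightarrow> P j h \<in> borel_measurable borel"
    and L2: "\<And>h. (\<And>j. test_fun (h j)) \<Longrightarrow> integrable lborel (\<lambda>x. norm (\<Sum>j\<in>J. P j (h j) x) ^ 2) \<and>
        (LINT x|lborel. norm (\<Sum>j\<in>J. P j (h j) x) ^ 2) \<le> K * (\<Sum>j\<in>J. LINT x|lborel. norm (h j x) ^ 2)"
    and L6: "\<And>h S. (\<And>j. test_fun (h j)) \<Longrightarrow> (\<And>j. 0 \<le> S j) \<Longrightarrow> (\<And>j. j \<in> J \<Longrightarrow> (LINT x|lborel. norm (h j x) ^ 6) \<le> S j ^ 3) \<Longrightarrow>
        integrable lborel (\<lambda>x. norm (\<Sum>j\<in>J. P j (h j) x) ^ 6) \<and>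
        (LINT x|lborel. norm (\<Sum>j\<in>J. P j (h j) x) ^ 6) \<le> K * (\<Sum>j\<in>J. S j) ^ 3"
    and h: "\<And>j. test_fun (h j)" and w: "\<And>j. w j > 0"
    and hw: "\<And>j. j \<in> J \<Longrightarrow> (LINT x|lborel. norm (h j x) powr p) \<le> w j powr p"
  shows "(\<integral>\<^sup>+x. ennreal (norm (\<Sum>j\<in>J. P j (h j) x) powr p) \<partial>lborel) \<le>
    ennreal (4 powr p * (1 / (1 - 2 powr (- (p - 2))) + 1 / (1 - 2 powr (- (6 - p)))) * K * (\<Sum>j\<in>J. w j ^ 2) powr (p / 2))"
proof -
  define W where "W = sqrt (\<Sum>j\<in>J. w j ^ 2)"
  define c where "c = (\<lambda>j. w j / W)"
  define g1 where "g1 = 1 / (1 - 2 powr (- (p - 2)))"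
  define g2 where "g2 = 1 / (1 - 2 powr (- (6 - p)))"
  have sw: "(\<Sum>j\<in>J. w j ^ 2) > 0" using J w by (intro sum_pos zero_less_power) auto
  have W: "W > 0" using sw by (simp add: W_def)
  have c: "c j > 0" for j using w W by (simp add: c_def)
  have wc: "w j = c j * W" for j using W by (simp add: c_def)
  have "W ^ 2 = (\<Sum>j\<in>J. w j ^ 2)" using sw by (simp add: W_def)
  then have c1: "(\<Sum>j\<in>J. c j ^ 2) = 1"
    using W sw by (simp add: c_def power_divide flip: sum_divide_distrib)
  have Wp: "W powr p = (\<Sum>j\<in>J. w j ^ 2) powr (p / 2)"
    using sw by (simp add: W_def powr_powr flip: powr_half_sqrt)
  have g: "g1 > 0" "g2 > 0" using p powr_less_mono[of "- (p - 2)" 0 2] powr_less_mono[of "- (6 - p)" 0 2] by (simp_all add: g1_def g2_def)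
  have [measurable]: "h j \<in> borel_measurable borel" for j using h[of j] by (simp add: test_fun_def)
  define hi where "hi = (\<lambda>(i::int) j x. if x \<in> {x. norm (h j x) > 2 powr i * c j} then h j x else 0)"
  define lo where "lo = (\<lambda>(i::int) j x. if x \<in> {x. norm (h j x) \<le> 2 powr i * c j} then h j x else 0)"
  have thi: "test_fun (hi i j)" for i j unfolding hi_def by (rule test_fun_restrict[OF h]) measurable
  have tlo: "test_fun (lo i j)" for i j unfolding lo_def by (rule test_fun_restrict[OF h]) measurable
  define F where "F = (\<lambda>x. \<Sum>j\<in>J. P j (h j) x)"
  define HI where "HI = (\<lambda>i x. \<Sum>j\<in>J. P j (hi i j) x)"
  define LO where "LO = (\<lambda>i x. \<Sum>j\<in>J. P j (lo i j) x)"
  have FHL: "F x = HI i x + LO i x" for i x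
  proof -
    have "h j = (\<lambda>x. hi i j x + lo i j x)" for j by (auto simp: hi_def lo_def)
    then have "P j (h j) x = P j (hi i j) x + P j (lo i j) x" for j
      using add[OF thi tlo, of j i j i j] by metis
    then show ?thesis by (simp add: F_def HI_def LO_def sum.distrib)
  qed
  have Fm [measurable]: "F \<in> borel_measurable borel" unfolding F_def by (intro borel_measurable_sum meas h)
  have iHI: "integrable lborel (\<lambda>x. norm (HI i x) ^ 2) \<and> (LINT x|lborel. norm (HI i x) ^ 2) \<le> K * (\<Sum>j\<in>J. LINT x|lborel. norm (hi i j x) ^ 2)" for i
    unfolding HI_def by (rule L2[OF thi])
  define S where "S = (\<lambda>i j. (LINT x|lborel. norm (lo i j x) ^ 6) powr (1 / 3))"
  have S0: "S i j \<ge> 0" for i j by (simp add: S_def)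
  have S3: "S i j ^ 3 = (LINT x|lborel. norm (lo i j x) ^ 6)" for i j
  proof (cases "(LINT x|lborel. norm (lo i j x) ^ 6) = 0")
    case False
    then have "(LINT x|lborel. norm (lo i j x) ^ 6) > 0" by (simp add: order.not_eq_order_implies_strict)
    then show ?thesis by (simp add: S_def powr_powr flip: powr_numeral)
  qed (simp add: S_def)
  have iLO: "integrable lborel (\<lambda>x. norm (LO i x) ^ 6) \<and> (LINT x|lborel. norm (LO i x) ^ 6) \<le> K * (\<Sum>j\<in>J. S i j) ^ 3" for i
    unfolding LO_def by (rule L6[OF tlo S0]) (simp add: S3)
  define G where "G = (\<lambda>I x. \<Sum>i\<in>I. 2 powr (i * (p - 2)) * norm (HI i x) ^ 2 + 2 powr (- real_of_int i * (6 - p)) * norm (LO i x) ^ 6)"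
  have G0: "G I x \<ge> 0" for I x by (auto simp: G_def intro!: sum_nonneg add_nonneg_nonneg)
  have Gi: "integrable lborel (G I)" if "finite I" for I
    unfolding G_def using iHI iLO by (intro Bochner_Integration.integrable_sum Bochner_Integration.integrable_add integrable_mult_right) auto
  have pw: "norm (F x) powr p \<le> 4 powr p * G {- int n - 1..int n} x" if x: "2 powr (- real n) \<le> norm (F x)" "norm (F x) \<le> 2 powr n" for x n
  proof -
    define t where "t = norm (F x)"
    have t: "t > 0" using x(1) unfolding t_def by (rule order.strict_trans2[rotated]) simp
    define k where "k = \<lfloor>log 2 t\<rfloor> - 1"
    have kl: "real_of_int k + 1 \<le> log 2 t" "log 2 t < real_of_int k + 2" using floor_correct[of "log 2 t"] unfolding k_def of_int_diff of_int_add of_int_1 by linarith+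
    have lo2: "2 powr (k + 1) \<le> t" using kl(1) t by (simp add: le_log_iff)
    have hi2: "t < 2 powr (k + 2)" using kl(2) t by (simp add: log_less_iff)
    have ln: "- real n \<le> log 2 t" "log 2 t \<le> real n" using x t unfolding t_def[symmetric] by (simp_all add: le_log_iff log_le_iff)
    have kI: "k \<in> {- int n - 1..int n}"
    proof -
      have "- real n - 2 < real_of_int k" "real_of_int k \<le> real n" using kl ln by linarith+
      then show ?thesis by auto
    qed
    have e4: "2 powr (k + 2) = 4 * 2 powr k" "2 powr (k + 1) = 2 * 2 powr (real_of_int k)" by (simp_all add: powr_add)
    have "t powr p \<le> (4 * 2 powr k) powr p" using hi2 t p unfolding e4 by (intro powr_mono2) auto
    also have "\<dots> = 4 powr p * 2 powr (k * p)" by (simp add: powr_mult powr_powr)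
    also have "2 powr (k * p) \<le> 2 powr (k * (p - 2)) * norm (HI k x) ^ 2 + 2 powr (- real_of_int k * (6 - p)) * norm (LO k x) ^ 6"
    proof (cases "2 powr k \<le> norm (HI k x)")
      case True
      have "2 powr (k * p) = 2 powr (k * (p - 2)) * (2 powr k) ^ 2"
        by (simp add: algebra_simps powr_powr flip: powr_add powr_numeral)
      also have "\<dots> \<le> 2 powr (k * (p - 2)) * norm (HI k x) ^ 2"
        using True by (intro mult_left_mono power_mono) auto
      finally show ?thesis by (simp add: add_increasing2)
    next
      case False
      have "2 * 2 powr k \<le> norm (HI k x) + norm (LO k x)"
        using lo2 norm_triangle_ineq[of "HI k x" "LO k x"] unfolding t_def FHL[of x k] e4 by linarith
      then have "2 powr k \<le> norm (LO k x)" using False by linarith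
      have "2 powr (k * p) = 2 powr (- real_of_int k * (6 - p)) * (2 powr k) ^ 6"
        by (simp add: algebra_simps powr_powr flip: powr_add powr_numeral)
      also have "\<dots> \<le> 2 powr (- real_of_int k * (6 - p)) * norm (LO k x) ^ 6"
        using \<open>2 powr k \<le> norm (LO k x)\<close> by (intro mult_left_mono power_mono) auto
      finally show ?thesis by (simp add: add_increasing)
    qed
    also have "\<dots> \<le> G {- int n - 1..int n} x"
      unfolding G_def using kI
      by (intro member_le_sum[of k _ "\<lambda>i::int. 2 powr (i * (p - 2)) * norm (HI i x) ^ 2 + 2 powr (- real_of_int i * (6 - p)) * norm (LO i x) ^ 6"])
         (auto intro!: add_nonneg_nonneg)
    finally show ?thesis by (simp add: t_def)
  qed
  have wW: "c j powr (2 - p) * w j powr p = W powr p * c j ^ 2" for j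
  proof -
    have "c j powr (2 - p) * w j powr p = W powr p * (c j powr (2 - p) * c j powr p)"
      using c[of j] W by (simp add: wc powr_mult)
    also have "c j powr (2 - p) * c j powr p = c j ^ 2"
      using c[of j] by (simp flip: powr_add)
    finally show ?thesis .
  qed
  have ip: "integrable lborel (\<lambda>x. norm (h j x) powr p)" for j by (rule test_fun_powr[OF h]) (use p in auto)
  have A: "(\<Sum>i\<in>I. 2 powr (i * (p - 2)) * (LINT x|lborel. norm (HI i x) ^ 2)) \<le> K * g1 * W powr p" if I: "finite I" for I :: "int set"
  proof -
    have pt: "(\<Sum>i\<in>I. 2 powr (i * (p - 2)) * norm (hi i j x) ^ 2) \<le> g1 * (c j powr (2 - p) * norm (h j x) powr p)" for j x
    proof (cases "h j x = 0")
      case False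
      define y where "y = norm (h j x) / c j"
      have y: "y > 0" using False c[of j] by (simp add: y_def)
      have "(\<Sum>i\<in>I. 2 powr (i * (p - 2)) * norm (hi i j x) ^ 2) \<le> (\<Sum>i\<in>I. (if 2 powr i \<le> y then 2 powr (i * (p - 2)) else 0) * norm (h j x) ^ 2)"
        using c[of j] by (intro sum_mono) (auto simp: hi_def y_def field_simps)
      also have "\<dots> = (\<Sum>i\<in>I. if 2 powr i \<le> y then 2 powr (i * (p - 2)) else 0) * norm (h j x) ^ 2"
        by (simp add: sum_distrib_right)
      also have "\<dots> \<le> y powr (p - 2) / (1 - 2 powr (- (p - 2))) * norm (h j x) ^ 2"
        using p y by (intro mult_right_mono geometric_dyadic_sum I) auto
      also have "\<dots> = g1 * (y powr (p - 2) * norm (h j x) powr 2)" by (simp add: g1_def)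
      also have "y powr (p - 2) * norm (h j x) powr 2 = c j powr (2 - p) * (norm (h j x) powr (p - 2) * norm (h j x) powr 2)"
        using c[of j] by (simp add: y_def powr_divide powr_diff)
      also have "norm (h j x) powr (p - 2) * norm (h j x) powr 2 = norm (h j x) powr p" unfolding powr_add[symmetric] by simp
      finally show ?thesis .
    next
      case True
      then have "hi i j x = 0" for i by (simp add: hi_def)
      then show ?thesis using True by simp
    qed
    have ihi: "integrable lborel (\<lambda>x. norm (hi i j x) ^ 2)" for i j by (rule test_fun_power[OF thi]) simp
    have "(\<Sum>i\<in>I. 2 powr (i * (p - 2)) * (LINT x|lborel. norm (HI i x) ^ 2)) \<le>
       (\<Sum>i\<in>I. 2 powr (i * (p - 2)) * (K * (\<Sum>j\<in>J. LINT x|lborel. norm (hi i j x) ^ 2)))"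
      using iHI by (intro sum_mono mult_left_mono) auto
    also have "\<dots> = K * (\<Sum>j\<in>J. LINT x|lborel. (\<Sum>i\<in>I. 2 powr (i * (p - 2)) * norm (hi i j x) ^ 2))"
    proof -
      have "(LINT x|lborel. (\<Sum>i\<in>I. 2 powr (i * (p - 2)) * norm (hi i j x) ^ 2)) = (\<Sum>i\<in>I. 2 powr (i * (p - 2)) * (LINT x|lborel. norm (hi i j x) ^ 2))" for j
        by (subst Bochner_Integration.integral_sum) (auto intro!: integrable_mult_right ihi)
      then show ?thesis by (simp add: sum_distrib_left mult_ac sum.swap[of _ I J])
    qed
    also have "\<dots> \<le> K * (\<Sum>j\<in>J. LINT x|lborel. g1 * (c j powr (2 - p) * norm (h j x) powr p))"
      using g pt K by (intro mult_left_mono sum_mono integral_mono') (auto intro!: integrable_mult_right ip)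
    also have "\<dots> = K * (\<Sum>j\<in>J. g1 * (c j powr (2 - p) * (LINT x|lborel. norm (h j x) powr p)))" by simp
    also have "\<dots> \<le> K * (\<Sum>j\<in>J. g1 * (c j powr (2 - p) * w j powr p))"
      using g K hw by (intro mult_left_mono sum_mono) auto
    also have "\<dots> = K * g1 * W powr p * (\<Sum>j\<in>J. c j ^ 2)" unfolding wW by (simp add: sum_distrib_left mult_ac)
    finally show ?thesis by (simp add: c1)
  qed
  have Bd: "(\<Sum>i\<in>I. 2 powr (- real_of_int i * (6 - p)) * (LINT x|lborel. norm (LO i x) ^ 6)) \<le> K * g2 * W powr p" if I: "finite I" for I :: "int set"
  proof -
    have pt: "(\<Sum>i\<in>I. 2 powr (- real_of_int i * (6 - p)) * norm (lo i j x) ^ 6) \<le> g2 * (c j powr (6 - p) * norm (h j x) powr p)" for j x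
    proof (cases "h j x = 0")
      case False
      define y where "y = c j / norm (h j x)"
      have y: "y > 0" using False c[of j] by (simp add: y_def)
      have "(\<Sum>i\<in>I. 2 powr (- real_of_int i * (6 - p)) * norm (lo i j x) ^ 6) \<le> (\<Sum>i\<in>I. (if 2 powr (- i) \<le> y then 2 powr (- real_of_int i * (6 - p)) else 0) * norm (h j x) ^ 6)"
        using c[of j] False by (intro sum_mono) (auto simp: lo_def y_def field_simps powr_minus)
      also have "\<dots> = (\<Sum>i\<in>uminus ` I. if 2 powr i \<le> y then 2 powr (i * (6 - p)) else 0) * norm (h j x) ^ 6"
        by (simp add: sum_distrib_right sum.reindex cong: if_cong)
      also have "\<dots> \<le> y powr (6 - p) / (1 - 2 powr (- (6 - p))) * norm (h j x) ^ 6"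
        using p y I by (intro mult_right_mono geometric_dyadic_sum) auto
      also have "\<dots> = g2 * (y powr (6 - p) * norm (h j x) powr 6)" by (simp add: g2_def)
      also have "y powr (6 - p) * norm (h j x) powr 6 = c j powr (6 - p) * (norm (h j x) powr 6 / norm (h j x) powr (6 - p))"
        using c[of j] by (simp add: y_def powr_divide)
      also have "norm (h j x) powr 6 / norm (h j x) powr (6 - p) = norm (h j x) powr p" unfolding powr_diff[symmetric] by simp
      finally show ?thesis .
    next
      case True
      then have "lo i j x = 0" for i by (simp add: lo_def)
      then show ?thesis using True by simp
    qed
    have ilo: "integrable lborel (\<lambda>x. norm (lo i j x) ^ 6)" for i j by (rule test_fun_power[OF tlo]) simp
    have "(\<Sum>i\<in>I. 2 powr (- real_of_int i * (6 - p)) * (LINT x|lborel. norm (LO i x) ^ 6)) \<le>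
       (\<Sum>i\<in>I. 2 powr (- real_of_int i * (6 - p)) * (K * (\<Sum>j\<in>J. (LINT x|lborel. norm (lo i j x) ^ 6) / (c j ^ 2) ^ 2)))"
    proof (intro sum_mono mult_left_mono)
      fix i
      have "(LINT x|lborel. norm (LO i x) ^ 6) \<le> K * (\<Sum>j\<in>J. S i j) ^ 3" using iLO by blast
      also have "\<dots> \<le> K * (\<Sum>j\<in>J. S i j ^ 3 / (c j ^ 2) ^ 2)"
        using less_imp_neq[OF c, symmetric] S0 c1 J K by (intro mult_left_mono weighted_cube_sum) auto
      finally show "(LINT x|lborel. norm (LO i x) ^ 6) \<le> K * (\<Sum>j\<in>J. (LINT x|lborel. norm (lo i j x) ^ 6) / (c j ^ 2) ^ 2)"
        unfolding S3 .
    qed auto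
    also have "\<dots> = K * (\<Sum>j\<in>J. (LINT x|lborel. (\<Sum>i\<in>I. 2 powr (- real_of_int i * (6 - p)) * norm (lo i j x) ^ 6)) / (c j ^ 2) ^ 2)"
    proof -
      have "(LINT x|lborel. (\<Sum>i\<in>I. 2 powr (- real_of_int i * (6 - p)) * norm (lo i j x) ^ 6)) = (\<Sum>i\<in>I. 2 powr (- real_of_int i * (6 - p)) * (LINT x|lborel. norm (lo i j x) ^ 6))" for j
        by (subst Bochner_Integration.integral_sum) (auto intro!: integrable_mult_right ilo)
      then show ?thesis by (simp add: sum_distrib_left sum_divide_distrib mult_ac sum.swap[of _ I J])
    qed
    also have "\<dots> \<le> K * (\<Sum>j\<in>J. (LINT x|lborel. g2 * (c j powr (6 - p) * norm (h j x) powr p)) / (c j ^ 2) ^ 2)"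
      using g pt K by (intro mult_left_mono sum_mono divide_right_mono integral_mono') (auto intro!: integrable_mult_right ip)
    also have "\<dots> = K * (\<Sum>j\<in>J. g2 * (c j powr (6 - p) / (c j ^ 2) ^ 2 * (LINT x|lborel. norm (h j x) powr p)))" by simp
    also have "\<dots> \<le> K * (\<Sum>j\<in>J. g2 * (c j powr (6 - p) / (c j ^ 2) ^ 2 * w j powr p))"
      using g K hw by (intro mult_left_mono sum_mono) auto
    also have "\<dots> = K * (\<Sum>j\<in>J. g2 * (c j powr (2 - p) * w j powr p))"
    proof -
      have "c j powr (6 - p) / (c j ^ 2) ^ 2 = c j powr (2 - p)" for j
      proof -
        have "(c j ^ 2) ^ 2 = c j powr 4" using c[of j] by (simp flip: power_mult)
        then show ?thesis by (simp flip: powr_diff)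
      qed
      then show ?thesis by simp
    qed
    also have "\<dots> = K * g2 * W powr p * (\<Sum>j\<in>J. c j ^ 2)" unfolding wW by (simp add: sum_distrib_left mult_ac)
    finally show ?thesis by (simp add: c1)
  qed
  have Gint: "(LINT x|lborel. G I x) \<le> (g1 + g2) * K * W powr p" if "finite I" for I
  proof -
    have "(LINT x|lborel. G I x) = (\<Sum>i\<in>I. 2 powr (i * (p - 2)) * (LINT x|lborel. norm (HI i x) ^ 2)) + (\<Sum>i\<in>I. 2 powr (- real_of_int i * (6 - p)) * (LINT x|lborel. norm (LO i x) ^ 6))"
      unfolding G_def using iHI iLO
      by (subst Bochner_Integration.integral_sum) (auto simp: sum.distrib intro!: Bochner_Integration.integrable_add integrable_mult_right)
    then show ?thesis using A[OF that] Bd[OF that] by (simp add: algebra_simps)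
  qed
  \<comment> \<open>The sum over all heights is infinite in both directions, hence the truncation to \<open>2^(-n) \<le> |F| \<le> 2^n\<close>.\<close>
  define u where "u = (\<lambda>n x. ennreal (indicator {x. 2 powr (- real n) \<le> norm (F x) \<and> norm (F x) \<le> 2 powr n} x * norm (F x) powr p))"
  have "(\<integral>\<^sup>+x. ennreal (norm (F x) powr p) \<partial>lborel) \<le> ennreal (4 powr p * ((g1 + g2) * K * W powr p))"
  proof (rule nn_integral_limit_le[where u = u])
    show "u n \<in> borel_measurable lborel" for n unfolding u_def by measurable
    show "(\<lambda>n. u n x) \<longlonglongrightarrow> ennreal (norm (F x) powr p)" for x
    proof (cases "F x = 0")
      case True
      then show ?thesis by (simp add: u_def)
    next
      case False
      obtain N :: nat where N: "\<bar>log 2 (norm (F x))\<bar> \<le> real N" using real_arch_simple by blast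
      have "u n x = ennreal (norm (F x) powr p)" if "n \<ge> N" for n
      proof -
        have "- real n \<le> log 2 (norm (F x))" "log 2 (norm (F x)) \<le> real n" using N that by linarith+
        then have "2 powr (- real n) \<le> norm (F x)" "norm (F x) \<le> 2 powr n"
          using False by (simp_all add: le_log_iff log_le_iff)
        then show ?thesis by (simp add: u_def)
      qed
      then show ?thesis by (intro tendsto_eventually) (auto simp: eventually_sequentially)
    qed
    show "(\<integral>\<^sup>+x. u n x \<partial>lborel) \<le> ennreal (4 powr p * ((g1 + g2) * K * W powr p))" for n
    proof -
      have "(\<integral>\<^sup>+x. u n x \<partial>lborel) \<le> (\<integral>\<^sup>+x. ennreal (4 powr p * G {- int n - 1..int n} x) \<partial>lborel)"
        using pw[of n] G0 by (intro nn_integral_mono) (auto simp: u_def indicator_def intro!: ennreal_leI)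
      also have "\<dots> = ennreal (LINT x|lborel. 4 powr p * G {- int n - 1..int n} x)"
        by (rule nn_integral_eq_integral) (auto intro!: integrable_mult_right Gi simp: G0)
      also have "\<dots> \<le> ennreal (4 powr p * ((g1 + g2) * K * W powr p))"
        using Gint[of "{- int n - 1..int n}"] by (intro ennreal_leI) auto
      finally show ?thesis .
    qed
  qed simp
  then show ?thesis by (simp add: F_def Wp g1_def g2_def mult_ac)
qed

section \<open>Decoupling for one arc of bounded curvature ratio\<close>

lemma conv_add:
  assumes V: "integrable lborel V" and "test_fun h" "test_fun h'"
  shows "conv V (\<lambda>x. h x + h' x) = (\<lambda>x. conv V h x + conv V h' x)"
proof
  fix x
  have i: "integrable lborel (\<lambda>y. g y * V (x - y))" if "test_fun g" for g
  proof -
    obtain M where "\<And>y. norm (g y) \<le> M" "g \<in> borel_measurable borel" using \<open>test_fun g\<close> unfolding test_fun_def by blast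
    then show ?thesis by (intro conv_integrable[OF V])
  qed
  show "conv V (\<lambda>x. h x + h' x) x = conv V h x + conv V h' x"
    unfolding conv_def distrib_right by (rule Bochner_Integration.integral_add; rule i; fact)
qed

lemma bandlimited_conv:
  assumes "test_fun h" "bandlimited B A V"
  shows "\<exists>A. bandlimited B A (conv V h)"
proof -
  have "h \<in> borel_measurable borel" "integrable lborel h" using assms test_fun_L1 by (auto simp: test_fun_def)
  from bandlimited_convolution[OF this assms(2)] show ?thesis unfolding conv_def[abs_def] by blast
qed

lemma conv_truncation_limit:
  fixes f V :: "'a::euclidean_space \<Rightarrow> complex"
  assumes V: "integrable lborel V" and f: "bandlimited B A f"
  shows "(\<lambda>n. conv V (\<lambda>y. if norm y \<le> real n then f y else 0) x) \<longlonglongrightarrow> conv V f x"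
  unfolding conv_def
proof (rule integral_dominated_convergence[where w = "\<lambda>y. A * norm (V (x - y))"])
  have [measurable]: "V \<in> borel_measurable borel" "f \<in> borel_measurable borel"
    using V bandlimited_measurable[OF f] by (auto dest: borel_measurable_integrable)
  have A: "A \<ge> 0" using bandlimited_bound[OF f, of 0] norm_ge_zero order_trans by blast
  show "(\<lambda>y. f y * V (x - y)) \<in> borel_measurable lborel" by measurable
  show "(\<lambda>y. (if norm y \<le> real n then f y else 0) * V (x - y)) \<in> borel_measurable lborel" for n by measurable
  show "integrable lborel (\<lambda>y. A * norm (V (x - y)))"
    using V lborel_reflect(2)[of V x] by (intro integrable_mult_right integrable_norm) simp
  show "AE y in lborel. (\<lambda>n. (if norm y \<le> real n then f y else 0) * V (x - y)) \<longlonglongrightarrow> f y * V (x - y)"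
  proof (rule AE_I2)
    fix y :: 'a
    obtain N :: nat where N: "norm y \<le> real N" using real_arch_simple by blast
    show "(\<lambda>n. (if norm y \<le> real n then f y else 0) * V (x - y)) \<longlonglongrightarrow> f y * V (x - y)"
      by (rule tendsto_eventually) (use N in \<open>auto simp: eventually_sequentially intro!: exI[of _ N]\<close>)
  qed
  show "AE y in lborel. norm ((if norm y \<le> real n then f y else 0) * V (x - y)) \<le> A * norm (V (x - y))" for n
    using A bandlimited_bound[OF f] by (intro AE_I2) (auto simp: norm_mult intro!: mult_right_mono)
qed

lemma test_fun_truncation:
  assumes "bandlimited B A f"
  shows "test_fun (\<lambda>y. if norm y \<le> R then f y else 0)"
proof -
  have [measurable]: "f \<in> borel_measurable borel" by (rule bandlimited_measurable[OF assms])
  have A: "A \<ge> 0" using bandlimited_bound[OF assms, of 0] norm_ge_zero order_trans by blast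
  show ?thesis unfolding test_fun_def
    using bandlimited_bound[OF assms] A by (intro conjI exI[of _ A] exI[of _ R]) auto
qed

lemma norm_power_of_nn_integral:
  fixes f :: "'a::euclidean_space \<Rightarrow> complex" and n :: nat
  assumes [measurable]: "f \<in> borel_measurable borel" and n: "n \<ge> 1" and v: "v \<ge> 0"
    and le: "(\<integral>\<^sup>+x. ennreal (norm (f x) powr real n) \<partial>lborel) \<le> ennreal (v powr real n)"
  shows "integrable lborel (\<lambda>x. norm (f x) ^ n)" "(LINT x|lborel. norm (f x) ^ n) \<le> v ^ n"
proof -
  have e: "t powr real n = t ^ n" if "t \<ge> 0" for t :: real
    using that n by (cases "t = 0") (auto simp: powr_realpow)
  have le': "(\<integral>\<^sup>+x. ennreal (norm (f x) ^ n) \<partial>lborel) \<le> ennreal (v ^ n)" using le v by (simp add: e)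
  show i: "integrable lborel (\<lambda>x. norm (f x) ^ n)"
    by (rule integrableI_bounded) (use le' in \<open>auto simp: norm_power intro: order.strict_trans1\<close>)
  show "(LINT x|lborel. norm (f x) ^ n) \<le> v ^ n"
    using le' v by (subst (asm) nn_integral_eq_integral[OF i]) auto
qed

lemma Lp_decoupling_2:
  assumes geo: "tangent_separated U B m u \<kappa>" and q: "block q l \<subseteq> U"
    and f: "\<And>j. j \<in> U \<Longrightarrow> \<exists>A. bandlimited (B j) A (f j)" and v: "\<And>j. 0 \<le> v j"
    and fv: "\<And>j. j \<in> block q l \<Longrightarrow> (\<integral>\<^sup>+x. ennreal (norm (f j x) powr 2) \<partial>lborel) \<le> ennreal (v j powr 2)"
  shows "(\<integral>\<^sup>+x. ennreal (norm (\<Sum>j\<in>block q l. f j x) powr 2) \<partial>lborel) \<le> ennreal (2 * real \<kappa> * (\<Sum>j\<in>block q l. v j ^ 2))"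
proof -
  interpret tangent_separated U B m u \<kappa> by (rule geo)
  have fm: "f j \<in> borel_measurable borel" if "j \<in> block q l" for j using f[of j] that q bandlimited_measurable by blast
  have fi: "integrable lborel (\<lambda>x. norm (f j x) ^ 2)" "(LINT x|lborel. norm (f j x) ^ 2) \<le> v j ^ 2" if "j \<in> block q l" for j
    using norm_power_of_nn_integral[OF fm[OF that], of 2 "v j"] fv[OF that] v by auto
  have sm: "(\<lambda>x. \<Sum>j\<in>block q l. f j x) \<in> borel_measurable borel" using fm by (intro borel_measurable_sum) auto
  have "integrable lborel (\<lambda>x. real (card (block q l)) ^ 2 * (\<Sum>j\<in>block q l. norm (f j x) ^ 2))"
    using fi by (intro integrable_mult_right Bochner_Integration.integrable_sum) auto
  then have i: "integrable lborel (\<lambda>x. norm (\<Sum>j\<in>block q l. f j x) ^ 2)"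
    by (rule Bochner_Integration.integrable_bound)
       (use sm in \<open>auto intro!: AE_I2 order_trans[OF norm_sum_power_le] sum_nonneg\<close>)
  have "(LINT x|lborel. norm (\<Sum>j\<in>block q l. f j x) ^ 2) \<le> 2 * real \<kappa> * (\<Sum>j\<in>block q l. LINT x|lborel. norm (f j x) ^ 2)"
    using f q fm fi by (intro L2_orthogonality[OF q]) (auto simp: square_int_def)
  also have "\<dots> \<le> 2 * real \<kappa> * (\<Sum>j\<in>block q l. v j ^ 2)" using fi by (intro mult_left_mono sum_mono) auto
  finally have "ennreal (LINT x|lborel. norm (\<Sum>j\<in>block q l. f j x) ^ 2) \<le> ennreal (2 * real \<kappa> * (\<Sum>j\<in>block q l. v j ^ 2))"
    by (rule ennreal_leI)
  then show ?thesis using nn_integral_eq_integral[OF i] by simp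
qed

lemma Lp_decoupling_6:
  assumes "\<eta> > 0"
  shows "\<exists>C\<ge>1. \<forall>U B m u f v q l. tangent_separated U B m u \<kappa> \<longrightarrow> block q l \<subseteq> U \<longrightarrow>
    (\<forall>j\<in>U. \<exists>A. bandlimited (B j) A (f j)) \<longrightarrow> (\<forall>j. 0 \<le> v j) \<longrightarrow>
    (\<forall>j\<in>block q l. (\<integral>\<^sup>+x. ennreal (norm (f j x) powr 6) \<partial>lborel) \<le> ennreal (v j powr 6)) \<longrightarrow>
    integrable lborel (\<lambda>x. norm (\<Sum>j\<in>block q l. f j x) ^ 6) \<and>
    (LINT x|lborel. norm (\<Sum>j\<in>block q l. f j x) ^ 6) \<le> C * 2 powr (\<eta> * l) * (\<Sum>j\<in>block q l. v j ^ 2) ^ 3"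
proof -
  obtain C where C: "C \<ge> 1" "\<And>U B m u f S q l. L6_family U B m u \<kappa> f S \<Longrightarrow> block q l \<subseteq> U \<Longrightarrow>
    (LINT x|lborel. norm (\<Sum>j\<in>block q l. f j x) ^ 6) \<le> C * 2 powr (\<eta> * l) * (\<Sum>j\<in>block q l. S j) ^ 3"
    using L6_decoupling[OF assms, of \<kappa>] by blast
  show ?thesis
  proof (intro exI[of _ C] conjI allI impI)
    fix U B m u f v q l
    assume geo: "tangent_separated U B m u \<kappa>" and q: "block q l \<subseteq> U"
      and f: "\<forall>j\<in>U. \<exists>A. bandlimited (B j) A (f j)" and v: "\<forall>j. (0::real) \<le> v j"
      and fv: "\<forall>j\<in>block q l. (\<integral>\<^sup>+x. ennreal (norm (f j x) powr 6) \<partial>lborel) \<le> ennreal (v j powr 6)"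
    interpret tangent_separated U B m u \<kappa> by (rule geo)
    have fm: "f j \<in> borel_measurable borel" if "j \<in> block q l" for j using f that q bandlimited_measurable by blast
    have fi: "L6 (f j)" "(LINT x|lborel. norm (f j x) ^ 6) \<le> (v j ^ 2) ^ 3" if "j \<in> block q l" for j
      using norm_power_of_nn_integral[OF fm[OF that], of 6 "v j"] fv that v fm[OF that] by (auto simp: L6_def simp flip: power_mult)
    have fam: "L6_family (block q l) B m u \<kappa> f (\<lambda>j. v j ^ 2)"
    proof
      fix q' j j' \<xi> \<xi>' L
      assume "q' \<in> block q l" "j \<in> block q l" "j' \<in> block q l"
      then have U: "q' \<in> U" "j \<in> U" "j' \<in> U" using q by auto
      show "\<bar>tilt (m q') \<xi> - tilt (m q') \<xi>'\<bar> \<le> real \<kappa> * u * real L ^ 2"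
        if "q' \<le> j" "j < q' + L" "q' \<le> j'" "j' < q' + L" "\<xi> \<in> B j" "\<xi>' \<in> B j'"
        using tangent[OF U that] .
      show "u * (real (j - q') + 1) * real (j' - j) \<le> \<bar>tilt (m q') \<xi> - tilt (m q') \<xi>'\<bar>"
        if "q' \<le> j" "j + \<kappa> \<le> j'" "\<xi> \<in> B j" "\<xi>' \<in> B j'"
        using right[OF U that] .
      show "u * (real (q' - j') + 1) * real (j' - j) \<le> \<bar>tilt (m q') \<xi> - tilt (m q') \<xi>'\<bar>"
        if "j' \<le> q'" "j + \<kappa> \<le> j'" "\<xi> \<in> B j" "\<xi>' \<in> B j'"
        using left[OF U that] .
    next
      fix j assume "j \<in> block q l"
      then show "\<exists>A. bandlimited (B j) A (f j)" "L6 (f j)" "(LINT x|lborel. norm (f j x) ^ 6) \<le> (v j ^ 2) ^ 3"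
        using f q fi by auto
    qed (use unit_pos kappa_pos in auto)
    show "integrable lborel (\<lambda>x. norm (\<Sum>j\<in>block q l. f j x) ^ 6)"
      using L6_sum[of "block q l" f] fi by (auto simp: L6_def)
    show "(LINT x|lborel. norm (\<Sum>j\<in>block q l. f j x) ^ 6) \<le> C * 2 powr (\<eta> * l) * (\<Sum>j\<in>block q l. v j ^ 2) ^ 3"
      using C(2)[OF fam] by simp
  qed (use C in auto)
qed

text \<open>The frequency sets of the geometric hypothesis have twice the size of those that contain the pieces: the kernels that
reproduce the pieces are band-limited only to the larger sets.\<close>

theorem Lp_decoupling:
  fixes \<eta> p :: real and \<kappa> :: nat
  assumes eta: "\<eta> > 0" and p: "2 \<le> p" "p \<le> 6"
  shows "\<exists>C\<ge>0. \<forall>U \<gamma> m s w u f v q l. s > 0 \<longrightarrow> w > 0 \<longrightarrow>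
    tangent_separated U (\<lambda>j. parallelogram (\<gamma> j) (m j) (2 * s) (2 * w)) m u \<kappa> \<longrightarrow> block q l \<subseteq> U \<longrightarrow>
    (\<forall>j\<in>U. \<exists>A. bandlimited (parallelogram (\<gamma> j) (m j) s w) A (f j)) \<longrightarrow> (\<forall>j. 0 \<le> v j) \<longrightarrow>
    (\<forall>j\<in>block q l. (\<integral>\<^sup>+x. ennreal (norm (f j x) powr p) \<partial>lborel) \<le> ennreal (v j powr p)) \<longrightarrow>
    (\<integral>\<^sup>+x. ennreal (norm (\<Sum>j\<in>block q l. f j x) powr p) \<partial>lborel) \<le> ennreal (C * 2 powr (\<eta> * l) * (\<Sum>j\<in>block q l. v j ^ 2) powr (p / 2))"
proof -
  obtain C6 where C6: "C6 \<ge> 1" "\<And>U B m u f v q l. tangent_separated U B m u \<kappa> \<Longrightarrow> block q l \<subseteq> U \<Longrightarrow>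
    (\<forall>j\<in>U. \<exists>A. bandlimited (B j) A (f j)) \<Longrightarrow> (\<forall>j. 0 \<le> v j) \<Longrightarrow>
    (\<forall>j\<in>block q l. (\<integral>\<^sup>+x. ennreal (norm (f j x) powr 6) \<partial>lborel) \<le> ennreal (v j powr 6)) \<Longrightarrow>
    integrable lborel (\<lambda>x. norm (\<Sum>j\<in>block q l. f j x) ^ 6) \<and>
    (LINT x|lborel. norm (\<Sum>j\<in>block q l. f j x) ^ 6) \<le> C6 * 2 powr (\<eta> * l) * (\<Sum>j\<in>block q l. v j ^ 2) ^ 3"
    using Lp_decoupling_6[OF eta, of \<kappa>] by blast
  define N where "N = vp_norm\<^sup>2"
  have N: "N \<ge> 1" using vp_norm_ge_1 by (simp add: N_def one_le_power)
  define g where "g = 4 powr p * (1 / (1 - 2 powr (- (p - 2))) + 1 / (1 - 2 powr (- (6 - p))))"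
  define C where "C = 2 * real \<kappa> + C6 + \<bar>g\<bar> * (2 * real \<kappa> * N ^ 2 + C6 * N ^ 6)"
  have big: "2 * real \<kappa> \<le> C" "C6 \<le> C" "g * (2 * real \<kappa> * N ^ 2 + C6 * N ^ 6) \<le> C" "0 \<le> C"
  proof -
    have a: "0 \<le> 2 * real \<kappa> * N ^ 2 + C6 * N ^ 6" using N C6(1) by simp
    then have "0 \<le> \<bar>g\<bar> * (2 * real \<kappa> * N ^ 2 + C6 * N ^ 6)" by simp
    moreover have "g * (2 * real \<kappa> * N ^ 2 + C6 * N ^ 6) \<le> \<bar>g\<bar> * (2 * real \<kappa> * N ^ 2 + C6 * N ^ 6)"
      using a by (intro mult_right_mono) auto
    ultimately show "2 * real \<kappa> \<le> C" "C6 \<le> C" "g * (2 * real \<kappa> * N ^ 2 + C6 * N ^ 6) \<le> C" "0 \<le> C"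
      using C6(1) unfolding C_def by linarith+
  qed
  show ?thesis
  proof (intro exI[of _ C] conjI allI impI big(4))
    fix U \<gamma> m s w u f q l and v :: "nat \<Rightarrow> real"
    assume s: "s > 0" and w: "w > 0"
      and geo: "tangent_separated U (\<lambda>j. parallelogram (\<gamma> j) (m j) (2 * s) (2 * w)) m u \<kappa>" and q: "block q l \<subseteq> U"
      and f: "\<forall>j\<in>U. \<exists>A. bandlimited (parallelogram (\<gamma> j) (m j) s w) A (f j)" and v: "\<forall>j. 0 \<le> v j"
      and fv: "\<forall>j\<in>block q l. (\<integral>\<^sup>+x. ennreal (norm (f j x) powr p) \<partial>lborel) \<le> ennreal (v j powr p)"
    let ?B = "\<lambda>j. parallelogram (\<gamma> j) (m j) (2 * s) (2 * w)"
    let ?J = "block q l"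
    have f': "\<forall>j\<in>U. \<exists>A. bandlimited (?B j) A (f j)"
    proof
      fix j assume "j \<in> U"
      then obtain A where "bandlimited (parallelogram (\<gamma> j) (m j) s w) A (f j)" using f by blast
      then have "bandlimited (?B j) A (f j)" by (rule bandlimited_mono) (use s w in \<open>auto simp: parallelogram_def\<close>)
      then show "\<exists>A. bandlimited (?B j) A (f j)" by blast
    qed
    have one: "1 \<le> 2 powr (\<eta> * l)" using eta by (intro ge_one_powr_ge_zero) auto
    have sv: "(\<Sum>j\<in>?J. v j ^ 2) \<ge> 0" by (intro sum_nonneg) auto
    consider "p = 2" | "p = 6" | "2 < p" "p < 6" using p by linarith
    then show "(\<integral>\<^sup>+x. ennreal (norm (\<Sum>j\<in>?J. f j x) powr p) \<partial>lborel) \<le> ennreal (C * 2 powr (\<eta> * l) * (\<Sum>j\<in>?J. v j ^ 2) powr (p / 2))"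
    proof cases
      case 1
      have "(\<integral>\<^sup>+x. ennreal (norm (\<Sum>j\<in>?J. f j x) powr 2) \<partial>lborel) \<le> ennreal (2 * real \<kappa> * (\<Sum>j\<in>?J. v j ^ 2))"
        by (rule Lp_decoupling_2[OF geo q]) (use f' v fv 1 in auto)
      also have "\<dots> \<le> ennreal (C * 2 powr (\<eta> * l) * (\<Sum>j\<in>?J. v j ^ 2))"
      proof (intro ennreal_leI mult_right_mono sv)
        have "2 * real \<kappa> * 1 \<le> C * 2 powr (\<eta> * l)" using big one by (intro mult_mono) auto
        then show "2 * real \<kappa> \<le> C * 2 powr (\<eta> * l)" by simp
      qed
      finally show ?thesis using 1 sv by simp
    next
      case 2
      have *: "integrable lborel (\<lambda>x. norm (\<Sum>j\<in>?J. f j x) ^ 6) \<and>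
        (LINT x|lborel. norm (\<Sum>j\<in>?J. f j x) ^ 6) \<le> C6 * 2 powr (\<eta> * l) * (\<Sum>j\<in>?J. v j ^ 2) ^ 3"
        by (rule C6(2)[OF geo q f']) (use v fv 2 in auto)
      have "(\<integral>\<^sup>+x. ennreal (norm (\<Sum>j\<in>?J. f j x) powr 6) \<partial>lborel) = ennreal (LINT x|lborel. norm (\<Sum>j\<in>?J. f j x) ^ 6)"
        using nn_integral_eq_integral[OF conjunct1[OF *]] by simp
      also have "\<dots> \<le> ennreal (C6 * 2 powr (\<eta> * l) * (\<Sum>j\<in>?J. v j ^ 2) ^ 3)" using * by (intro ennreal_leI) auto
      also have "\<dots> \<le> ennreal (C * 2 powr (\<eta> * l) * (\<Sum>j\<in>?J. v j ^ 2) ^ 3)"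
        using big sv by (intro ennreal_leI mult_right_mono) auto
      finally show ?thesis using 2 sv by simp
    next
      case 3
      define V where "V = (\<lambda>j. pkernel (\<gamma> j) (m j) s w)"
      have V: "integrable lborel (V j)" "(LINT y|lborel. norm (V j y)) = N" for j
        using integrable_pkernel[OF s w] by (simp_all add: V_def N_def)
      have bV: "\<exists>A. bandlimited (?B j) A (conv (V j) h)" if "test_fun h" for j h
        using bandlimited_pkernel[OF s w, of "\<gamma> j" "m j"] bandlimited_conv[OF that] unfolding V_def by blast
      have mV: "conv (V j) h \<in> borel_measurable borel" if "test_fun h" for j h
        using bV[OF that] bandlimited_measurable by blast
      define K where "K = (2 * real \<kappa> * N ^ 2 + C6 * N ^ 6) * 2 powr (\<eta> * l)"
      have K0: "K \<ge> 0" using C6(1) N by (simp add: K_def)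
      have Jne: "?J \<noteq> {}" by (auto simp: block_def)
      have nn_eq: "(\<integral>\<^sup>+x. ennreal (norm (conv (V j) h x) powr real n) \<partial>lborel) \<le> ennreal (N ^ n * (LINT x|lborel. norm (h x) ^ n))"
        if "test_fun h" "n \<ge> 1" for j h and n :: nat
      proof -
        note cb = conv_power_bound[OF V that(1) that(2) mV[OF that(1)]]
        have "t powr real n = t ^ n" if "t \<ge> 0" for t :: real using that \<open>n \<ge> 1\<close> by (cases "t = 0") (auto simp: powr_realpow)
        then have "(\<integral>\<^sup>+x. ennreal (norm (conv (V j) h x) powr real n) \<partial>lborel) = ennreal (LINT x|lborel. norm (conv (V j) h x) ^ n)"
          using nn_integral_eq_integral[OF cb(1)] by simp
        also have "\<dots> \<le> ennreal (N ^ n * (LINT x|lborel. norm (h x) ^ n))" by (intro ennreal_leI cb)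
        finally show ?thesis .
      qed
      have L2: "integrable lborel (\<lambda>x. norm (\<Sum>j\<in>?J. conv (V j) (h j) x) ^ 2) \<and>
        (LINT x|lborel. norm (\<Sum>j\<in>?J. conv (V j) (h j) x) ^ 2) \<le> K * (\<Sum>j\<in>?J. LINT x|lborel. norm (h j x) ^ 2)"
        if h: "\<And>j. test_fun (h j)" for h
      proof -
        define v2 where "v2 = (\<lambda>j. sqrt (N ^ 2 * (LINT x|lborel. norm (h j x) ^ 2)))"
        have v2: "v2 j powr 2 = N ^ 2 * (LINT x|lborel. norm (h j x) ^ 2)" "v2 j ^ 2 = N ^ 2 * (LINT x|lborel. norm (h j x) ^ 2)" "0 \<le> v2 j" for j
          by (auto simp: v2_def)
        have "(\<integral>\<^sup>+x. ennreal (norm (\<Sum>j\<in>?J. conv (V j) (h j) x) powr 2) \<partial>lborel) \<le> ennreal (2 * real \<kappa> * (\<Sum>j\<in>?J. v2 j ^ 2))"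
          by (rule Lp_decoupling_2[OF geo q]) (use bV h v2(3) nn_eq[OF h, of 2] in \<open>auto simp: v2(1)\<close>)
        also have "2 * real \<kappa> * (\<Sum>j\<in>?J. v2 j ^ 2) = sqrt (2 * real \<kappa> * (\<Sum>j\<in>?J. v2 j ^ 2)) powr real 2"
          by (simp add: sum_nonneg)
        finally have le: "(\<integral>\<^sup>+x. ennreal (norm (\<Sum>j\<in>?J. conv (V j) (h j) x) powr real 2) \<partial>lborel) \<le>
            ennreal (sqrt (2 * real \<kappa> * (\<Sum>j\<in>?J. v2 j ^ 2)) powr real 2)" by simp
        have sm: "(\<lambda>x. \<Sum>j\<in>?J. conv (V j) (h j) x) \<in> borel_measurable borel" using mV h by (intro borel_measurable_sum) auto
        note r = norm_power_of_nn_integral[OF sm _ _ le]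
        have "(LINT x|lborel. norm (\<Sum>j\<in>?J. conv (V j) (h j) x) ^ 2) \<le> 2 * real \<kappa> * (\<Sum>j\<in>?J. v2 j ^ 2)"
          using r(2) by (simp add: sum_nonneg)
        also have "\<dots> = (2 * real \<kappa> * N ^ 2) * 1 * (\<Sum>j\<in>?J. LINT x|lborel. norm (h j x) ^ 2)"
          by (simp add: v2(2) sum_distrib_left mult_ac)
        also have "\<dots> \<le> K * (\<Sum>j\<in>?J. LINT x|lborel. norm (h j x) ^ 2)"
          unfolding K_def using one C6(1) N by (intro mult_right_mono mult_mono sum_nonneg) auto
        finally show ?thesis using r(1) by (simp add: sum_nonneg)
      qed
      have L6: "integrable lborel (\<lambda>x. norm (\<Sum>j\<in>?J. conv (V j) (h j) x) ^ 6) \<and>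
        (LINT x|lborel. norm (\<Sum>j\<in>?J. conv (V j) (h j) x) ^ 6) \<le> K * (\<Sum>j\<in>?J. S j) ^ 3"
        if h: "\<And>j. test_fun (h j)" and S: "\<And>j. (0::real) \<le> S j" and hS: "\<And>j. j \<in> ?J \<Longrightarrow> (LINT x|lborel. norm (h j x) ^ 6) \<le> S j ^ 3" for h S
      proof -
        define v6 where "v6 = (\<lambda>j. N * sqrt (S j))"
        have v6: "0 \<le> v6 j" "v6 j ^ 2 = N ^ 2 * S j" "v6 j powr 6 = N ^ 6 * S j ^ 3" for j
        proof -
          show "0 \<le> v6 j" using N S by (simp add: v6_def)
          show e: "v6 j ^ 2 = N ^ 2 * S j" using S by (simp add: v6_def power_mult_distrib)
          have "v6 j ^ 6 = (v6 j ^ 2) ^ 3" by (simp flip: power_mult)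
          also have "\<dots> = N ^ 6 * S j ^ 3" unfolding e by (simp add: power_mult_distrib flip: power_mult)
          finally show "v6 j powr 6 = N ^ 6 * S j ^ 3" using \<open>0 \<le> v6 j\<close> by simp
        qed
        have fv6: "(\<integral>\<^sup>+x. ennreal (norm (conv (V j) (h j) x) powr 6) \<partial>lborel) \<le> ennreal (v6 j powr 6)" if "j \<in> ?J" for j
        proof -
          have "(\<integral>\<^sup>+x. ennreal (norm (conv (V j) (h j) x) powr 6) \<partial>lborel) \<le> ennreal (N ^ 6 * (LINT x|lborel. norm (h j x) ^ 6))"
            using nn_eq[OF h, of 6 j j] by simp
          also have "\<dots> \<le> ennreal (v6 j powr 6)"
            unfolding v6(3) using N hS[OF that] by (intro ennreal_leI mult_left_mono) auto
          finally show ?thesis .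
        qed
        have *: "integrable lborel (\<lambda>x. norm (\<Sum>j\<in>?J. conv (V j) (h j) x) ^ 6) \<and>
           (LINT x|lborel. norm (\<Sum>j\<in>?J. conv (V j) (h j) x) ^ 6) \<le> C6 * 2 powr (\<eta> * l) * (\<Sum>j\<in>?J. v6 j ^ 2) ^ 3"
          by (rule C6(2)[OF geo q]) (use bV h v6(1) fv6 in auto)
        have "(\<Sum>j\<in>?J. v6 j ^ 2) ^ 3 = N ^ 6 * (\<Sum>j\<in>?J. S j) ^ 3"
          unfolding v6(2) sum_distrib_left[symmetric] power_mult_distrib by (simp flip: power_mult)
        then have "C6 * 2 powr (\<eta> * l) * (\<Sum>j\<in>?J. v6 j ^ 2) ^ 3 = (C6 * N ^ 6 * 2 powr (\<eta> * l)) * (\<Sum>j\<in>?J. S j) ^ 3" by simp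
        also have "\<dots> \<le> K * (\<Sum>j\<in>?J. S j) ^ 3"
          unfolding K_def using N S by (intro mult_right_mono zero_le_power sum_nonneg) auto
        finally show ?thesis using * by linarith
      qed
      \<comment> \<open>The interpolation lemma needs positive norms and compactly supported functions: enlarge \<open>v j\<close> by \<open>e n\<close>, truncate \<open>f j\<close> to balls, and pass to the limit.\<close>
      define e where "e = (\<lambda>n::nat. 1 / real (Suc n))"
      define hn where "hn = (\<lambda>(n::nat) j. if j \<in> ?J then (\<lambda>y. if norm y \<le> real n then f j y else 0) else (\<lambda>y. 0))"
      have bf: "\<exists>A. bandlimited (parallelogram (\<gamma> j) (m j) s w) A (f j)" if "j \<in> ?J" for j using f q that by blast
      have thn: "test_fun (hn n j)" for n j
      proof (cases "j \<in> ?J")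
        case True
        then obtain A where "bandlimited (parallelogram (\<gamma> j) (m j) s w) A (f j)" using bf by blast
        from test_fun_truncation[OF this, of "real n"] show ?thesis using True by (simp add: hn_def)
      qed (auto simp: hn_def test_fun_def intro: exI[of _ "0::real"])
      have reprod: "conv (V j) (f j) = f j" if j: "j \<in> ?J" for j
      proof -
        obtain A where "bandlimited (parallelogram (\<gamma> j) (m j) s w) A (f j)" using bf[OF j] by blast
        then show ?thesis
          by (rule conv_reproducing[OF _ V(1)]) (auto simp: V_def pkernel_fourier[OF s w])
      qed
      have lim: "(\<lambda>n. conv (V j) (hn n j) x) \<longlonglongrightarrow> f j x" if j: "j \<in> ?J" for j x
      proof -
        obtain A where A: "bandlimited (parallelogram (\<gamma> j) (m j) s w) A (f j)" using bf[OF j] by blast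
        have "(\<lambda>n. conv (V j) (\<lambda>y. if norm y \<le> real n then f j y else 0) x) \<longlonglongrightarrow> conv (V j) (f j) x"
          by (rule conv_truncation_limit[OF V(1) A])
        then show ?thesis using j by (simp add: hn_def reprod[OF j])
      qed
      have fle: "(LINT x|lborel. norm (hn n j x) powr p) \<le> (v j + e n) powr p" if j: "j \<in> ?J" for n j
      proof -
        have i: "integrable lborel (\<lambda>x. norm (hn n j x) powr p)" by (rule test_fun_powr[OF thn]) (use p in auto)
        have "ennreal (LINT x|lborel. norm (hn n j x) powr p) = (\<integral>\<^sup>+x. ennreal (norm (hn n j x) powr p) \<partial>lborel)"
          by (rule nn_integral_eq_integral[symmetric, OF i]) auto
        also have "\<dots> \<le> (\<integral>\<^sup>+x. ennreal (norm (f j x) powr p) \<partial>lborel)"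
          by (intro nn_integral_mono) (use j in \<open>auto simp: hn_def\<close>)
        also have "\<dots> \<le> ennreal (v j powr p)" using fv j by blast
        finally have "(LINT x|lborel. norm (hn n j x) powr p) \<le> v j powr p" by (simp add: ennreal_le_iff)
        also have "\<dots> \<le> (v j + e n) powr p" using v p by (intro powr_mono2) (auto simp: e_def)
        finally show ?thesis .
      qed
      have "(\<integral>\<^sup>+x. ennreal (norm (\<Sum>j\<in>?J. f j x) powr p) \<partial>lborel) \<le> ennreal (g * K * (\<Sum>j\<in>?J. v j ^ 2) powr (p / 2))"
      proof (rule nn_integral_limit_le)
        show "(\<lambda>x. ennreal (norm (\<Sum>j\<in>?J. conv (V j) (hn n j) x) powr p)) \<in> borel_measurable lborel" for n
        proof -
          have [measurable]: "(\<lambda>x. \<Sum>j\<in>?J. conv (V j) (hn n j) x) \<in> borel_measurable borel"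
            by (intro borel_measurable_sum mV thn)
          show ?thesis by measurable
        qed
        show "(\<lambda>n. ennreal (norm (\<Sum>j\<in>?J. conv (V j) (hn n j) x) powr p)) \<longlonglongrightarrow> ennreal (norm (\<Sum>j\<in>?J. f j x) powr p)" for x
          using 3 by (intro tendsto_ennrealI tendsto_powr' tendsto_norm tendsto_sum lim tendsto_const) auto
        show "(\<integral>\<^sup>+x. ennreal (norm (\<Sum>j\<in>?J. conv (V j) (hn n j) x) powr p) \<partial>lborel) \<le>
           ennreal (g * K * (\<Sum>j\<in>?J. (v j + e n) ^ 2) powr (p / 2))" for n
          unfolding g_def
          by (rule real_interpolation[OF _ Jne 3 K0 conv_add[OF V(1)] mV L2 L6 thn _ fle])
             (use v in \<open>auto simp: e_def intro!: add_nonneg_pos\<close>)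
        have "e \<longlonglongrightarrow> 0" unfolding e_def by (rule LIMSEQ_Suc[OF lim_const_over_n])
        then have "(\<lambda>n. g * K * (\<Sum>j\<in>?J. (v j + e n) ^ 2) powr (p / 2)) \<longlonglongrightarrow> g * K * (\<Sum>j\<in>?J. (v j + 0) ^ 2) powr (p / 2)"
          using p by (intro tendsto_intros tendsto_powr' tendsto_sum) (auto intro!: sum_nonneg always_eventually)
        then show "(\<lambda>n. ennreal (g * K * (\<Sum>j\<in>?J. (v j + e n) ^ 2) powr (p / 2))) \<longlonglongrightarrow> ennreal (g * K * (\<Sum>j\<in>?J. v j ^ 2) powr (p / 2))"
          by (intro tendsto_ennrealI) simp
      qed
      also have "\<dots> \<le> ennreal (C * 2 powr (\<eta> * l) * (\<Sum>j\<in>?J. v j ^ 2) powr (p / 2))"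
      proof (intro ennreal_leI mult_right_mono)
        show "g * K \<le> C * 2 powr (\<eta> * l)"
          unfolding K_def mult.assoc[symmetric] using big(3) by (intro mult_right_mono) auto
      qed simp
      finally show ?thesis .
    qed
  qed
qed

section \<open>Arcs of the power curve\<close>

lemma separation_arithmetic:
  fixes e d k :: real
  assumes "e \<ge> 0" "k \<ge> 1" "d \<ge> 16 * k"
  shows "(e + 1) * d / 2 + 2 * k * (2 + 2 * e + d) \<le> e * d + d\<^sup>2 / 4"
proof -
  have "e * (16 * k) \<le> e * d" using assms by (intro mult_left_mono) auto
  then have 1: "16 * (k * e) \<le> e * d" by (simp add: mult_ac)
  have "d * (16 * k) \<le> d * d" using assms by (intro mult_left_mono) auto
  then have 2: "16 * (k * d) \<le> d * d" by (simp only: mult_ac)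
  have "1 * (d - 2) \<le> k * (d - 2)" using assms by (intro mult_right_mono) auto
  then have 3: "d - 2 \<le> k * d - 2 * k" by (simp add: algebra_simps)
  have 4: "0 \<le> e * d" using assms by simp
  have "2 * k * (2 + 2 * e + d) = 4 * k + 4 * (k * e) + 2 * (k * d)" "(e + 1) * d / 2 = e * d / 2 + d / 2"
    by (simp_all add: algebra_simps add_divide_distrib)
  then show ?thesis unfolding power2_eq_square using 1 2 3 4 assms by linarith
qed

text \<open>The graph of \<open>\<phi>\<close>, with derivative \<open>\<psi>\<close>. The second derivative lies between \<open>\<Lambda>\<close> and \<open>k * \<Lambda>\<close>, expressed through increments of
\<open>\<psi>\<close>; only the ratio \<open>k\<close> influences the final constants.\<close>

locale strictly_convex_curve =
  fixes \<phi> \<psi> :: "real \<Rightarrow> real" and a b \<Lambda> k :: real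
  assumes deriv: "\<And>t. a \<le> t \<Longrightarrow> t \<le> b \<Longrightarrow> (\<phi> has_real_derivative \<psi> t) (at t)"
    and lower: "\<And>x y. a \<le> x \<Longrightarrow> x \<le> y \<Longrightarrow> y \<le> b \<Longrightarrow> \<Lambda> * (y - x) \<le> \<psi> y - \<psi> x"
    and upper: "\<And>x y. a \<le> x \<Longrightarrow> x \<le> y \<Longrightarrow> y \<le> b \<Longrightarrow> \<psi> y - \<psi> x \<le> k * \<Lambda> * (y - x)"
    and Lambda_pos: "\<Lambda> > 0" and k_ge_1: "k \<ge> 1"
begin

lemma mean_value:
  assumes "a \<le> x" "x \<le> y" "y \<le> b"
  obtains z where "x \<le> z" "z \<le> y" "\<phi> y - \<phi> x = (y - x) * \<psi> z"
proof (cases "x = y")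
  case False
  then have "x < y" using assms by simp
  from MVT2[OF this, of \<phi> \<psi>] deriv assms obtain z where "x < z" "z < y" "\<phi> y - \<phi> x = (y - x) * \<psi> z" by force
  then show ?thesis by (intro that[of z]) auto
qed (use that[of x] in auto)

lemma gap_right_half:
  assumes "a \<le> q" "q \<le> x" "x \<le> y" "y \<le> b"
  shows "\<Lambda> * ((x - q) * (y - x)) \<le> \<phi> y - \<phi> x - \<psi> q * (y - x)"
proof -
  obtain z where z: "x \<le> z" "z \<le> y" "\<phi> y - \<phi> x = (y - x) * \<psi> z" using mean_value[of x y] assms by auto
  have "\<Lambda> * (x - q) \<le> \<Lambda> * (z - q)" using z Lambda_pos by (intro mult_left_mono) auto
  also have "\<dots> \<le> \<psi> z - \<psi> q" using z assms by (intro lower) auto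
  finally have "(y - x) * (\<Lambda> * (x - q)) \<le> (y - x) * (\<psi> z - \<psi> q)" using assms by (intro mult_left_mono) auto
  then show ?thesis using z(3) by (simp add: algebra_simps)
qed

text \<open>The linear bound, applied to both halves of \<open>[x, y]\<close>, yields the additional quadratic term. This term keeps pieces close to
\<open>q\<close> separated as well, where the first term is too small to outweigh the thickness of the parallelograms.\<close>

lemma gap_right:
  assumes "a \<le> q" "q \<le> x" "x \<le> y" "y \<le> b"
  shows "\<Lambda> * ((x - q) * (y - x) + (y - x)\<^sup>2 / 4) \<le> \<phi> y - \<phi> x - \<psi> q * (y - x)"
proof -
  define d where "d = (y - x) / 2"
  define z where "z = x + d"
  have e: "y - x = 2 * d" "z - x = d" "y - z = d" by (simp_all add: d_def z_def field_simps)
  have d: "d \<ge> 0" using assms by (simp add: d_def)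
  have le: "q \<le> z" "x \<le> z" "z \<le> y" "z \<le> b" using d e assms by linarith+
  have 1: "\<Lambda> * ((x - q) * d) \<le> \<phi> z - \<phi> x - \<psi> q * d"
    using gap_right_half[OF assms(1,2) le(2,4)] unfolding e .
  have 2: "\<Lambda> * ((z - q) * d) \<le> \<phi> y - \<phi> z - \<psi> q * d"
    using gap_right_half[OF assms(1) le(1,3) assms(4)] unfolding e .
  have "\<Lambda> * ((x - q) * (2 * d) + (2 * d)\<^sup>2 / 4) = \<Lambda> * ((x - q) * d) + \<Lambda> * ((z - q) * d)"
    by (simp add: z_def power2_eq_square algebra_simps)
  moreover have "\<psi> q * (2 * d) = \<psi> q * d + \<psi> q * d" by simp
  ultimately show ?thesis unfolding e using 1 2 by linarith
qed

lemma gap_left_half: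
  assumes "a \<le> x" "x \<le> y" "y \<le> q" "q \<le> b"
  shows "\<Lambda> * ((q - y) * (y - x)) \<le> \<phi> x - \<phi> y - \<psi> q * (x - y)"
proof -
  obtain z where z: "x \<le> z" "z \<le> y" "\<phi> y - \<phi> x = (y - x) * \<psi> z" using mean_value[of x y] assms by auto
  have "\<Lambda> * (q - y) \<le> \<Lambda> * (q - z)" using z Lambda_pos by (intro mult_left_mono) auto
  also have "\<dots> \<le> \<psi> q - \<psi> z" using z assms by (intro lower) auto
  finally have "(y - x) * (\<Lambda> * (q - y)) \<le> (y - x) * (\<psi> q - \<psi> z)" using assms by (intro mult_left_mono) auto
  then show ?thesis using z(3) by (simp add: algebra_simps)
qed

lemma gap_left:
  assumes "a \<le> x" "x \<le> y" "y \<le> q" "q \<le> b"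
  shows "\<Lambda> * ((q - y) * (y - x) + (y - x)\<^sup>2 / 4) \<le> \<phi> x - \<phi> y - \<psi> q * (x - y)"
proof -
  define d where "d = (y - x) / 2"
  define z where "z = y - d"
  have e: "y - x = 2 * d" "x - y = - (2 * d)" "z - x = d" "y - z = d" "x - z = - d" "z - y = - d"
    by (simp_all add: d_def z_def field_simps)
  have d: "d \<ge> 0" using assms by (simp add: d_def)
  have le: "a \<le> z" "x \<le> z" "z \<le> y" "z \<le> q" using d e(3,4) assms by linarith+
  have 1: "\<Lambda> * ((q - z) * d) \<le> \<phi> x - \<phi> z - \<psi> q * (- d)"
    using gap_left_half[OF assms(1) le(2,4) assms(4)] unfolding e .
  have 2: "\<Lambda> * ((q - y) * d) \<le> \<phi> z - \<phi> y - \<psi> q * (- d)"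
    using gap_left_half[OF le(1,3) assms(3,4)] unfolding e .
  have "\<Lambda> * ((q - y) * (2 * d) + (2 * d)\<^sup>2 / 4) = \<Lambda> * ((q - z) * d) + \<Lambda> * ((q - y) * d)"
    by (simp add: z_def power2_eq_square algebra_simps)
  moreover have "\<psi> q * (- (2 * d)) = \<psi> q * (- d) + \<psi> q * (- d)" by simp
  ultimately show ?thesis unfolding e using 1 2 by linarith
qed

lemma tangent_deviation:
  assumes "a \<le> q" "q \<le> y" "y \<le> b"
  shows "0 \<le> \<phi> y - \<phi> q - \<psi> q * (y - q)" "\<phi> y - \<phi> q - \<psi> q * (y - q) \<le> k * \<Lambda> * (y - q)\<^sup>2"
proof -
  show "0 \<le> \<phi> y - \<phi> q - \<psi> q * (y - q)" using gap_right_half[of q q y] assms by simp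
  obtain z where z: "q \<le> z" "z \<le> y" "\<phi> y - \<phi> q = (y - q) * \<psi> z" using mean_value[of q y] assms by auto
  have "\<psi> z - \<psi> q \<le> k * \<Lambda> * (z - q)" using z assms by (intro upper) auto
  also have "\<dots> \<le> k * \<Lambda> * (y - q)" using z Lambda_pos k_ge_1 by (intro mult_left_mono) auto
  finally have "(y - q) * (\<psi> z - \<psi> q) \<le> (y - q) * (k * \<Lambda> * (y - q))" using assms by (intro mult_left_mono) auto
  then show "\<phi> y - \<phi> q - \<psi> q * (y - q) \<le> k * \<Lambda> * (y - q)\<^sup>2"
    using z(3) by (simp add: algebra_simps power2_eq_square)
qed

text \<open>In units of \<open>v = \<Lambda> s\<^sup>2\<close>, a point of the \<open>j\<close>-th parallelogram deviates from the curve point \<open>t j\<close> in the normal direction at \<open>t q\<close>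
by \<open>O(1 + |j - q|)\<close>, since the parallelogram has length \<open>s\<close> and is turned by an angle of order \<open>|j - q| s\<close> relative to that direction.
Between the curve points themselves the convexity of \<open>\<phi>\<close> gives \<open>|j - q| d + d\<^sup>2 / 4\<close> for pieces at distance \<open>d\<close>, and this dominates the
deviations once \<open>d \<ge> 16 k\<close> (\<open>separation_arithmetic\<close>).\<close>

lemma tangent_separated_parallelograms:
  fixes s :: real and K :: nat
  assumes s: "s > 0" and U: "\<And>j. j \<in> U \<Longrightarrow> a \<le> real j * s \<and> real j * s \<le> b" and K: "16 * k \<le> real K"
  shows "tangent_separated U (\<lambda>j. parallelogram (real j * s, \<phi> (real j * s)) (\<psi> (real j * s)) (2 * s) (2 * (k * \<Lambda> * s\<^sup>2)))
    (\<lambda>j. \<psi> (real j * s)) (\<Lambda> * s\<^sup>2 / 2) K"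
proof -
  define t where "t = (\<lambda>j::nat. real j * s)"
  define v where "v = \<Lambda> * s\<^sup>2"
  have v: "v > 0" using Lambda_pos s by (simp add: v_def)
  define B where "B = (\<lambda>j. parallelogram (t j, \<phi> (t j)) (\<psi> (t j)) (2 * s) (2 * (k * \<Lambda> * s\<^sup>2)))"
  define h where "h = (\<lambda>q j. \<phi> (t j) - \<psi> (t q) * t j)"
  have dev: "\<bar>tilt (\<psi> (t q)) \<xi> - h q j\<bar> \<le> 2 * k * v * (1 + \<bar>real j - real q\<bar>)"
    if "q \<in> U" "j \<in> U" "\<xi> \<in> B j" for q j \<xi>
  proof -
    have 1: "\<bar>fst \<xi> - t j\<bar> \<le> 2 * s" "\<bar>tilt (\<psi> (t j)) \<xi> - tilt (\<psi> (t j)) (t j, \<phi> (t j))\<bar> \<le> 2 * (k * \<Lambda> * s\<^sup>2)"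
      using that(3) by (auto simp: B_def parallelogram_def)
    have tU: "a \<le> t q" "t q \<le> b" "a \<le> t j" "t j \<le> b" using U that by (auto simp: t_def)
    have "\<bar>\<psi> (t j) - \<psi> (t q)\<bar> \<le> k * \<Lambda> * \<bar>t j - t q\<bar>"
    proof (cases "t q \<le> t j")
      case True
      have e: "\<bar>t j - t q\<bar> = t j - t q" "0 \<le> \<Lambda> * (t j - t q)" using True Lambda_pos by auto
      show ?thesis unfolding e(1) using upper[OF tU(1) True tU(4)] lower[OF tU(1) True tU(4)] e(2) by linarith
    next
      case False
      then have le: "t j \<le> t q" by simp
      have e: "\<bar>t j - t q\<bar> = t q - t j" "0 \<le> \<Lambda> * (t q - t j)" using le Lambda_pos by auto
      show ?thesis unfolding e(1) using upper[OF tU(3) le tU(2)] lower[OF tU(3) le tU(2)] e(2) by linarith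
    qed
    also have "\<bar>t j - t q\<bar> = \<bar>real j - real q\<bar> * s" using s by (simp add: t_def abs_mult flip: left_diff_distrib)
    finally have "\<bar>\<psi> (t j) - \<psi> (t q)\<bar> * \<bar>fst \<xi> - t j\<bar> \<le> (k * \<Lambda> * (\<bar>real j - real q\<bar> * s)) * (2 * s)"
      using 1(1) Lambda_pos k_ge_1 s by (intro mult_mono) auto
    then have 2: "\<bar>(\<psi> (t j) - \<psi> (t q)) * (fst \<xi> - t j)\<bar> \<le> 2 * k * v * \<bar>real j - real q\<bar>"
      unfolding abs_mult by (simp add: v_def power2_eq_square mult_ac)
    have "tilt (\<psi> (t q)) \<xi> - h q j = (tilt (\<psi> (t j)) \<xi> - tilt (\<psi> (t j)) (t j, \<phi> (t j))) + (\<psi> (t j) - \<psi> (t q)) * (fst \<xi> - t j)"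
      by (simp add: tilt_def h_def algebra_simps)
    moreover have "2 * (k * \<Lambda> * s\<^sup>2) = 2 * k * v" by (simp add: v_def)
    ultimately show ?thesis using 1(2) 2 unfolding distrib_left mult_1_right by linarith
  qed
  have sep: "v / 2 * (e + 1) * d \<le> \<bar>x - y\<bar>"
    if "e \<ge> 0" "d \<ge> real K" "v * (e * d + d\<^sup>2 / 4) \<le> \<bar>x' - y'\<bar>" "\<bar>x - x'\<bar> + \<bar>y - y'\<bar> \<le> 2 * k * v * (2 + 2 * e + d)" for e d x y x' y' :: real
  proof -
    have "v * ((e + 1) * d / 2 + 2 * k * (2 + 2 * e + d)) \<le> v * (e * d + d\<^sup>2 / 4)"
      using that K v k_ge_1 by (intro mult_left_mono separation_arithmetic) auto
    have "v / 2 * (e + 1) * d + 2 * k * v * (2 + 2 * e + d) \<le> \<bar>x' - y'\<bar>"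
    proof -
      have "v * ((e + 1) * d / 2 + 2 * k * r) = v / 2 * (e + 1) * d + 2 * k * v * r" for r
        by (simp add: distrib_left)
      with \<open>v * ((e + 1) * d / 2 + 2 * k * (2 + 2 * e + d)) \<le> v * (e * d + d\<^sup>2 / 4)\<close> that(3)
      show ?thesis by (metis order_trans)
    qed
    with that(4) show ?thesis by linarith
  qed
  have "tangent_separated U B (\<lambda>j. \<psi> (t j)) (v / 2) K"
  proof
    show "v / 2 > 0" using v by simp
    show "K \<ge> 1" using K k_ge_1 by simp
  next
    fix q j j' \<xi> \<xi>' L
    assume qU: "q \<in> U" "j \<in> U" "j' \<in> U" and ord: "q \<le> j" "j < q + L" "q \<le> j'" "j' < q + L" and \<xi>: "\<xi> \<in> B j" "\<xi>' \<in> B j'"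
    have ht: "0 \<le> h q i - h q q \<and> h q i - h q q \<le> k * v * (real L - 1)\<^sup>2" if "i \<in> U" "q \<le> i" "i < q + L" for i
    proof -
      have tq: "t q \<le> t i" using that s by (simp add: t_def mult_right_mono)
      have e: "t i - t q = (real i - real q) * s" by (simp add: t_def algebra_simps)
      have "(real i - real q)\<^sup>2 \<le> (real L - 1)\<^sup>2" using that by (intro power_mono) auto
      then have "k * v * (real i - real q)\<^sup>2 \<le> k * v * (real L - 1)\<^sup>2" using k_ge_1 v by (intro mult_left_mono) auto
      moreover have "k * \<Lambda> * (t i - t q)\<^sup>2 = k * v * (real i - real q)\<^sup>2"
        unfolding e by (simp add: v_def power_mult_distrib mult_ac)
      moreover have "h q i - h q q = \<phi> (t i) - \<phi> (t q) - \<psi> (t q) * (t i - t q)" by (simp add: h_def algebra_simps)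
      moreover have "a \<le> t q" "t i \<le> b" using U[OF that(1)] U[OF qU(1)] by (auto simp: t_def)
      ultimately show ?thesis using tangent_deviation[of "t q" "t i"] tq by linarith
    qed
    have kv: "k * v \<ge> 0" using k_ge_1 v by simp
    have err: "2 * k * v * (1 + \<bar>real i - real q\<bar>) \<le> 2 * (k * v) * real L" if "q \<le> i" "i < q + L" for i
    proof -
      have "(2 * (k * v)) * (1 + \<bar>real i - real q\<bar>) \<le> (2 * (k * v)) * real L"
        using that kv by (intro mult_left_mono) auto
      then show ?thesis by (simp only: mult.assoc)
    qed
    have "\<bar>tilt (\<psi> (t q)) \<xi> - tilt (\<psi> (t q)) \<xi>'\<bar> \<le> k * v * (real L - 1)\<^sup>2 + 4 * (k * v) * real L"
      using dev[OF qU(1,2) \<xi>(1)] dev[OF qU(1,3) \<xi>(2)] ht[OF qU(2) ord(1,2)] ht[OF qU(3) ord(3,4)] err[OF ord(1,2)] err[OF ord(3,4)]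
      by linarith
    also have "\<dots> = k * v * (real L + 1)\<^sup>2" by (simp add: power2_eq_square algebra_simps)
    also have "\<dots> \<le> k * v * (2 * real L)\<^sup>2" using ord kv by (intro mult_left_mono power_mono) auto
    also have "\<dots> = (8 * k) * (v / 2 * (real L)\<^sup>2)" by (simp add: power2_eq_square)
    also have "\<dots> \<le> real K * (v / 2 * (real L)\<^sup>2)" using K k_ge_1 v by (intro mult_right_mono) auto
    finally show "\<bar>tilt (\<psi> (t q)) \<xi> - tilt (\<psi> (t q)) \<xi>'\<bar> \<le> real K * (v / 2) * (real L)\<^sup>2" by (simp add: mult_ac)
  next
    fix q j j' \<xi> \<xi>'
    assume qU: "q \<in> U" "j \<in> U" "j' \<in> U" and ord: "q \<le> j" "j + K \<le> j'" and \<xi>: "\<xi> \<in> B j" "\<xi>' \<in> B j'"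
    have e: "real (j - q) = real j - real q" "real (j' - j) = real j' - real j" using ord by auto
    have "\<Lambda> * ((t j - t q) * (t j' - t j) + (t j' - t j)\<^sup>2 / 4) \<le> \<phi> (t j') - \<phi> (t j) - \<psi> (t q) * (t j' - t j)"
      using U[OF qU(1)] U[OF qU(2)] U[OF qU(3)] ord s by (intro gap_right) (auto simp: t_def intro!: mult_right_mono)
    then have "v * ((real j - real q) * (real j' - real j) + (real j' - real j)\<^sup>2 / 4) \<le> h q j' - h q j"
      by (simp add: t_def v_def h_def power2_eq_square algebra_simps)
    then show "v / 2 * (real (j - q) + 1) * real (j' - j) \<le> \<bar>tilt (\<psi> (t q)) \<xi> - tilt (\<psi> (t q)) \<xi>'\<bar>"
      unfolding e using ord dev[OF qU(1,2) \<xi>(1)] dev[OF qU(1,3) \<xi>(2)]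
      by (intro sep[where x' = "h q j" and y' = "h q j'"]) (auto simp: algebra_simps)
  next
    fix q j j' \<xi> \<xi>'
    assume qU: "q \<in> U" "j \<in> U" "j' \<in> U" and ord: "j' \<le> q" "j + K \<le> j'" and \<xi>: "\<xi> \<in> B j" "\<xi>' \<in> B j'"
    have e: "real (q - j') = real q - real j'" "real (j' - j) = real j' - real j" using ord by auto
    have "\<Lambda> * ((t q - t j') * (t j' - t j) + (t j' - t j)\<^sup>2 / 4) \<le> \<phi> (t j) - \<phi> (t j') - \<psi> (t q) * (t j - t j')"
      using U[OF qU(1)] U[OF qU(2)] U[OF qU(3)] ord s by (intro gap_left) (auto simp: t_def intro!: mult_right_mono)
    then have "v * ((real q - real j') * (real j' - real j) + (real j' - real j)\<^sup>2 / 4) \<le> h q j - h q j'"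
      by (simp add: t_def v_def h_def power2_eq_square algebra_simps)
    then show "v / 2 * (real (q - j') + 1) * real (j' - j) \<le> \<bar>tilt (\<psi> (t q)) \<xi> - tilt (\<psi> (t q)) \<xi>'\<bar>"
      unfolding e using ord dev[OF qU(1,2) \<xi>(1)] dev[OF qU(1,3) \<xi>(2)]
      by (intro sep[where x' = "h q j" and y' = "h q j'"]) (auto simp: algebra_simps)
  qed
  then show ?thesis by (simp add: B_def t_def v_def)
qed

lemma curve_piece_in_parallelogram:
  assumes "a \<le> x" "x \<le> t" "t \<le> x + s" "t \<le> b"
  shows "(t, \<phi> t) \<in> parallelogram (x, \<phi> x) (\<psi> x) s (k * \<Lambda> * s\<^sup>2)"
proof -
  have "\<phi> t - \<phi> x - \<psi> x * (t - x) \<le> k * \<Lambda> * (t - x)\<^sup>2" "0 \<le> \<phi> t - \<phi> x - \<psi> x * (t - x)"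
    using tangent_deviation[of x t] assms by auto
  moreover have "k * \<Lambda> * (t - x)\<^sup>2 \<le> k * \<Lambda> * s\<^sup>2"
    using assms k_ge_1 Lambda_pos by (intro mult_left_mono power_mono) auto
  ultimately show ?thesis using assms by (simp add: parallelogram_def tilt_def algebra_simps)
qed

end

text \<open>On \<open>[c, 2c]\<close> the second derivative is a multiple of \<open>t powr (\<nu> - 1)\<close>. This is increasing or decreasing according to the sign of
\<open>\<nu> - 1\<close>, so the minimum is at one of the end points.\<close>

lemma power_curve:
  assumes \<nu>: "\<nu> > 0" and c: "c > 0"
  shows "\<exists>\<Lambda>. strictly_convex_curve (\<lambda>t. t powr (1 + \<nu>)) (\<lambda>t. (1 + \<nu>) * t powr \<nu>) c (2 * c) \<Lambda> (2 powr \<bar>\<nu> - 1\<bar>)"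
proof -
  \<comment> \<open>The end point at which \<open>t powr (\<nu> - 1)\<close> is smallest.\<close>
  define c0 where "c0 = (if \<nu> \<ge> 1 then c else 2 * c)"
  define \<Lambda> where "\<Lambda> = (1 + \<nu>) * \<nu> * c0 powr (\<nu> - 1)"
  have c0: "c0 > 0" using c by (simp add: c0_def)
  have bounds: "c0 powr (\<nu> - 1) \<le> z powr (\<nu> - 1) \<and> z powr (\<nu> - 1) \<le> 2 powr \<bar>\<nu> - 1\<bar> * c0 powr (\<nu> - 1)" if z: "c \<le> z" "z \<le> 2 * c" for z
  proof (cases "\<nu> \<ge> 1")
    case True
    have "z powr (\<nu> - 1) \<le> (2 * c) powr (\<nu> - 1)" "c powr (\<nu> - 1) \<le> z powr (\<nu> - 1)"
      using True z c by (auto intro!: powr_mono2)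
    then show ?thesis using True c by (simp add: c0_def powr_mult)
  next
    case False
    have "(2 * c) powr (\<nu> - 1) \<le> z powr (\<nu> - 1)" "z powr (\<nu> - 1) \<le> c powr (\<nu> - 1)"
      using False z c by (auto intro!: powr_mono2')
    moreover have "2 powr \<bar>\<nu> - 1\<bar> * (2 * c) powr (\<nu> - 1) = c powr (\<nu> - 1)"
    proof -
      have "2 powr \<bar>\<nu> - 1\<bar> * 2 powr (\<nu> - 1) = 1" using False unfolding powr_add[symmetric] by simp
      then show ?thesis using c by (simp add: powr_mult)
    qed
    ultimately show ?thesis using False by (simp add: c0_def)
  qed
  have mv: "\<Lambda> * (y - x) \<le> (1 + \<nu>) * y powr \<nu> - (1 + \<nu>) * x powr \<nu> \<and>
      (1 + \<nu>) * y powr \<nu> - (1 + \<nu>) * x powr \<nu> \<le> 2 powr \<bar>\<nu> - 1\<bar> * \<Lambda> * (y - x)" if xy: "c \<le> x" "x \<le> y" "y \<le> 2 * c" for x y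
  proof (cases "x = y")
    case False
    then have "x < y" using xy by simp
    moreover have "((\<lambda>t. (1 + \<nu>) * t powr \<nu>) has_real_derivative (1 + \<nu>) * (\<nu> * t powr (\<nu> - 1))) (at t)" if "x \<le> t" for t
      using that xy c by (auto intro!: derivative_eq_intros)
    ultimately obtain z where z: "x < z" "z < y" "(1 + \<nu>) * y powr \<nu> - (1 + \<nu>) * x powr \<nu> = (y - x) * ((1 + \<nu>) * (\<nu> * z powr (\<nu> - 1)))"
      using MVT2[of x y "\<lambda>t. (1 + \<nu>) * t powr \<nu>" "\<lambda>t. (1 + \<nu>) * (\<nu> * t powr (\<nu> - 1))"] by auto
    have b: "c0 powr (\<nu> - 1) \<le> z powr (\<nu> - 1)" "z powr (\<nu> - 1) \<le> 2 powr \<bar>\<nu> - 1\<bar> * c0 powr (\<nu> - 1)"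
      using bounds[of z] z xy by auto
    have pos: "0 \<le> (y - x) * ((1 + \<nu>) * \<nu>)" using xy \<nu> by simp
    have "(y - x) * ((1 + \<nu>) * \<nu>) * c0 powr (\<nu> - 1) \<le> (y - x) * ((1 + \<nu>) * \<nu>) * z powr (\<nu> - 1)"
      "(y - x) * ((1 + \<nu>) * \<nu>) * z powr (\<nu> - 1) \<le> (y - x) * ((1 + \<nu>) * \<nu>) * (2 powr \<bar>\<nu> - 1\<bar> * c0 powr (\<nu> - 1))"
      using mult_left_mono[OF b(1) pos] mult_left_mono[OF b(2) pos] .
    then show ?thesis unfolding z(3) \<Lambda>_def by (simp add: mult_ac)
  qed simp
  have "strictly_convex_curve (\<lambda>t. t powr (1 + \<nu>)) (\<lambda>t. (1 + \<nu>) * t powr \<nu>) c (2 * c) \<Lambda> (2 powr \<bar>\<nu> - 1\<bar>)"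
  proof
    show "((\<lambda>t. t powr (1 + \<nu>)) has_real_derivative (1 + \<nu>) * t powr \<nu>) (at t)" if "c \<le> t" "t \<le> 2 * c" for t
      using that c by (auto intro!: derivative_eq_intros)
    show "\<Lambda> > 0" using \<nu> c0 by (simp add: \<Lambda>_def)
    show "1 \<le> 2 powr \<bar>\<nu> - 1\<bar>" by (intro ge_one_powr_ge_zero) auto
  qed (use mv in auto)
  then show ?thesis by blast
qed

lemma bounded_parallelogram: "bounded (parallelogram \<gamma> m s w)"
proof -
  have "parallelogram \<gamma> m s w \<subseteq> (\<lambda>(x, y). (x, y + m * x)) ` ({fst \<gamma> - s..fst \<gamma> + s} \<times> {tilt m \<gamma> - w..tilt m \<gamma> + w})"
  proof
    fix \<xi> assume "\<xi> \<in> parallelogram \<gamma> m s w"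
    then show "\<xi> \<in> (\<lambda>(x, y). (x, y + m * x)) ` ({fst \<gamma> - s..fst \<gamma> + s} \<times> {tilt m \<gamma> - w..tilt m \<gamma> + w})"
      by (intro image_eqI[of _ _ "(fst \<xi>, tilt m \<xi>)"]) (auto simp: parallelogram_def tilt_def abs_le_iff)
  qed
  moreover have "compact ((\<lambda>(x, y). (x, y + m * x)) ` ({fst \<gamma> - s..fst \<gamma> + s} \<times> {tilt m \<gamma> - w..tilt m \<gamma> + w}))"
    by (intro compact_continuous_image compact_Times) (auto intro!: continuous_intros simp: case_prod_beta')
  ultimately show ?thesis using bounded_subset compact_imp_bounded by blast
qed

lemma extension_op_eq:
  "extension_op \<nu> Q g x = (LINT t|lebesgue. (indicator Q t *\<^sub>R g t) * unit_exp ((t, t powr (1 + \<nu>)) \<bullet> x))"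
  by (cases x) (simp add: extension_op_def set_lebesgue_integral_def mult.commute)

lemma bandlimited_extension_op:
  assumes g: "g absolutely_integrable_on Q" and B: "bounded B" "\<And>t. t \<in> Q \<Longrightarrow> (t, t powr (1 + \<nu>)) \<in> B"
  shows "\<exists>A. bandlimited B A (extension_op \<nu> Q g)"
proof -
  have "\<exists>A. bandlimited B A (\<lambda>x. LINT t|lebesgue. (indicator Q t *\<^sub>R g t) * unit_exp ((t, t powr (1 + \<nu>)) \<bullet> x))"
  proof (rule bandlimited_integral)
    show "(\<lambda>t. (t, t powr (1 + \<nu>))) \<in> borel_measurable lebesgue"
      by (rule measurable_completion) measurable
    show "integrable lebesgue (\<lambda>t. indicator Q t *\<^sub>R g t)" using g by (simp add: set_integrable_def)
  qed (use B in \<open>auto simp: indicator_def split: if_splits\<close>)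
  then show ?thesis unfolding extension_op_eq[abs_def] .
qed

section \<open>Summation over dyadic arcs\<close>

text \<open>The ranges of summation are \<open>{0}\<close>, \<open>{1}\<close>, \<open>{2, 3}\<close>, \<open>{4 .. 7}\<close> and so on. The index \<open>0\<close> stands alone because the
curvature is not bounded above and below on the interval at the origin.\<close>

definition dyadic :: "(nat \<Rightarrow> 'a::comm_monoid_add) \<Rightarrow> nat \<Rightarrow> 'a" where
  "dyadic f i = (if i = 0 then f 0 else (\<Sum>j\<in>block (2 ^ (i - 1)) (i - 1). f j))"

lemma sum_dyadic: "(\<Sum>j<2 ^ m. f j) = (\<Sum>i\<le>m. dyadic f i)"
proof (induction m)
  case (Suc m)
  have "{..<(2::nat) ^ Suc m} = {..<2 ^ m} \<union> block (2 ^ m) m" by (auto simp: block_def)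
  then have "(\<Sum>j<2 ^ Suc m. f j) = (\<Sum>j<2 ^ m. f j) + (\<Sum>j\<in>block (2 ^ m) m. f j)"
    by (simp add: sum.union_disjoint block_def disjoint_iff)
  then show ?case using Suc by (simp add: dyadic_def)
qed (simp add: dyadic_def)

text \<open>The number of dyadic arcs is logarithmic in the number of pieces.\<close>

lemma log_le_power: "\<theta> > 0 \<Longrightarrow> real m + 1 \<le> (1 + 1 / (\<theta> * ln 2)) * 2 powr (\<theta> * real m)"
proof -
  assume \<theta>: "\<theta> > 0"
  define t where "t = \<theta> * ln 2"
  have t: "t > 0" using \<theta> by (simp add: t_def)
  have e: "2 powr (\<theta> * real m) = exp (t * real m)" by (simp add: powr_def t_def mult_ac)
  have a: "1 + t * real m \<le> exp (t * real m)" by (rule exp_ge_add_one_self)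
  have "1 \<le> exp (t * real m)" using t by simp
  moreover have "t * real m \<le> exp (t * real m)" using a by linarith
  then have "real m \<le> exp (t * real m) / t" unfolding pos_le_divide_eq[OF t] by (simp only: mult.commute)
  ultimately have "real m + 1 \<le> exp (t * real m) + exp (t * real m) / t" by linarith
  then show ?thesis unfolding e t_def[symmetric] by (simp add: algebra_simps)
qed

definition piece :: "real \<Rightarrow> nat \<Rightarrow> real set" where
  "piece s j = (if Suc j < nat \<lceil>1 / s\<rceil> then {real j * s..<real (Suc j) * s} else {real j * s..1})"

lemma Part_pieces:
  assumes s: "0 < s" "s \<le> 1" and N: "N = nat \<lceil>1 / s\<rceil>"
  shows "Part s = piece s ` {..<N}" and "inj_on (piece s) {..<N}"
    and "\<And>j. j < N \<Longrightarrow> piece s j \<subseteq> {real j * s..real (Suc j) * s} \<inter> {0..1}"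
    and "\<And>t. indicator {0..1} t = (\<Sum>j<N. indicator (piece s j) t :: real)"
    and "1 \<le> N" and "real N \<le> 2 / s"
proof -
  have N1: "1 / s \<le> real N" "real N < 1 / s + 1"
  proof -
    have "real N = real_of_int \<lceil>1 / s\<rceil>" using s by (simp add: N of_nat_nat)
    then show "1 / s \<le> real N" "real N < 1 / s + 1" using ceiling_correct[of "1 / s"] by linarith+
  qed
  have N2: "1 \<le> N" using N1(1) s by (cases N) (auto simp: field_simps)
  have Ns: "1 \<le> real N * s" "real N * s < 1 + s" using N1 s by (auto simp: field_simps)
  show "Part s = piece s ` {..<N}"
    unfolding Part_def Let_def piece_def N by (intro image_cong refl)
  have js: "real j * s \<le> 1" if "j < N" for j
  proof -
    have "(real j + 1) * s \<le> real N * s" using that s by (intro mult_right_mono) auto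
    then show ?thesis using Ns(2) by (simp add: algebra_simps)
  qed
  have mem: "real j * s \<in> piece s j" if "j < N" for j using js[OF that] s by (auto simp: piece_def)
  have low: "real j * s \<le> t" if "t \<in> piece s j" for j t using that by (auto simp: piece_def split: if_splits)
  show "inj_on (piece s) {..<N}"
  proof (rule inj_onI)
    fix i j assume "i \<in> {..<N}" "j \<in> {..<N}" "piece s i = piece s j"
    then have "real i * s \<le> real j * s" "real j * s \<le> real i * s" using mem low by auto
    then show "i = j" using s by simp
  qed
  show "piece s j \<subseteq> {real j * s..real (Suc j) * s} \<inter> {0..1}" if "j < N" for j
  proof
    fix t assume t: "t \<in> piece s j"
    have 0: "0 \<le> real j * s" using s by simp
    show "t \<in> {real j * s..real (Suc j) * s} \<inter> {0..1}"
    proof (cases "Suc j < N")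
      case True
      then have "t < real (Suc j) * s" using t by (simp add: piece_def N)
      then show ?thesis using low[OF t] 0 js[OF True] by auto
    next
      case False
      then have "N = Suc j" using that by simp
      then show ?thesis using t 0 Ns(1) False by (auto simp: piece_def N[symmetric])
    qed
  qed
  show "indicator {0..1} t = (\<Sum>j<N. indicator (piece s j) t :: real)" for t
  proof -
    obtain M where M: "N = Suc M" using N2 by (cases N) auto
    have a: "(\<Sum>j<k. indicator {real j * s..<real (Suc j) * s} t :: real) = indicator {0..<real k * s} t" for k
    proof (induction k)
      case (Suc k)
      have "0 \<le> real k * s" "real k * s \<le> real (Suc k) * s" using s by (auto simp: distrib_right)
      then show ?case using Suc by (auto simp: indicator_def)
    qed simp
    have "(\<Sum>j<N. indicator (piece s j) t :: real) = (\<Sum>j<M. indicator {real j * s..<real (Suc j) * s} t) + indicator {real M * s..1} t"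
      unfolding M by (simp add: piece_def N[symmetric] M)
    also have "\<dots> = indicator {0..<real M * s} t + indicator {real M * s..1} t" unfolding a ..
    also have "\<dots> = indicator {0..1} t"
    proof -
      have "0 \<le> real M * s" using s by simp
      then show ?thesis using js[of M] M by (auto simp: indicator_def)
    qed
    finally show ?thesis by simp
  qed
  show "1 \<le> N" by (rule N2)
  have "1 \<le> 1 / s" using s by simp
  then show "real N \<le> 2 / s" using N1(2) by linarith
qed

lemma Lp_norm_finite:
  assumes "Lp_norm p f \<noteq> \<infinity>" "p > 0"
  obtains v where "v \<ge> 0" "Lp_norm p f = ennreal v" "(\<integral>\<^sup>+x. ennreal (norm (f x) powr p) \<partial>lborel) = ennreal (v powr p)"
proof -
  define I where "I = (\<integral>\<^sup>+x. ennreal (norm (f x) powr p) \<partial>lborel)"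
  have I: "I \<noteq> \<infinity>" using assms by (auto simp: Lp_norm_def ennreal_powr_def I_def split: if_splits)
  show ?thesis
  proof (rule that[of "enn2real I powr (1 / p)"])
    show "Lp_norm p f = ennreal (enn2real I powr (1 / p))"
      using I by (simp add: Lp_norm_def ennreal_powr_def I_def)
    show "(\<integral>\<^sup>+x. ennreal (norm (f x) powr p) \<partial>lborel) = ennreal ((enn2real I powr (1 / p)) powr p)"
      using I assms(2) by (simp add: powr_powr I_def less_top)
  qed simp
qed

lemma Lp_norm_le:
  assumes "(\<integral>\<^sup>+x. ennreal (norm (f x) powr p) \<partial>lborel) \<le> ennreal X" "p > 0" "X \<ge> 0"
  shows "Lp_norm p f \<le> ennreal (X powr (1 / p))"
proof -
  define I where "I = (\<integral>\<^sup>+x. ennreal (norm (f x) powr p) \<partial>lborel)"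
  have "I < \<infinity>" using assms(1) unfolding I_def[symmetric] by (rule order.strict_trans1) simp
  then have I: "I \<noteq> \<infinity>" by simp
  have "enn2real I \<le> X" using assms unfolding I_def[symmetric] by (simp add: enn2real_leI)
  then have "enn2real I powr (1 / p) \<le> X powr (1 / p)" using assms by (intro powr_mono2) auto
  then show ?thesis using I by (simp add: Lp_norm_def ennreal_powr_def I_def[symmetric] ennreal_leI)
qed

theorem theorem1p1:
  fixes \<nu> p \<epsilon> :: real
  assumes "\<nu> > 0" and "2 \<le> p" and "p \<le> 6" and "\<epsilon> > 0"
  shows "\<exists>C::real. C > 0 \<and>
    (\<forall>\<delta>::real. 0 < \<delta> \<and> \<delta> \<le> 1 \<longrightarrow>
      (\<forall>g :: real \<Rightarrow> complex. g absolutely_integrable_on {0..1} \<longrightarrow>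
        Lp_norm p (extension_op \<nu> {0..1} g)
          \<le> ennreal (C * \<delta> powr (- \<epsilon>)) *
            ennreal_powr
              (\<Sum>\<Delta>\<in>Part (\<delta> powr (1 / 2)). (Lp_norm p (extension_op \<nu> \<Delta> g))\<^sup>2) (1 / 2)))"
proof -
  note \<nu> = assms(1) and p = assms(2,3) and \<epsilon> = assms(4)
  define \<eta> where "\<eta> = \<epsilon> / 4"
  have \<eta>: "\<eta> > 0" using \<epsilon> by (simp add: \<eta>_def)
  define k where "k = 2 powr \<bar>\<nu> - 1\<bar>"
  obtain K :: nat where K: "16 * k \<le> real K" using real_arch_simple by blast
  obtain C0 where C0: "C0 \<ge> 0" "\<And>U \<gamma> m s w u f v q l. s > 0 \<Longrightarrow> w > 0 \<Longrightarrow>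
    tangent_separated U (\<lambda>j. parallelogram (\<gamma> j) (m j) (2 * s) (2 * w)) m u K \<Longrightarrow> block q l \<subseteq> U \<Longrightarrow>
    (\<forall>j\<in>U. \<exists>A. bandlimited (parallelogram (\<gamma> j) (m j) s w) A (f j)) \<Longrightarrow> (\<forall>j. 0 \<le> v j) \<Longrightarrow>
    (\<forall>j\<in>block q l. (\<integral>\<^sup>+x. ennreal (norm (f j x) powr p) \<partial>lborel) \<le> ennreal (v j powr p)) \<Longrightarrow>
    (\<integral>\<^sup>+x. ennreal (norm (\<Sum>j\<in>block q l. f j x) powr p) \<partial>lborel) \<le> ennreal (C0 * 2 powr (\<eta> * l) * (\<Sum>j\<in>block q l. v j ^ 2) powr (p / 2))"
    using Lp_decoupling[OF \<eta> p, of K] by blast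
  \<comment> \<open>The logarithmic factor occurs with the exponent \<open>p + 1\<close>; with this \<open>\<theta>\<close> it costs \<open>2 powr (\<eta> * M)\<close> for \<open>2^M\<close> pieces.\<close>
  define \<theta> where "\<theta> = \<eta> / (p + 1)"
  have \<theta>: "\<theta> > 0" using \<eta> p by (simp add: \<theta>_def)
  define c where "c = 1 + 1 / (\<theta> * ln 2)"
  have c: "c > 0" using \<theta> by (simp add: c_def add_pos_pos)
  define C1 where "C1 = c powr (p + 1) * (1 + C0)"
  have C1: "C1 > 0" using c C0(1) by (simp add: C1_def)
  define C where "C = C1 powr (1 / p) * 4 powr (2 * \<epsilon>)"
  have C: "C > 0" using C1 by (simp add: C_def)
  show ?thesis
  proof (intro exI[of _ C] conjI allI impI C)
    fix \<delta> :: real and g :: "real \<Rightarrow> complex"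
    assume \<delta>: "0 < \<delta> \<and> \<delta> \<le> 1" and g: "g absolutely_integrable_on {0..1}"
    define s where "s = \<delta> powr (1 / 2)"
    have s: "0 < s" "s \<le> 1" using \<delta> by (auto simp: s_def powr_le1)
    define N where "N = nat \<lceil>1 / s\<rceil>"
    note P = Part_pieces[OF s N_def]
    define E where "E = (\<lambda>j. extension_op \<nu> (piece s j) g)"
    have Csum: "(\<Sum>\<Delta>\<in>Part s. (Lp_norm p (extension_op \<nu> \<Delta> g))\<^sup>2) = (\<Sum>j<N. (Lp_norm p (E j))\<^sup>2)"
      unfolding P(1) E_def using P(2) by (simp add: sum.reindex)
    have pos: "C * \<delta> powr (- \<epsilon>) > 0" using C \<delta> by simp
    show "Lp_norm p (extension_op \<nu> {0..1} g) \<le> ennreal (C * \<delta> powr (- \<epsilon>)) *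
            ennreal_powr (\<Sum>\<Delta>\<in>Part (\<delta> powr (1 / 2)). (Lp_norm p (extension_op \<nu> \<Delta> g))\<^sup>2) (1 / 2)"
      unfolding s_def[symmetric] Csum
    \<comment> \<open>If one of the norms on the right-hand side is infinite, then so is the right-hand side.\<close>
    proof (cases "\<exists>j<N. Lp_norm p (E j) = \<infinity>")
      case True
      then obtain j where j: "j < N" "Lp_norm p (E j) = \<infinity>" by blast
      have "(Lp_norm p (E j))\<^sup>2 \<le> (\<Sum>j<N. (Lp_norm p (E j))\<^sup>2)" using j by (intro member_le_sum) auto
      then have "(\<Sum>j<N. (Lp_norm p (E j))\<^sup>2) = \<infinity>" using j by (simp add: top_unique power2_eq_square)
      then show "Lp_norm p (extension_op \<nu> {0..1} g) \<le> ennreal (C * \<delta> powr (- \<epsilon>)) * ennreal_powr (\<Sum>j<N. (Lp_norm p (E j))\<^sup>2) (1 / 2)"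
      proof -
        have "ennreal X * \<infinity> = \<infinity>" if "X > 0" for X :: real
          using that by (simp add: ennreal_mult_eq_top_iff ennreal_eq_0_iff)
        from this[OF pos] show ?thesis
          unfolding \<open>(\<Sum>j<N. (Lp_norm p (E j))\<^sup>2) = \<infinity>\<close> ennreal_powr_def by simp
      qed
    next
      case False
      have "\<exists>v. \<forall>j<N. v j \<ge> 0 \<and> Lp_norm p (E j) = ennreal (v j) \<and> (\<integral>\<^sup>+x. ennreal (norm (E j x) powr p) \<partial>lborel) = ennreal (v j powr p)"
      proof -
        have "\<forall>j. \<exists>v. j < N \<longrightarrow> v \<ge> 0 \<and> Lp_norm p (E j) = ennreal v \<and> (\<integral>\<^sup>+x. ennreal (norm (E j x) powr p) \<partial>lborel) = ennreal (v powr p)"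
        proof
          fix j
          show "\<exists>v. j < N \<longrightarrow> v \<ge> 0 \<and> Lp_norm p (E j) = ennreal v \<and> (\<integral>\<^sup>+x. ennreal (norm (E j x) powr p) \<partial>lborel) = ennreal (v powr p)"
          proof (cases "j < N")
            case True
            then have "Lp_norm p (E j) \<noteq> \<infinity>" using False by blast
            then obtain v where "v \<ge> 0" "Lp_norm p (E j) = ennreal v" "(\<integral>\<^sup>+x. ennreal (norm (E j x) powr p) \<partial>lborel) = ennreal (v powr p)"
              by (rule Lp_norm_finite) (use p in auto)
            then show ?thesis by blast
          qed simp
        qed
        from choice[OF this] show ?thesis by blast
      qed
      then obtain v0 where v0: "\<And>j. j < N \<Longrightarrow> v0 j \<ge> 0" "\<And>j. j < N \<Longrightarrow> Lp_norm p (E j) = ennreal (v0 j)"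
        "\<And>j. j < N \<Longrightarrow> (\<integral>\<^sup>+x. ennreal (norm (E j x) powr p) \<partial>lborel) = ennreal (v0 j powr p)" by blast
      define v where "v = (\<lambda>j. if j < N then v0 j else 0)"
      define f where "f = (\<lambda>j. if j < N then E j else (\<lambda>x. 0))"
      have v: "0 \<le> v j" for j using v0 by (simp add: v_def)
      have fv: "(\<integral>\<^sup>+x. ennreal (norm (f j x) powr p) \<partial>lborel) \<le> ennreal (v j powr p)" for j
        using v0(3)[of j] p by (cases "j < N") (auto simp: f_def v_def)
      define V where "V = (\<Sum>j<N. v j ^ 2)"
      have V: "V \<ge> 0" by (auto simp: V_def intro!: sum_nonneg)
      have VS: "(\<Sum>j\<in>J. v j ^ 2) \<le> V" if "finite J" for J
      proof -
        have "(\<Sum>j\<in>J. v j ^ 2) = (\<Sum>j\<in>J \<inter> {..<N}. v j ^ 2)"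
          using that by (intro sum.mono_neutral_right) (auto simp: v_def)
        also have "\<dots> \<le> V" unfolding V_def by (intro sum_mono2) auto
        finally show ?thesis .
      qed
      have gp: "g absolutely_integrable_on piece s j" if "j < N" for j
        by (rule set_integrable_subset[OF g]) (use P(3)[OF that] in \<open>auto simp: piece_def\<close>)
      have fm: "f j \<in> borel_measurable borel" for j
      proof (cases "j < N")
        case True
        have "\<exists>A. bandlimited ({0..1} \<times> {0..1}) A (extension_op \<nu> (piece s j) g)"
          using P(3)[OF True] \<nu> by (intro bandlimited_extension_op gp True bounded_Times) (auto simp: powr_le1 subset_iff)
        then show ?thesis using bandlimited_measurable True by (auto simp: f_def E_def)
      qed (simp add: f_def)
      have dyadic_arc: "(\<integral>\<^sup>+x. ennreal (norm (\<Sum>j\<in>block (2 ^ i) i. f j x) powr p) \<partial>lborel) \<le> ennreal (C0 * 2 powr (\<eta> * i) * (\<Sum>j\<in>block (2 ^ i) i. v j ^ 2) powr (p / 2))" for i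
      proof -
        define a where "a = 2 ^ i * s"
        have a: "a > 0" using s by (simp add: a_def)
        obtain \<Lambda> where cv: "strictly_convex_curve (\<lambda>t. t powr (1 + \<nu>)) (\<lambda>t. (1 + \<nu>) * t powr \<nu>) a (2 * a) \<Lambda> k"
          using power_curve[OF \<nu> a] unfolding k_def by blast
        interpret strictly_convex_curve "\<lambda>t. t powr (1 + \<nu>)" "\<lambda>t. (1 + \<nu>) * t powr \<nu>" a "2 * a" \<Lambda> k by (rule cv)
        have U: "a \<le> real j * s \<and> real (Suc j) * s \<le> 2 * a" if "j \<in> block (2 ^ i) i" for j
        proof -
          have "2 ^ i \<le> j" "Suc j \<le> 2 * 2 ^ i" using that by (auto simp: block_def)
          then have "real (2 ^ i) \<le> real j" "real (Suc j) \<le> real (2 * 2 ^ i)" by (simp_all only: of_nat_le_iff)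
          then have "real (2 ^ i) * s \<le> real j * s" "real (Suc j) * s \<le> real (2 * 2 ^ i) * s"
            using s by (auto intro!: mult_right_mono simp del: of_nat_Suc of_nat_mult of_nat_power)
          then show ?thesis by (simp add: a_def)
        qed
        show ?thesis
        proof (rule C0(2))
          show "tangent_separated (block (2 ^ i) i) (\<lambda>j. parallelogram (real j * s, (real j * s) powr (1 + \<nu>)) ((1 + \<nu>) * (real j * s) powr \<nu>) (2 * s) (2 * (k * \<Lambda> * s\<^sup>2)))
              (\<lambda>j. (1 + \<nu>) * (real j * s) powr \<nu>) (\<Lambda> * s\<^sup>2 / 2) K"
          proof (rule tangent_separated_parallelograms[OF s(1) _ K])
            fix j assume "j \<in> block (2 ^ i) i"
            from U[OF this] show "a \<le> real j * s \<and> real j * s \<le> 2 * a" using s by (auto simp: algebra_simps)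
          qed
          show "k * \<Lambda> * s\<^sup>2 > 0" using k_ge_1 Lambda_pos s by simp
          show "\<forall>j\<in>block (2 ^ i) i. \<exists>A. bandlimited (parallelogram (real j * s, (real j * s) powr (1 + \<nu>)) ((1 + \<nu>) * (real j * s) powr \<nu>) s (k * \<Lambda> * s\<^sup>2)) A (f j)"
          proof
            fix j assume j: "j \<in> block (2 ^ i) i"
            show "\<exists>A. bandlimited (parallelogram (real j * s, (real j * s) powr (1 + \<nu>)) ((1 + \<nu>) * (real j * s) powr \<nu>) s (k * \<Lambda> * s\<^sup>2)) A (f j)"
            proof (cases "j < N")
              case True
              have "\<exists>A. bandlimited (parallelogram (real j * s, (real j * s) powr (1 + \<nu>)) ((1 + \<nu>) * (real j * s) powr \<nu>) s (k * \<Lambda> * s\<^sup>2)) A (extension_op \<nu> (piece s j) g)"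
              proof (rule bandlimited_extension_op[OF gp[OF True] bounded_parallelogram])
                fix t assume "t \<in> piece s j"
                then have "real j * s \<le> t" "t \<le> real (Suc j) * s" using P(3)[OF True] by auto
                then show "(t, t powr (1 + \<nu>)) \<in> parallelogram (real j * s, (real j * s) powr (1 + \<nu>)) ((1 + \<nu>) * (real j * s) powr \<nu>) s (k * \<Lambda> * s\<^sup>2)"
                  using U[OF j] by (intro curve_piece_in_parallelogram) (auto simp: algebra_simps)
              qed
              then show ?thesis using True by (simp add: f_def E_def)
            next
              case F: False
              then show ?thesis using bandlimited_mono[OF bandlimited_zero] by (auto simp: f_def)
            qed
          qed
        qed (use s v fv in auto)
      qed
      obtain M where M: "real N \<le> 2 ^ M" "2 ^ M \<le> 2 * real N"
      proof -
        define M where "M = (LEAST M. N \<le> 2 ^ M)"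
        have "N \<le> 2 ^ N" by (rule less_imp_le[OF less_exp])
        then have 1: "N \<le> 2 ^ M" unfolding M_def by (rule LeastI)
        have 2: "2 ^ M \<le> 2 * N"
        proof (cases M)
          case (Suc M')
          then have "\<not> N \<le> 2 ^ M'" using not_less_Least[of M' "\<lambda>M. N \<le> 2 ^ M"] unfolding M_def by simp
          then show ?thesis using Suc by simp
        qed (use P(5) in simp)
        have "real N \<le> real (2 ^ M)" "real (2 ^ M) \<le> real (2 * N)" using 1 2 by (simp_all only: of_nat_le_iff)
        then show ?thesis by (intro that[of M]) simp_all
      qed
      have Eeq: "extension_op \<nu> {0..1} g x = (\<Sum>i\<le>M. dyadic (\<lambda>j. f j x) i)" for x
      proof -
        have i: "integrable lebesgue (\<lambda>t. (indicator (piece s j) t *\<^sub>R g t) * unit_exp ((t, t powr (1 + \<nu>)) \<bullet> x))" if "j < N" for j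
        proof (rule Bochner_Integration.integrable_bound)
          show "integrable lebesgue (\<lambda>t. indicator (piece s j) t *\<^sub>R g t)" using gp[OF that] by (simp add: set_integrable_def)
          have "(\<lambda>t. unit_exp ((t, t powr (1 + \<nu>)) \<bullet> x)) \<in> borel_measurable lebesgue"
            by (rule measurable_completion) measurable
          moreover have "(\<lambda>t. indicator (piece s j) t *\<^sub>R g t) \<in> borel_measurable lebesgue"
            using gp[OF that] by (auto simp: set_integrable_def)
          ultimately show "(\<lambda>t. (indicator (piece s j) t *\<^sub>R g t) * unit_exp ((t, t powr (1 + \<nu>)) \<bullet> x)) \<in> borel_measurable lebesgue"
            by (rule borel_measurable_times[rotated])
        qed (simp add: norm_mult)
        have "extension_op \<nu> {0..1} g x = (LINT t|lebesgue. (\<Sum>j<N. (indicator (piece s j) t *\<^sub>R g t) * unit_exp ((t, t powr (1 + \<nu>)) \<bullet> x)))"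
          unfolding extension_op_eq P(4) by (simp only: scaleR_sum_left sum_distrib_right)
        also have "\<dots> = (\<Sum>j<N. E j x)"
          unfolding E_def extension_op_eq by (rule Bochner_Integration.integral_sum) (use i in auto)
        also have "\<dots> = (\<Sum>j<N. f j x)" by (simp add: f_def)
        also have "\<dots> = (\<Sum>j<2 ^ M. f j x)"
        proof (rule sum.mono_neutral_left)
          have "real N \<le> real (2 ^ M)" using M(1) by simp
          then have "N \<le> 2 ^ M" by (simp only: of_nat_le_iff)
          then show "{..<N} \<subseteq> {..<2 ^ M}" by auto
        qed (auto simp: f_def)
        also have "\<dots> = (\<Sum>i\<le>M. dyadic (\<lambda>j. f j x) i)" by (rule sum_dyadic)
        finally show ?thesis .
      qed
      define Y where "Y = (1 + C0) * 2 powr (\<eta> * M) * V powr (p / 2)"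
      have Y0: "Y \<ge> 0" using C0(1) by (simp add: Y_def)
      have one: "1 \<le> 2 powr (\<eta> * M)" using \<eta> by (intro ge_one_powr_ge_zero) auto
      have dy: "(\<integral>\<^sup>+x. ennreal (norm (dyadic (\<lambda>j. f j x) i) powr p) \<partial>lborel) \<le> ennreal Y" if "i \<le> M" for i
      proof (cases i)
        case 0
        have "(\<integral>\<^sup>+x. ennreal (norm (dyadic (\<lambda>j. f j x) i) powr p) \<partial>lborel) \<le> ennreal (v 0 powr p)"
          using fv[of 0] 0 by (simp add: dyadic_def)
        also have "v 0 powr p = (v 0 ^ 2) powr (p / 2)"
          using v[of 0] by (cases "v 0 = 0") (simp_all add: powr_powr flip: powr_numeral)
        also have "\<dots> \<le> V powr (p / 2)" using VS[of "{0}"] p by (intro powr_mono2) auto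
        also have "\<dots> \<le> Y"
        proof -
          have "1 * 1 * V powr (p / 2) \<le> Y" unfolding Y_def using C0(1) one by (intro mult_mono) auto
          then show ?thesis by simp
        qed
        finally show ?thesis by (simp add: ennreal_leI)
      next
        case (Suc n)
        have "(\<integral>\<^sup>+x. ennreal (norm (dyadic (\<lambda>j. f j x) i) powr p) \<partial>lborel) \<le> ennreal (C0 * 2 powr (\<eta> * n) * (\<Sum>j\<in>block (2 ^ n) n. v j ^ 2) powr (p / 2))"
          using dyadic_arc[of n] Suc by (simp add: dyadic_def)
        also have "\<dots> \<le> ennreal Y"
        proof (rule ennreal_leI)
          have "(\<Sum>j\<in>block (2 ^ n) n. v j ^ 2) powr (p / 2) \<le> V powr (p / 2)"
            using VS[of "block (2 ^ n) n"] p by (intro powr_mono2) (auto intro!: sum_nonneg)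
          moreover have "2 powr (\<eta> * n) \<le> 2 powr (\<eta> * M)" using that Suc \<eta> by (intro powr_mono mult_left_mono) auto
          ultimately show "C0 * 2 powr (\<eta> * n) * (\<Sum>j\<in>block (2 ^ n) n. v j ^ 2) powr (p / 2) \<le> Y"
            unfolding Y_def using C0(1) by (intro mult_mono) auto
        qed
        finally show ?thesis .
      qed
      have dm [measurable]: "(\<lambda>x. dyadic (\<lambda>j. f j x) i) \<in> borel_measurable borel" for i
        unfolding dyadic_def using fm by (cases "i = 0") auto
      have "(\<integral>\<^sup>+x. ennreal (norm (extension_op \<nu> {0..1} g x) powr p) \<partial>lborel) \<le>
        (\<integral>\<^sup>+x. ennreal ((real M + 1) powr p) * (\<Sum>i\<le>M. ennreal (norm (dyadic (\<lambda>j. f j x) i) powr p)) \<partial>lborel)"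
      proof (rule nn_integral_mono)
        fix x
        have "norm (extension_op \<nu> {0..1} g x) powr p \<le> (real M + 1) powr p * (\<Sum>i\<le>M. norm (dyadic (\<lambda>j. f j x) i) powr p)"
          unfolding Eeq using norm_sum_powr_le[of "{..M}" p "dyadic (\<lambda>j. f j x)"] p by (simp add: add.commute)
        then have "ennreal (norm (extension_op \<nu> {0..1} g x) powr p) \<le> ennreal ((real M + 1) powr p * (\<Sum>i\<le>M. norm (dyadic (\<lambda>j. f j x) i) powr p))"
          by (rule ennreal_leI)
        also have "\<dots> = ennreal ((real M + 1) powr p) * (\<Sum>i\<le>M. ennreal (norm (dyadic (\<lambda>j. f j x) i) powr p))"
          by (simp add: ennreal_mult' sum_ennreal)
        finally show "ennreal (norm (extension_op \<nu> {0..1} g x) powr p) \<le> ennreal ((real M + 1) powr p) * (\<Sum>i\<le>M. ennreal (norm (dyadic (\<lambda>j. f j x) i) powr p))" .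
      qed
      also have "\<dots> = ennreal ((real M + 1) powr p) * (\<Sum>i\<le>M. \<integral>\<^sup>+x. ennreal (norm (dyadic (\<lambda>j. f j x) i) powr p) \<partial>lborel)"
      proof -
        have "(\<integral>\<^sup>+x. (\<Sum>i\<le>M. ennreal (norm (dyadic (\<lambda>j. f j x) i) powr p)) \<partial>lborel) = (\<Sum>i\<le>M. \<integral>\<^sup>+x. ennreal (norm (dyadic (\<lambda>j. f j x) i) powr p) \<partial>lborel)"
          by (rule nn_integral_sum) measurable
        moreover have "(\<lambda>x. \<Sum>i\<le>M. ennreal (norm (dyadic (\<lambda>j. f j x) i) powr p)) \<in> borel_measurable lborel" by measurable
        ultimately show ?thesis by (simp only: nn_integral_cmult)
      qed
      also have "\<dots> \<le> ennreal ((real M + 1) powr p) * (\<Sum>i\<le>M. ennreal Y)"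
        using dy by (intro mult_left_mono sum_mono) auto
      also have "\<dots> = ennreal ((real M + 1) powr (p + 1) * Y)"
      proof -
        have "(\<Sum>i\<le>M. ennreal Y) = ennreal (\<Sum>i\<le>M. Y)" by (rule sum_ennreal) (use Y0 in simp)
        also have "(\<Sum>i\<le>M. Y) = (real M + 1) * Y" by (simp add: algebra_simps)
        finally have "ennreal ((real M + 1) powr p) * (\<Sum>i\<le>M. ennreal Y) = ennreal ((real M + 1) powr p * ((real M + 1) * Y))"
          using Y0 by (simp only: ennreal_mult' powr_ge_zero)
        also have "(real M + 1) powr p * ((real M + 1) * Y) = (real M + 1) powr (p + 1) * Y"
          by (simp add: powr_add)
        finally show ?thesis .
      qed
      also have "\<dots> \<le> ennreal (C1 * 2 powr (2 * \<eta> * M) * V powr (p / 2))"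
      proof (rule ennreal_leI)
        have "(real M + 1) powr (p + 1) \<le> (c * 2 powr (\<theta> * M)) powr (p + 1)"
          using log_le_power[OF \<theta>, of M] p unfolding c_def by (intro powr_mono2) auto
        also have "\<dots> = c powr (p + 1) * 2 powr (\<eta> * M)"
          using c p by (simp add: powr_mult powr_powr \<theta>_def)
        finally have "(real M + 1) powr (p + 1) * Y \<le> (c powr (p + 1) * 2 powr (\<eta> * M)) * Y" using Y0 by (intro mult_right_mono) auto
        also have "\<dots> = C1 * (2 powr (\<eta> * M) * 2 powr (\<eta> * M)) * V powr (p / 2)" by (simp add: C1_def Y_def mult_ac)
        also have "2 powr (\<eta> * M) * 2 powr (\<eta> * M) = 2 powr (2 * \<eta> * M)" unfolding powr_add[symmetric] by (simp add: mult.assoc)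
        finally show "(real M + 1) powr (p + 1) * Y \<le> C1 * 2 powr (2 * \<eta> * M) * V powr (p / 2)" .
      qed
      finally have "Lp_norm p (extension_op \<nu> {0..1} g) \<le> ennreal ((C1 * 2 powr (2 * \<eta> * M) * V powr (p / 2)) powr (1 / p))"
        by (rule Lp_norm_le) (use p C1 in auto)
      also have "(C1 * 2 powr (2 * \<eta> * M) * V powr (p / 2)) powr (1 / p) = C1 powr (1 / p) * (2 powr M) powr (2 * \<eta> / p) * V powr (1 / 2)"
        using C1 p by (simp add: powr_mult powr_powr mult_ac)
      also have "\<dots> \<le> C * \<delta> powr (- \<epsilon>) * V powr (1 / 2)"
      proof -
        have "2 * real N \<le> 4 / s" using P(6) by simp
        then have "2 powr M \<le> 4 / s" using M(2) by (simp add: powr_realpow)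
        then have "(2 powr M) powr (2 * \<eta> / p) \<le> (4 / s) powr (2 * \<eta> / p)" using \<eta> p by (intro powr_mono2) auto
        also have "\<dots> \<le> (4 / s) powr (2 * \<epsilon>)"
        proof (rule powr_mono)
          have "2 * \<eta> / p \<le> 2 * \<eta> / 1" using \<eta> p by (intro divide_left_mono) auto
          then show "2 * \<eta> / p \<le> 2 * \<epsilon>" using \<epsilon> by (simp add: \<eta>_def)
        qed (use s in simp)
        also have "\<dots> = 4 powr (2 * \<epsilon>) * \<delta> powr (- \<epsilon>)"
          using \<delta> by (simp add: s_def powr_divide powr_powr powr_minus_divide)
        finally have "C1 powr (1 / p) * (2 powr M) powr (2 * \<eta> / p) * V powr (1 / 2) \<le> C1 powr (1 / p) * (4 powr (2 * \<epsilon>) * \<delta> powr (- \<epsilon>)) * V powr (1 / 2)"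
          using C1 by (intro mult_right_mono mult_left_mono) auto
        then show ?thesis by (simp add: C_def mult_ac)
      qed
      also have "V powr (1 / 2) = (\<Sum>j<N. v j ^ 2) powr (1 / 2)" by (simp add: V_def)
      also have "ennreal (C * \<delta> powr (- \<epsilon>) * (\<Sum>j<N. v j ^ 2) powr (1 / 2)) = ennreal (C * \<delta> powr (- \<epsilon>)) * ennreal_powr (\<Sum>j<N. (Lp_norm p (E j))\<^sup>2) (1 / 2)"
      proof -
        have "(\<Sum>j<N. (Lp_norm p (E j))\<^sup>2) = (\<Sum>j<N. ennreal (v j ^ 2))"
          using v0 by (intro sum.cong) (auto simp: v_def ennreal_power)
        also have "\<dots> = ennreal (\<Sum>j<N. v j ^ 2)" by (rule sum_ennreal) auto
        finally show ?thesis using pos by (simp add: ennreal_powr_def ennreal_mult' sum_nonneg)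
      qed
      finally show "Lp_norm p (extension_op \<nu> {0..1} g) \<le> ennreal (C * \<delta> powr (- \<epsilon>)) * ennreal_powr (\<Sum>j<N. (Lp_norm p (E j))\<^sup>2) (1 / 2)"
        by (simp add: ennreal_leI)
    qed
  qed
qed

end
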